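(* Let $\mathcal{C}$ be a divisible properly open convex set in $\mathbb{P}^n$ and let $\mathcal{H}$ be a horoball of $\overline{\mathcal{C}}$. Then $$\lambda_1(\mathcal{C})=\lambda_1(\mathcal{H}).$$
   Context: A properly open convex set of the real projective space $\mathbb{P}^n$ is a nonempty open set which, in some affine chart $\cong\mathbb{R}^n$ (complement of a projective hyperplane), is a bounded open convex set. The following are computed in such a chart and are projectively invariant. Hilbert distance: for distinct $p,q\in\mathcal{C}$, the line through $p,q$ meets $\partial\mathcal{C}$ at $a,b$, in the order $a,p,q,b$, and $d_{\mathcal{C}}(p,q)=\frac12\ln\left(\frac{\|q-a\|}{\|p-a\|}\cdot\frac{\|p-b\|}{\|q-b\|}\right)$. Finsler metric: for $v\ne0$, with $p^\pm$ the intersections of $\partial\mathcal{C}$ with the line through $p$ directed by $v$, $F_{\mathcal{C}}(p,v)=\frac12\|v\|\left(\frac1{\|p-p^-\|}+\frac1{\|p-p^+\|}\right)$, $F_{\mathcal{C}}(p,0)=0$; dual norm $\|\ell\|_{\mathcal{C}}^*=\sup\{|\ell(v)|: F_{\mathcal{C}}(p,v)\le1\}$. Hilbert measure: $\mu_{\mathcal{C}}(A)=\int_A \frac{\omega_n}{\mathrm{Vol}(\{v: F_{\mathcal{C}}(p,v)<1\})}\,d\mathrm{Vol}(p)$, with $\mathrm{Vol}$ Lebesgue measure and $\omega_n$ the volume of the Euclidean unit ball of $\mathbb{R}^n$. $\lambda_1(\mathcal{C})=\inf_f \frac{\int_{\mathcal{C}}(\|df_p\|_{\mathcal{C}}^*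 )^2\,d\mu_{\mathcal{C}}(p)}{\int_{\mathcal{C}}f^2(p)\,d\mu_{\mathcal{C}}(p)}$ over nonzero Lipschitz functions $f$ with compact support in $\mathcal{C}$. For a horoball $\mathcal{H}$, $\lambda_1(\mathcal{H})$ is the infimum of the same quotient (same $\|\cdot\|^*_{\mathcal{C}}$ and $\mu_{\mathcal{C}}$) over nonzero Lipschitz functions with compact support contained in the interior of $\mathcal{H}$. A horoball of $\overline{\mathcal{C}}$ is a set $\mathcal{H}$ such that, for some $x_0\in\mathcal{C}$ and $p\in\partial\mathcal{C}$, the balls $B_{\mathcal{C}}(x,d_{\mathcal{C}}(x,x_0))$, with $x$ in the open segment $(x_0,p)\subset\mathcal{C}$, converge to $\mathcal{H}$ as $x\to p$ for the Hausdorff topology of $\mathbb{P}^n$. $\mathcal{C}$ is divisible if there is a subgroup of isometries of $(\mathcal{C},d_{\mathcal{C}})$ acting cocompactly on $\mathcal{C}$. *)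

theory Defs
  imports "HOL-Analysis.Analysis" "HOL-Algebra.Bij"
begin

section \<open>Real projective space\<close>

text \<open>
  The dimension is \<open>n = CARD('n)\<close>, and \<open>\<R>\<^sup>n\<^sup>+\<^sup>1\<close> is represented by \<^typ>\<open>(real ^ 'n) \<times> real\<close>.
\<close>

quotient_type (overloaded) 'n projective = "(real ^ 'n::finite) \<times> real" /
    partial: "\<lambda>x y. x \<noteq> 0 \<and> (\<exists>c. c \<noteq> 0 \<and> y = c *\<^sub>R x)"
proof (rule part_equivpI)
  show "\<exists>x::(real ^ 'n) \<times> real. x \<noteq> 0 \<and> (\<exists>c. c \<noteq> 0 \<and> x = c *\<^sub>R x)"
    by (intro exI[of _ "(0, 1)"] conjI exI[of _ 1]) (auto simp: zero_prod_def)
  show "symp (\<lambda>x y::(real ^ 'n) \<times> real. x \<noteq> 0 \<and> (\<exists>c. c \<noteq> 0 \<and> y = c *\<^sub>R x))"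
  proof (rule sympI, elim conjE exE, intro conjI)
    fix x y :: "(real ^ 'n) \<times> real" and c
    assume "x \<noteq> 0" "c \<noteq> 0" "y = c *\<^sub>R x"
    then show "y \<noteq> 0" "\<exists>c. c \<noteq> 0 \<and> x = c *\<^sub>R y"
      by (auto intro!: exI[of _ "inverse c"])
  qed
  show "transp (\<lambda>x y::(real ^ 'n) \<times> real. x \<noteq> 0 \<and> (\<exists>c. c \<noteq> 0 \<and> y = c *\<^sub>R x))"
  proof (rule transpI, elim conjE exE, intro conjI)
    fix x y z :: "(real ^ 'n) \<times> real" and c d
    assume "x \<noteq> 0" "c \<noteq> 0" "y = c *\<^sub>R x" "d \<noteq> 0" "z = d *\<^sub>R y"
    then show "x \<noteq> 0" "\<exists>c. c \<noteq> 0 \<and> z = c *\<^sub>R x"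
      by (auto intro!: exI[of _ "d * c"])
  qed
qed

lemma projective_cases:
  obtains x where "x \<noteq> 0" "P = abs_projective x"
proof -
  have "\<exists>x. x \<noteq> 0 \<and> P = abs_projective x"
    by (induct P rule: projective.abs_induct) auto
  then show ?thesis using that by blast
qed

lemma abs_projective_eq_iff:
  assumes "x \<noteq> 0" "y \<noteq> 0"
  shows "abs_projective x = abs_projective y \<longleftrightarrow> (\<exists>c. c \<noteq> 0 \<and> y = c *\<^sub>R x)"
  using Quotient3_rel[OF Quotient3_projective, of x y] assms
  by (metis scaleR_one zero_neq_one)

lemma sgn_proportional_cases:
  fixes x y :: "'a::real_normed_vector"
  assumes "c \<noteq> 0" "y = c *\<^sub>R x"
  shows "sgn y = sgn x \<or> sgn y = - sgn x"
  using assms by (cases "c > 0") (auto simp: sgn_scaleR sgn_if)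

instantiation projective :: (finite) metric_space
begin

text \<open>The distance between two lines is the chordal distance of their pairs of unit vectors.\<close>

lift_definition dist_projective :: "'a projective \<Rightarrow> 'a projective \<Rightarrow> real"
  is "\<lambda>x y. min (norm (sgn x - sgn y)) (norm (sgn x + sgn y))"
proof -
  fix x x' y y' :: "(real ^ 'a) \<times> real"
  assume "x \<noteq> 0 \<and> (\<exists>c. c \<noteq> 0 \<and> x' = c *\<^sub>R x)" "y \<noteq> 0 \<and> (\<exists>c. c \<noteq> 0 \<and> y' = c *\<^sub>R y)"
  then have *: "sgn x' = sgn x \<or> sgn x' = - sgn x" "sgn y' = sgn y \<or> sgn y' = - sgn y"
    using sgn_proportional_cases by blast+
  have neg: "min (norm (- a - b)) (norm (- a + b)) = min (norm (a - b)) (norm (a + b))"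
      "min (norm (a - (- b))) (norm (a + (- b))) = min (norm (a - b)) (norm (a + b))"
    for a b :: "(real ^ 'a) \<times> real"
    using norm_minus_cancel[of "a + b"] norm_minus_cancel[of "a - b"]
    by (simp_all add: min.commute)
  show "min (norm (sgn x - sgn y)) (norm (sgn x + sgn y)) =
        min (norm (sgn x' - sgn y')) (norm (sgn x' + sgn y'))"
    using * by (elim disjE; simp only: neg)
qed

definition uniformity_projective :: "('a projective \<times> 'a projective) filter"
  where "uniformity_projective = (INF e\<in>{0<..}. principal {(x, y). dist x y < e})"

definition open_projective :: "'a projective set \<Rightarrow> bool"
  where "open_projective U \<longleftrightarrow>
    (\<forall>x\<in>U. eventually (\<lambda>(x', y). x' = x \<longrightarrow> y \<in> U) uniformity)"

instance
proof
  show "dist x y = 0 \<longleftrightarrow> x = y" for x y :: "'a projective"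
  proof (transfer, elim conjE exE)
    fix x x' y y' :: "(real ^ 'a) \<times> real"
    assume nz: "x \<noteq> 0" "y \<noteq> 0"
    have "(\<exists>c. c \<noteq> 0 \<and> y = c *\<^sub>R x)" if s: "sgn x = sgn y \<or> sgn x = - sgn y"
    proof -
      have y: "norm y *\<^sub>R sgn y = y" using nz by (simp add: sgn_div_norm)
      have "sgn y = sgn x \<or> sgn y = - sgn x" using s by auto
      then have "norm y *\<^sub>R sgn y = norm y *\<^sub>R sgn x \<or> norm y *\<^sub>R sgn y = norm y *\<^sub>R (- sgn x)"
        by (elim disjE) simp_all
      then have "y = norm y *\<^sub>R sgn x \<or> y = norm y *\<^sub>R (- sgn x)" by (simp only: y)
      then have "y = (norm y / norm x) *\<^sub>R x \<or> y = (- (norm y / norm x)) *\<^sub>R x"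
        by (simp add: sgn_div_norm divide_inverse)
      moreover have "norm y / norm x \<noteq> 0" "- (norm y / norm x) \<noteq> 0" using nz by simp_all
      ultimately show ?thesis by blast
    qed
    moreover have "sgn x = sgn y \<or> sgn x = - sgn y" if "c \<noteq> 0" "y = c *\<^sub>R x" for c
      using sgn_proportional_cases[OF that] by auto
    ultimately show "(min (norm (sgn x - sgn y)) (norm (sgn x + sgn y)) = 0) =
        (x \<noteq> 0 \<and> (\<exists>c. c \<noteq> 0 \<and> y = c *\<^sub>R x))"
      using nz by (auto simp: min_def eq_neg_iff_add_eq_0)
  qed
  show "dist x y \<le> dist x z + dist y z" for x y z :: "'a projective"
  proof (transfer, elim conjE exE)
    fix x y z :: "(real ^ 'a) \<times> real"
    have *: "norm (a - b) \<le> norm (a - c) + norm (b - c)"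
      "norm (a + b) \<le> norm (a - c) + norm (b + c)"
      "norm (a + b) \<le> norm (a + c) + norm (b - c)"
      "norm (a - b) \<le> norm (a + c) + norm (b + c)" for a b c :: "(real ^ 'a) \<times> real"
      by norm+
    show "min (norm (sgn x - sgn y)) (norm (sgn x + sgn y)) \<le>
          min (norm (sgn x - sgn z)) (norm (sgn x + sgn z)) +
          min (norm (sgn y - sgn z)) (norm (sgn y + sgn z))"
      using *[of "sgn x" "sgn y" "sgn z"] by (auto simp: min_def)
  qed
qed (rule uniformity_projective_def open_projective_def)+

end

text \<open>This metric induces the quotient topology.\<close>

lemma open_projective_iff:
  fixes U :: "'n::finite projective set"
  shows "open U \<longleftrightarrow> open {x. x \<noteq> 0 \<and> abs_projective x \<in> U}"
proof
  have d: "dist (abs_projective x) (abs_projective y) =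
      min (norm (sgn x - sgn y)) (norm (sgn x + sgn y))"
    if "x \<noteq> 0" "y \<noteq> 0" for x y :: "(real ^ 'n) \<times> real"
    by (rule dist_projective.abs_eq) (use that in \<open>auto intro!: exI[of _ 1]\<close>)
  show "open {x. x \<noteq> 0 \<and> abs_projective x \<in> U}" if "open U"
  proof -
    have "continuous_on (- {0}) (abs_projective :: _ \<Rightarrow> 'n projective)"
      unfolding continuous_on_iff
    proof (intro ballI allI impI)
      fix x :: "(real ^ 'n) \<times> real" and e :: real
      assume x: "x \<in> - {0}" and e: "0 < e"
      have "continuous_on (- {0}) (sgn :: (real ^ 'n) \<times> real \<Rightarrow> _)"
        unfolding sgn_div_norm by (intro continuous_intros) auto
      then obtain k where "k > 0" and
        k: "\<And>y. y \<in> - {0} \<Longrightarrow> dist y x < k \<Longrightarrow> dist (sgn y) (sgn x) < e"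
        using x e unfolding continuous_on_iff by blast
      then show "\<exists>k>0. \<forall>y\<in>- {0}. dist y x < k \<longrightarrow>
          dist (abs_projective y :: 'n projective) (abs_projective x) < e"
        using x by (intro exI[of _ k]) (auto simp: d dist_norm min_less_iff_disj)
    qed
    then have "open (abs_projective -` U \<inter> - {0})"
      using that by (subst (asm) continuous_on_open_vimage) auto
    then show ?thesis by (simp add: vimage_def Int_def conj_commute)
  qed
  show "open U" if V: "open {x. x \<noteq> 0 \<and> abs_projective x \<in> U}"
    unfolding open_dist
  proof
    fix P assume P: "P \<in> U"
    obtain x where x: "x \<noteq> 0" "P = abs_projective x"
      by (rule projective_cases)
    have abs_scale: "abs_projective (c *\<^sub>R y) = (abs_projective y :: 'n projective)"
      if "y \<noteq> 0" "c \<noteq> 0" for y c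
      using that by (subst eq_commute, subst abs_projective_eq_iff) auto
    have abs_sgn: "abs_projective (sgn y) = (abs_projective y :: 'n projective)"
      "abs_projective (- sgn y) = (abs_projective y :: 'n projective)" if "y \<noteq> 0" for y
      using abs_scale[OF that, of "inverse (norm y)"] abs_scale[OF that, of "- inverse (norm y)"]
        that by (simp_all add: sgn_div_norm)
    have "sgn x \<in> {x. x \<noteq> 0 \<and> abs_projective x \<in> U}"
      using x P by (simp add: abs_sgn sgn_zero_iff)
    with V obtain e where e: "e > 0"
      "\<And>y. dist y (sgn x) < e \<Longrightarrow> y \<noteq> 0 \<and> abs_projective y \<in> U"
      unfolding open_dist by blast
    have "Q \<in> U" if Q: "dist Q P < e" for Q
    proof -
      obtain y where y: "y \<noteq> 0" "Q = abs_projective y"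
        by (rule projective_cases)
      have "dist (sgn y) (sgn x) < e \<or> dist (- sgn y) (sgn x) < e"
        using Q x y norm_minus_cancel[of "sgn y + sgn x"]
        by (auto simp: d dist_norm min_less_iff_disj)
      then show ?thesis using e(2) abs_sgn y by metis
    qed
    then show "\<exists>e>0. \<forall>y. dist y P < e \<longrightarrow> y \<in> U" using e(1) by blast
  qed
qed

section \<open>Affine charts and properly open convex sets\<close>

text \<open>
  For a linear automorphism \<open>g\<close> of \<open>\<R>\<^sup>n\<^sup>+\<^sup>1\<close>, the map \<open>affine_point g\<close> is the parametrization by
  \<open>\<R>\<^sup>n\<close> of the complement of the projective hyperplane \<open>{[g (v, 0)] | v \<noteq> 0}\<close>, that is, the inverse
  of an affine chart. Every affine chart, with every affine coordinate system on it, arises so.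
\<close>

type_synonym 'n chart = "(real ^ 'n) \<times> real \<Rightarrow> (real ^ 'n) \<times> real"

definition affine_point :: "'n::finite chart \<Rightarrow> real ^ 'n \<Rightarrow> 'n projective"
  where "affine_point g v = abs_projective (g (v, 1))"

definition affine_coord :: "'n::finite chart \<Rightarrow> 'n projective \<Rightarrow> real ^ 'n"
  where "affine_coord g = inv_into UNIV (affine_point g)"

definition affine_trace :: "'n::finite chart \<Rightarrow> 'n projective set \<Rightarrow> (real ^ 'n) set"
  where "affine_trace g S = affine_point g -` S"

definition adapted_chart :: "'n::finite chart \<Rightarrow> 'n projective set \<Rightarrow> bool"
  where "adapted_chart g C \<longleftrightarrow>
    linear g \<and> bij g \<and> C \<subseteq> range (affine_point g) \<and>
    bounded (affine_trace g C) \<and> open (affine_trace g C) \<and> convex (affine_trace g C)"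

definition properly_open_convex :: "'n::finite projective set \<Rightarrow> bool"
  where "properly_open_convex C \<longleftrightarrow> C \<noteq> {} \<and> open C \<and> (\<exists>g. adapted_chart g C)"

lemma inj_affine_point:
  assumes "linear g" "bij g"
  shows "inj (affine_point g)"
proof (rule injI)
  fix v w assume eq: "affine_point g v = affine_point g w"
  have nz: "g (u, 1) \<noteq> 0" for u
    using inj_eq[OF bij_is_inj[OF assms(2)], of "(u, 1)" 0] linear_0[OF assms(1)]
    by (simp add: zero_prod_def)
  obtain c where "g (w, 1) = c *\<^sub>R g (v, 1)"
    using eq nz by (auto simp: affine_point_def abs_projective_eq_iff)
  then have "g (w, 1) = g (c *\<^sub>R (v, 1))" by (simp only: linear_scale[OF assms(1)])
  then have "(w, 1 :: real) = c *\<^sub>R (v, 1)" by (rule injD[OF bij_is_inj[OF assms(2)]])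
  then show "v = w" by simp
qed

section \<open>Hilbert geometry of a bounded open convex set of \<open>\<R>\<^sup>n\<close>\<close>

definition exit_point :: "(real ^ 'n::finite) set \<Rightarrow> real ^ 'n \<Rightarrow> real ^ 'n \<Rightarrow> real ^ 'n"
  where "exit_point \<Omega> p v = (THE x. x \<in> frontier \<Omega> \<and> (\<exists>t>0. x = p + t *\<^sub>R v))"

definition affine_hilbert_dist :: "(real ^ 'n::finite) set \<Rightarrow> real ^ 'n \<Rightarrow> real ^ 'n \<Rightarrow> real"
  where "affine_hilbert_dist \<Omega> p q =
    (if p = q then 0 else
     let a = exit_point \<Omega> p (p - q); b = exit_point \<Omega> q (q - p)
     in 1 / 2 * ln (norm (q - a) / norm (p - a) * (norm (p - b) / norm (q - b))))"

definition finsler :: "(real ^ 'n::finite) set \<Rightarrow> real ^ 'n \<Rightarrow> real ^ 'n \<Rightarrow> real"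
  where "finsler \<Omega> p v =
    (if v = 0 then 0 else
     1 / 2 * norm v * (1 / norm (p - exit_point \<Omega> p (- v)) + 1 / norm (p - exit_point \<Omega> p v)))"

definition dual_norm :: "(real ^ 'n::finite) set \<Rightarrow> real ^ 'n \<Rightarrow> (real ^ 'n \<Rightarrow> real) \<Rightarrow> real"
  where "dual_norm \<Omega> p l = (SUP v\<in>{v. finsler \<Omega> p v \<le> 1}. \<bar>l v\<bar>)"

definition hilbert_measure :: "(real ^ 'n::finite) set \<Rightarrow> (real ^ 'n) measure"
  where "hilbert_measure \<Omega> = density lebesgue
    (\<lambda>p. ennreal (indicator \<Omega> p * measure lebesgue (ball (0 :: real ^ 'n) 1)
                    / measure lebesgue {v. finsler \<Omega> p v < 1}))"

text \<open>
  A Lipschitz function is differentiable almost everywhere; on the null set where it is not,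
  the value 0 is a dummy.
\<close>

definition differential_norm :: "(real ^ 'n::finite) set \<Rightarrow> (real ^ 'n \<Rightarrow> real) \<Rightarrow> real ^ 'n \<Rightarrow> real"
  where "differential_norm \<Omega> f p =
    (if f differentiable (at p) then dual_norm \<Omega> p (frechet_derivative f (at p)) else 0)"

definition rayleigh_quotient :: "(real ^ 'n::finite) set \<Rightarrow> (real ^ 'n \<Rightarrow> real) \<Rightarrow> ennreal"
  where "rayleigh_quotient \<Omega> f =
    (\<integral>\<^sup>+p. ennreal ((differential_norm \<Omega> f p)\<^sup>2) \<partial>hilbert_measure \<Omega>) /
    (\<integral>\<^sup>+p. ennreal ((f p)\<^sup>2) \<partial>hilbert_measure \<Omega>)"

section \<open>Hilbert geometry of a properly open convex set\<close>

text \<open>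
  In the following, \<open>g\<close> is meant to be a chart adapted to \<open>C\<close>, in which the notions are
  computed; by projective invariance its choice does not matter.
\<close>

definition hilbert_dist ::
  "'n::finite chart \<Rightarrow> 'n projective set \<Rightarrow> 'n projective \<Rightarrow> 'n projective \<Rightarrow> real"
  where "hilbert_dist g C P Q =
    affine_hilbert_dist (affine_trace g C) (affine_coord g P) (affine_coord g Q)"

definition hilbert_ball ::
  "'n::finite chart \<Rightarrow> 'n projective set \<Rightarrow> 'n projective \<Rightarrow> real \<Rightarrow> 'n projective set"
  where "hilbert_ball g C X r = {Y \<in> C. hilbert_dist g C X Y < r}"

text \<open>\<open>test_functions g C U\<close>: nonzero Lipschitz functions on \<open>C\<close> with compact support contained in \<open>U\<close>.\<close>

definition test_functions ::
  "'n::finite chart \<Rightarrow> 'n projective set \<Rightarrow> 'n projective set \<Rightarrow> ('n projective \<Rightarrow> real) set"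
  where "test_functions g C U =
    {f. (\<exists>L. \<forall>P\<in>C. \<forall>Q\<in>C. \<bar>f P - f Q\<bar> \<le> L * hilbert_dist g C P Q) \<and>
        (\<exists>P\<in>C. f P \<noteq> 0) \<and>
        compact (closure {P \<in> C. f P \<noteq> 0}) \<and> closure {P \<in> C. f P \<noteq> 0} \<subseteq> U}"

definition lambda1_on ::
  "'n::finite chart \<Rightarrow> 'n projective set \<Rightarrow> 'n projective set \<Rightarrow> ennreal"
  where "lambda1_on g C U =
    (INF f\<in>test_functions g C U. rayleigh_quotient (affine_trace g C) (f \<circ> affine_point g))"

definition lambda1 ::
  "'n::finite chart \<Rightarrow> 'n projective set \<Rightarrow> ennreal"
  where "lambda1 g C = lambda1_on g C C"

definition lambda1_horoball ::
  "'n::finite chart \<Rightarrow> 'n projective set \<Rightarrow> 'n projective set \<Rightarrow> ennreal"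
  where "lambda1_horoball g C H = lambda1_on g C (interior H)"

definition hausdorff_dist :: "'a::metric_space set \<Rightarrow> 'a set \<Rightarrow> real"
  where "hausdorff_dist A B = max (SUP a\<in>A. infdist a B) (SUP b\<in>B. infdist b A)"

text \<open>
  The Hausdorff topology lives on the nonempty compact sets, so the balls are replaced by their
  closures, and a horoball is compact.
\<close>

definition horoball ::
  "'n::finite chart \<Rightarrow> 'n projective set \<Rightarrow> 'n projective set \<Rightarrow> bool"
  where "horoball g C H \<longleftrightarrow> compact H \<and> H \<noteq> {} \<and>
    (\<exists>X0\<in>C. \<exists>P\<in>frontier C.
      ((\<lambda>X. hausdorff_dist (closure (hilbert_ball g C X (hilbert_dist g C X X0))) H) \<longlongrightarrow> 0)
        (at P within affine_point g ` open_segment (affine_coord g X0) (affine_coord g P)))"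

definition divisible ::
  "'n::finite chart \<Rightarrow> 'n projective set \<Rightarrow> bool"
  where "divisible g C \<longleftrightarrow>
    (\<exists>\<Gamma>. subgroup \<Gamma> (BijGroup C) \<and>
      (\<forall>\<gamma>\<in>\<Gamma>. \<forall>P\<in>C. \<forall>Q\<in>C. hilbert_dist g C (\<gamma> P) (\<gamma> Q) = hilbert_dist g C P Q) \<and>
      (\<exists>K\<subseteq>C. compact K \<and> (\<Union>\<gamma>\<in>\<Gamma>. \<gamma> ` K) = C))"

end

(* In an affine chart put k(p,q) = 1 + j(p,p-q), where j(p,-) is the Minkowski functional of Omega - p. Then
   2 d(p,q) = ln k(p,q) + ln k(q,p), and k is submultiplicative, so d is a metric; and 2 d(p,q) is the difference
   ln (1 + j(q,q-p)) - ln (1 - j(q,p-q)) whose ingredients are convex in p.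

   The interior of the horoball lies in C and contains balls of arbitrarily large radius, hence, by cocompactness,
   an isometric copy of any compact subset of C. So only the invariance of the Rayleigh quotient under isometries T
   of d is to be shown. These need not be projective maps. But convex functions are differentiable almost
   everywhere, hence so are the functions d(-,z), and since d(T x, z) = d(x, T^{-1} z) and the gradients of
   the d(-,z), with z in a dense set, span, T itself is differentiable almost everywhere. The derivative of T is an
   isometry for the Finsler norms, so T preserves the norm of differentials and, by the change of variables formula,
   the Hilbert measure. *)

theory Submission
  imports Defs
begin

section \<open>The Minkowski functional of a bounded open convex set\<close>

text \<open>The obstacle is that \<open>T\<close> is only known to be locally Lipschitz. If the
  distance to z is differentiable at \<open>T x\<close> with derivative D, and its composition with
  \<open>T\<close> is differentiable at x, then D composed with \<open>T\<close> is differentiable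
  at x; so the question is whether there are enough such D. They span because the derivative of the
  distance to z is strictly negative towards every point closer to z: a vector v annihilated by all
  D contradicts this as soon as z is chosen close to \<open>T x + t v\<close>. The exceptional
  points sit partly at x and partly at \<open>T x\<close>, so isometries must be shown to carry null
  sets to null sets beforehand.

  No Jacobian is evaluated for \<open>T\<close>. The derivative maps the Finsler unit ball at x onto
  the one at \<open>T x\<close>, and the volume of the unit ball times the density is the same
  constant \<omega>_n at both ends. For the Rayleigh quotient one inequality suffices: the numerator
  is compared through one isometry and the denominator through its inverse.\<close>

definition radial_gauge :: "'a::real_normed_vector set \<Rightarrow> 'a \<Rightarrow> 'a \<Rightarrow> real"
  where "radial_gauge \<Omega> p v = Inf {t. 0 < t \<and> p + v /\<^sub>R t \<in> \<Omega>}"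

text \<open>Gauges are known through strict sublevel conditions, and these only at positive levels;
  this is how an equation between nonnegative numbers is read off from them.\<close>

lemma eq_by_upper_bounds:
  fixes a b :: real
  assumes "0 \<le> a" "0 \<le> b" "\<And>t. 0 < t \<Longrightarrow> a < t \<longleftrightarrow> b < t"
  shows "a = b"
  by (metis assms linorder_less_linear order_le_less_trans order_less_irrefl)

locale convex_domain =
  fixes \<Omega> :: "'a::euclidean_space set"
  assumes open_domain: "open \<Omega>" and convex_domain: "convex \<Omega>" and bounded_domain: "bounded \<Omega>"
begin

abbreviation gauge where "gauge \<equiv> radial_gauge \<Omega>"

lemma gauge_set_nonempty:
  assumes "p \<in> \<Omega>"
  obtains t where "0 < t" "p + v /\<^sub>R t \<in> \<Omega>"
proof -
  obtain e where e: "e > 0" "ball p e \<subseteq> \<Omega>"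
    using open_domain assms open_contains_ball by blast
  define t where "t = (norm v + 1) / e"
  have t: "t > 0" using e by (simp add: t_def add_nonneg_pos)
  have "norm v < t * e" using e by (simp add: t_def)
  then have "norm (v /\<^sub>R t) < e" using t by (simp add: field_simps)
  then have "p + v /\<^sub>R t \<in> \<Omega>" using e(2) by (auto simp: dist_norm subset_iff)
  with t show ?thesis by (rule that)
qed

lemma gauge_nonneg:
  assumes "p \<in> \<Omega>"
  shows "0 \<le> gauge p v"
  unfolding radial_gauge_def
  using gauge_set_nonempty[OF assms, of v] by (intro cInf_greatest) auto

text \<open>Openness lets an admissible t be decreased slightly, which makes the bound strict;
  convexity with p in the domain makes the admissible t upward closed. From here on the infimum is
  used only through this equivalence.\<close>

lemma gauge_less_iff:
  assumes p: "p \<in> \<Omega>" and t: "0 < t"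
  shows "gauge p v < t \<longleftrightarrow> p + v /\<^sub>R t \<in> \<Omega>"
proof
  have bdd: "bdd_below {t. 0 < t \<and> p + v /\<^sub>R t \<in> \<Omega>}"
    by (intro bdd_belowI[of _ 0]) auto
  show "gauge p v < t" if "p + v /\<^sub>R t \<in> \<Omega>"
  proof -
    have "((\<lambda>s. p + v /\<^sub>R s) \<longlongrightarrow> p + v /\<^sub>R t) (at_left t)"
      using t by (intro tendsto_intros) auto
    then have "\<forall>\<^sub>F s in at_left t. p + v /\<^sub>R s \<in> \<Omega>"
      using that open_domain topological_tendstoD by blast
    moreover have "\<forall>\<^sub>F s in at_left t. 0 < s \<and> s < t"
      using t eventually_at_left_real eventually_mono by fastforce
    ultimately have "\<forall>\<^sub>F s in at_left t. 0 < s \<and> s < t \<and> p + v /\<^sub>R s \<in> \<Omega>"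
      by eventually_elim auto
    then obtain s where "0 < s" "s < t" "p + v /\<^sub>R s \<in> \<Omega>"
      using eventually_happens' trivial_limit_at_left_real by blast
    then have "gauge p v \<le> s"
      unfolding radial_gauge_def by (intro cInf_lower bdd) auto
    with \<open>s < t\<close> show ?thesis by simp
  qed
  assume "gauge p v < t"
  then obtain s where s: "0 < s" "s < t" "p + v /\<^sub>R s \<in> \<Omega>"
    unfolding radial_gauge_def using gauge_set_nonempty[OF p, of v]
    by (metis (mono_tags, lifting) cInf_lessD empty_iff mem_Collect_eq)
  have "(1 - s / t) *\<^sub>R p + (s / t) *\<^sub>R (p + v /\<^sub>R s) \<in> \<Omega>"
    using convex_domain p s by (intro convexD) auto
  moreover have "(1 - s / t) *\<^sub>R p + (s / t) *\<^sub>R (p + v /\<^sub>R s) = p + v /\<^sub>R t"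
    by (rule euclidean_eqI) (use s in \<open>simp add: inner_simps field_simps\<close>)
  ultimately show "p + v /\<^sub>R t \<in> \<Omega>" by simp
qed

lemma gauge_less_one_iff: "p \<in> \<Omega> \<Longrightarrow> gauge p v < 1 \<longleftrightarrow> p + v \<in> \<Omega>"
  using gauge_less_iff[of p 1 v] by simp

lemma gauge_zero [simp]: "p \<in> \<Omega> \<Longrightarrow> gauge p 0 = 0"
  using gauge_less_iff[of p "gauge p 0" 0] gauge_nonneg[of p 0] by (force simp: order_le_less)

lemma gauge_scale:
  assumes p: "p \<in> \<Omega>" and c: "0 \<le> c"
  shows "gauge p (c *\<^sub>R v) = c * gauge p v"
proof (cases "c = 0")
  case False
  with c have c: "c > 0" by simp
  show ?thesis
  proof (rule eq_by_upper_bounds)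
    fix t :: real assume t: "t > 0"
    have "(c *\<^sub>R v) /\<^sub>R t = v /\<^sub>R (t / c)" using c by (simp add: divide_inverse mult.commute)
    then have "gauge p (c *\<^sub>R v) < t \<longleftrightarrow> gauge p v < t / c"
      using gauge_less_iff[OF p] c t by (metis zero_less_divide_iff)
    then show "gauge p (c *\<^sub>R v) < t \<longleftrightarrow> c * gauge p v < t"
      using c by (simp add: field_simps)
  qed (use p c gauge_nonneg in auto)
qed (use p in simp)

text \<open>With s and t slightly above the two gauges, p + (u + v) / (s + t) is the convex
  combination of p + u / s and p + v / t with weights s / (s + t) and t / (s + t).\<close>

lemma gauge_triangle:
  assumes p: "p \<in> \<Omega>"
  shows "gauge p (u + v) \<le> gauge p u + gauge p v"
proof (rule field_le_epsilon)
  fix e :: real assume "e > 0"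
  define s where "s = gauge p u + e / 2"
  define t where "t = gauge p v + e / 2"
  have pos: "s > 0" "t > 0" using gauge_nonneg[OF p] \<open>e > 0\<close> by (simp_all add: s_def t_def add_nonneg_pos)
  have "p + u /\<^sub>R s \<in> \<Omega>" "p + v /\<^sub>R t \<in> \<Omega>"
    using gauge_less_iff[OF p, of s u] gauge_less_iff[OF p, of t v] pos \<open>e > 0\<close>
    by (simp_all add: s_def t_def)
  then have "(s / (s + t)) *\<^sub>R (p + u /\<^sub>R s) + (t / (s + t)) *\<^sub>R (p + v /\<^sub>R t) \<in> \<Omega>"
    using pos convex_domain by (intro convexD) (auto simp: add_divide_distrib[symmetric])
  moreover have "(s / (s + t)) *\<^sub>R (p + u /\<^sub>R s) + (t / (s + t)) *\<^sub>R (p + v /\<^sub>R t)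
      = p + (u + v) /\<^sub>R (s + t)"
  proof (rule euclidean_eqI)
    fix e :: 'a
    have "s * (P + U / s) + t * (P + V / t) = (s + t) * P + (U + V)" for P U V
      using pos by (simp add: field_simps)
    then have "(s * (P + U / s) + t * (P + V / t)) / (s + t) = P + (U + V) / (s + t)" for P U V
      using pos by (simp add: add_divide_distrib)
    from this[of "p \<bullet> e" "u \<bullet> e" "v \<bullet> e"]
    show "((s / (s + t)) *\<^sub>R (p + u /\<^sub>R s) + (t / (s + t)) *\<^sub>R (p + v /\<^sub>R t)) \<bullet> e
        = (p + (u + v) /\<^sub>R (s + t)) \<bullet> e"
      by (simp add: inner_simps add_divide_distrib divide_inverse mult_ac distrib_left)
  qed
  ultimately have "p + (u + v) /\<^sub>R (s + t) \<in> \<Omega>" by simp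
  then have "gauge p (u + v) < s + t" using gauge_less_iff[OF p] pos by simp
  then show "gauge p (u + v) \<le> gauge p u + gauge p v + e" by (simp add: s_def t_def)
qed

lemma convex_on_gauge: "p \<in> \<Omega> \<Longrightarrow> convex_on UNIV (gauge p)"
  by (rule convex_onI) (use gauge_triangle gauge_scale in \<open>metis diff_ge_0_iff_ge order_less_imp_le\<close>, simp)

section \<open>Comparison of the gauge with the Euclidean norm\<close>

lemma gauge_le_norm:
  assumes p: "p \<in> \<Omega>" and r: "0 < r" "ball p r \<subseteq> \<Omega>"
  shows "gauge p v \<le> norm v / r"
proof (rule dense_ge)
  fix t assume t: "norm v / r < t"
  then have "t > 0" using r by (meson divide_nonneg_pos norm_ge_zero order_le_less_trans)
  then have "norm (v /\<^sub>R t) < r" using t r by (simp add: field_simps)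
  then have "p + v /\<^sub>R t \<in> \<Omega>" using r by (auto simp: subset_iff dist_norm)
  then show "gauge p v \<le> t" using gauge_less_iff[OF p \<open>t > 0\<close>] by (simp add: less_imp_le)
qed

lemma domain_radius:
  obtains D where "0 < D" "\<And>x y. x \<in> \<Omega> \<Longrightarrow> y \<in> \<Omega> \<Longrightarrow> norm (x - y) \<le> D"
proof -
  obtain B where B: "B > 0" "\<And>x. x \<in> \<Omega> \<Longrightarrow> norm x \<le> B" using bounded_domain bounded_pos by blast
  have "norm (x - y) \<le> 2 * B" if "x \<in> \<Omega>" "y \<in> \<Omega>" for x y
    using B(2)[OF that(1)] B(2)[OF that(2)] norm_triangle_ineq4[of x y] by linarith
  then show ?thesis using that[of "2 * B"] B by auto
qed

lemma norm_le_gauge: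
  assumes p: "p \<in> \<Omega>" and D: "0 < D" "\<And>x y. x \<in> \<Omega> \<Longrightarrow> y \<in> \<Omega> \<Longrightarrow> norm (x - y) \<le> D"
  shows "norm v / D \<le> gauge p v"
proof (rule dense_ge)
  fix t assume t: "gauge p v < t"
  then have t0: "t > 0" using gauge_nonneg[OF p] order_le_less_trans by blast
  then have "p + v /\<^sub>R t \<in> \<Omega>" using gauge_less_iff[OF p] t by blast
  then have "norm (v /\<^sub>R t) \<le> D" using D(2)[OF _ p, of "p + v /\<^sub>R t"] by simp
  then show "norm v / D \<le> t" using t0 D(1) by (simp add: field_simps)
qed

lemma gauge_pos: "p \<in> \<Omega> \<Longrightarrow> v \<noteq> 0 \<Longrightarrow> 0 < gauge p v"
  using domain_radius norm_le_gauge
  by (metis divide_pos_pos order_less_le_trans zero_less_norm_iff)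

lemma gauge_continuous: "p \<in> \<Omega> \<Longrightarrow> continuous_on UNIV (gauge p)"
  by (intro convex_on_continuous convex_on_gauge) auto

text \<open>A ray from the interior point p meets the frontier only once, since a point of the
  closure becomes interior when pulled towards p. A gauge above t would leave room for some s > t
  with p + v / s outside the domain, although that point is nearer to p than the frontier
  point.\<close>

lemma gauge_frontier:
  assumes p: "p \<in> \<Omega>" and t: "0 < t"
  shows "p + v /\<^sub>R t \<in> frontier \<Omega> \<longleftrightarrow> gauge p v = t"
proof
  show "gauge p v = t" if fr: "p + v /\<^sub>R t \<in> frontier \<Omega>"
  proof (rule ccontr)
    assume ne: "gauge p v \<noteq> t"
    have "p + v /\<^sub>R t \<notin> \<Omega>" using fr open_domain frontier_def interior_open by blast
    then have "\<not> gauge p v < t" using gauge_less_iff[OF p t] by blast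
    with ne have "t < gauge p v" by simp
    then obtain s where s: "t < s" "s < gauge p v" by (blast dest: dense)
    define x where "x = p + v /\<^sub>R t"
    have "x \<in> closure \<Omega>" using fr by (simp add: frontier_def x_def)
    moreover have "p + v /\<^sub>R s = x - (1 - t / s) *\<^sub>R (x - p)"
      unfolding x_def
      by (rule euclidean_eqI) (use s t in \<open>simp add: inner_simps field_simps\<close>)
    ultimately have "p + v /\<^sub>R s \<in> interior \<Omega>"
      using mem_interior_closure_convex_shrink[OF convex_domain, of p x "1 - t / s"]
        p t s open_domain by (simp add: interior_open)
    then show False using gauge_less_iff[OF p, of s v] s t interior_subset by fastforce
  qed
  assume eq: "gauge p v = t"
  have "((\<lambda>s. p + v /\<^sub>R s) \<longlongrightarrow> p + v /\<^sub>R t) (at_right t)"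
    using t by (intro tendsto_intros) auto
  moreover have "\<forall>\<^sub>F s in at_right t. p + v /\<^sub>R s \<in> closure \<Omega>"
  proof (rule eventually_mono[OF eventually_at_right_less])
    show "p + v /\<^sub>R s \<in> closure \<Omega>" if "t < s" for s
      using gauge_less_iff[OF p, of s v] eq t that closure_subset[of \<Omega>] by auto
  qed
  ultimately have "p + v /\<^sub>R t \<in> closure \<Omega>"
    by (intro Lim_in_closed_set[OF closed_closure _ trivial_limit_at_right_real])
  moreover have "p + v /\<^sub>R t \<notin> \<Omega>" using gauge_less_iff[OF p t] eq by blast
  ultimately show "p + v /\<^sub>R t \<in> frontier \<Omega>"
    using open_domain by (simp add: frontier_def interior_open)
qed

text \<open>The left-hand side is the predicate under the definite description in
  \<open>exit_point\<close>, which thereby becomes meaningful.\<close>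

lemma exit_unique:
  assumes p: "p \<in> \<Omega>" and v: "v \<noteq> 0"
  shows "x \<in> frontier \<Omega> \<and> (\<exists>t>0. x = p + t *\<^sub>R v) \<longleftrightarrow> x = p + v /\<^sub>R gauge p v"
proof -
  have "x \<in> frontier \<Omega> \<and> x = p + t *\<^sub>R v \<longleftrightarrow> x = p + v /\<^sub>R gauge p v \<and> gauge p v = 1 / t"
    if "t > 0" for t
    using gauge_frontier[OF p, of "1 / t" v] that by auto
  moreover have "gauge p v > 0" using gauge_pos[OF p v] .
  moreover have "x = p + v /\<^sub>R gauge p v \<Longrightarrow> x \<in> frontier \<Omega>"
    using gauge_frontier[OF p] gauge_pos[OF p v] by auto
  ultimately show ?thesis
    by (metis inverse_positive_iff_positive)
qed

text \<open>If b is the point where the ray from q through p leaves the domain, the first factor is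
  |q - b| / |p - b| and the second its reciprocal. The proof compares the two gauges at the levels l
  - 1 and (l - 1) / l, where both test the same point of that ray.\<close>

lemma gauge_mult_eq:
  assumes p: "p \<in> \<Omega>" and q: "q \<in> \<Omega>"
  shows "(1 + gauge p (p - q)) * (1 - gauge q (p - q)) = 1"
proof -
  have l: "gauge p (p - q) < l - 1 \<longleftrightarrow> gauge q (p - q) < (l - 1) / l" if l: "l > 1" for l
  proof -
    have "p + (p - q) /\<^sub>R (l - 1) = (1 + inverse (l - 1)) *\<^sub>R p - inverse (l - 1) *\<^sub>R q"
      by (simp add: algebra_simps)
    moreover have "q + (p - q) /\<^sub>R ((l - 1) / l) = (l / (l - 1)) *\<^sub>R p - (l / (l - 1) - 1) *\<^sub>R q"
      using l by (simp add: algebra_simps)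
    moreover have "l / (l - 1) = 1 + inverse (l - 1)" using l by (simp add: field_simps)
    ultimately have "p + (p - q) /\<^sub>R (l - 1) = q + (p - q) /\<^sub>R ((l - 1) / l)" by simp
    then show ?thesis using gauge_less_iff[OF p, of "l - 1"] gauge_less_iff[OF q, of "(l - 1) / l"] l
      by simp
  qed
  have lt1: "gauge q (p - q) < 1" using gauge_less_one_iff[OF q] p by simp
  have "gauge p (p - q) = inverse (1 - gauge q (p - q)) - 1"
  proof (rule eq_by_upper_bounds)
    show "0 \<le> gauge p (p - q)" by (rule gauge_nonneg[OF p])
    show "0 \<le> inverse (1 - gauge q (p - q)) - 1"
      using lt1 gauge_nonneg[OF q, of "p - q"] by (simp add: field_simps)
    fix t :: real assume "t > 0"
    then show "gauge p (p - q) < t \<longleftrightarrow> inverse (1 - gauge q (p - q)) - 1 < t"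
      using l[of "t + 1"] lt1 by (simp add: field_simps)
  qed
  then show ?thesis using lt1 by (simp add: field_simps)
qed

lemma gauge_mult_triangle:
  assumes p: "p \<in> \<Omega>" and q: "q \<in> \<Omega>" and r: "r \<in> \<Omega>"
  shows "1 + gauge p (p - r) \<le> (1 + gauge p (p - q)) * (1 + gauge q (q - r))"
proof -
  have *: "gauge p (p - r) < a + b + a * b" if a: "gauge p (p - q) < a" and b: "gauge q (q - r) < b" for a b
  proof -
    have pos: "a > 0" "b > 0" using a b gauge_nonneg p q order_le_less_trans by blast+
    \<comment> \<open>c = (1 + a) (1 + b) - 1. The weights below are chosen so that the multiples of
      q cancel in the combination of the two points.\<close>
    define c where "c = a + b + a * b"
    have c: "c > 0" unfolding c_def using pos by (intro add_pos_pos mult_pos_pos)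
    then have sum1: "(1 + b) * a / c + b / c = 1"
      by (simp add: add_divide_distrib[symmetric]) (simp add: c_def algebra_simps)
    have "p + (p - q) /\<^sub>R a \<in> \<Omega>" "q + (q - r) /\<^sub>R b \<in> \<Omega>"
      using gauge_less_iff[OF p] gauge_less_iff[OF q] a b pos by auto
    then have "((1 + b) * a / c) *\<^sub>R (p + (p - q) /\<^sub>R a) + (b / c) *\<^sub>R (q + (q - r) /\<^sub>R b) \<in> \<Omega>"
      by (intro convexD[OF convex_domain] sum1) (use pos c in auto)
    moreover have "((1 + b) * a / c) *\<^sub>R (p + (p - q) /\<^sub>R a) + (b / c) *\<^sub>R (q + (q - r) /\<^sub>R b)
      = p + (p - r) /\<^sub>R c"
    proof (rule euclidean_eqI)
      fix e :: 'a
      have "(1 + b) * a * (P + (P - Q) / a) + b * (Q + (Q - R) / b) = c * P + (P - R)" for P Q R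
        using pos by (simp add: field_simps c_def)
      then have "((1 + b) * a * (P + (P - Q) / a) + b * (Q + (Q - R) / b)) / c = P + (P - R) / c" for P Q R
        using c by (simp add: add_divide_distrib)
      then have "((1 + b) * a / c) * (P + (P - Q) / a) + (b / c) * (Q + (Q - R) / b) = P + (P - R) / c" for P Q R
        by (simp only: add_divide_distrib times_divide_eq_left)
      from this[of "p \<bullet> e" "q \<bullet> e" "r \<bullet> e"]
      show "(((1 + b) * a / c) *\<^sub>R (p + (p - q) /\<^sub>R a) + (b / c) *\<^sub>R (q + (q - r) /\<^sub>R b)) \<bullet> e
          = (p + (p - r) /\<^sub>R c) \<bullet> e"
        by (simp only: inner_simps divide_inverse_commute)
    qed
    ultimately have "p + (p - r) /\<^sub>R c \<in> \<Omega>" by simp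
    then show ?thesis using gauge_less_iff[OF p c] by (simp add: c_def)
  qed
  have "((\<lambda>e. (1 + (gauge p (p - q) + e)) * (1 + (gauge q (q - r) + e))) \<longlongrightarrow>
      (1 + (gauge p (p - q) + 0)) * (1 + (gauge q (q - r) + 0))) (at_right 0)"
    by (intro tendsto_intros)
  moreover have "\<forall>\<^sub>F e in at_right 0. 1 + gauge p (p - r) \<le>
      (1 + (gauge p (p - q) + e)) * (1 + (gauge q (q - r) + e))"
    unfolding eventually_at_right_field
  proof (intro exI[of _ 1] conjI allI impI)
    fix e :: real assume "0 < e"
    then show "1 + gauge p (p - r) \<le> (1 + (gauge p (p - q) + e)) * (1 + (gauge q (q - r) + e))"
      using *[of "gauge p (p - q) + e" "gauge q (q - r) + e"] by (simp add: algebra_simps)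
  qed simp
  ultimately show ?thesis
    by (intro tendsto_lowerbound) (auto)
qed

end

section \<open>The Hilbert distance\<close>

locale hilbert_domain = convex_domain \<Omega> for \<Omega> :: "(real ^ 'n::finite) set"
begin

abbreviation hdist where "hdist \<equiv> affine_hilbert_dist \<Omega>"

lemma exit_point_eq:
  assumes "p \<in> \<Omega>" "v \<noteq> 0"
  shows "exit_point \<Omega> p v = p + v /\<^sub>R gauge p v"
  unfolding exit_point_def exit_unique[OF assms] by simp

lemma finsler_eq:
  assumes p: "p \<in> \<Omega>"
  shows "finsler \<Omega> p v = (gauge p v + gauge p (- v)) / 2"
  using p gauge_pos[OF p, of v] gauge_pos[OF p, of "- v"]
  by (auto simp: finsler_def exit_point_eq field_simps)

lemma gauge_ratio_pos: "p \<in> \<Omega> \<Longrightarrow> 0 < 1 + gauge p v"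
  using gauge_nonneg[of p v] by simp

lemma gauge_diff_less_one: "p \<in> \<Omega> \<Longrightarrow> q \<in> \<Omega> \<Longrightarrow> gauge p (q - p) < 1"
  using gauge_less_one_iff[of p "q - p"] by simp

lemma hdist_eq:
  assumes p: "p \<in> \<Omega>" and q: "q \<in> \<Omega>"
  shows "hdist p q = (ln (1 + gauge p (p - q)) + ln (1 + gauge q (q - p))) / 2"
proof (cases "p = q")
  case True
  then show ?thesis using p by (simp add: affine_hilbert_dist_def)
next
  case False
  \<comment> \<open>Seen from the exit point beyond x, the points y and x lie at distances (1 + 1/m)
    |x - y| and (1/m) |x - y|, where m is the gauge; so each factor of the cross ratio is 1 +
    m.\<close>
  have ratio: "norm (y - exit_point \<Omega> x (x - y)) / norm (x - exit_point \<Omega> x (x - y)) = 1 + gauge x (x - y)"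
    if x: "x \<in> \<Omega>" and "x \<noteq> y" for x y
  proof -
    define m where "m = gauge x (x - y)"
    have m: "m > 0" using gauge_pos[OF x, of "x - y"] that by (simp add: m_def)
    have e: "exit_point \<Omega> x (x - y) = x + (x - y) /\<^sub>R m"
      using exit_point_eq[OF x, of "x - y"] that by (simp add: m_def)
    have "y - exit_point \<Omega> x (x - y) = - ((1 + inverse m) *\<^sub>R (x - y))"
      unfolding e by (simp add: algebra_simps)
    then have "norm (y - exit_point \<Omega> x (x - y)) = (1 + inverse m) * norm (x - y)"
      using m by simp
    moreover have "norm (x - exit_point \<Omega> x (x - y)) = inverse m * norm (x - y)"
      using m unfolding e by simp
    ultimately have "norm (y - exit_point \<Omega> x (x - y)) / norm (x - exit_point \<Omega> x (x - y))
        = ((1 + inverse m) * norm (x - y)) / (inverse m * norm (x - y))"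
      by (simp only:)
    also have "\<dots> = 1 + m" using m that by (simp add: field_simps)
    finally show ?thesis by (simp add: m_def)
  qed
  have "hdist p q = 1 / 2 * ln ((1 + gauge p (p - q)) * (1 + gauge q (q - p)))"
    using ratio[OF p False] ratio[OF q not_sym[OF False]] False
    by (simp only: affine_hilbert_dist_def Let_def if_False)
  also have "\<dots> = (ln (1 + gauge p (p - q)) + ln (1 + gauge q (q - p))) / 2"
    using gauge_ratio_pos p q by (simp add: ln_mult_pos)
  finally show ?thesis .
qed

text \<open>Both gauges are now based at q. With q fixed the dependence on p is explicit, and
  continuity and differentiability in p are read off from this form.\<close>

lemma hdist_eq':
  assumes p: "p \<in> \<Omega>" and q: "q \<in> \<Omega>"
  shows "hdist p q = (ln (1 + gauge q (q - p)) - ln (1 - gauge q (p - q))) / 2"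
proof -
  have "1 + gauge p (p - q) = inverse (1 - gauge q (p - q))"
    using gauge_mult_eq[OF p q] by (metis inverse_unique mult.commute)
  then show ?thesis
    using gauge_diff_less_one[OF q p] by (simp add: hdist_eq[OF p q] ln_inverse)
qed

lemma hdist_commute: "p \<in> \<Omega> \<Longrightarrow> q \<in> \<Omega> \<Longrightarrow> hdist p q = hdist q p"
  by (simp add: hdist_eq)

lemma hdist_triangle:
  assumes "p \<in> \<Omega>" "q \<in> \<Omega>" "r \<in> \<Omega>"
  shows "hdist p r \<le> hdist p q + hdist q r"
proof -
  have "ln (1 + gauge x (x - z)) \<le> ln (1 + gauge x (x - y)) + ln (1 + gauge y (y - z))"
    if "x \<in> \<Omega>" "y \<in> \<Omega>" "z \<in> \<Omega>" for x y z
    using gauge_mult_triangle[OF that] gauge_ratio_pos that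
    by (metis ln_mono ln_mult_pos)
  from this[of p q r] this[of r q p] show ?thesis using assms by (simp add: hdist_eq add_divide_distrib)
qed

lemma hdist_self [simp]: "hdist p p = 0"
  by (simp add: affine_hilbert_dist_def)

text \<open>The first logarithm is dropped and the second estimated by ln (1 - s) \<le> - s. This
  bound is uniform on the domain, with D at least the diameter, whereas the opposite bound
  \<open>hdist_upper\<close> depends on the room r around both points.\<close>

lemma hdist_lower:
  assumes p: "p \<in> \<Omega>" and q: "q \<in> \<Omega>"
    and D: "0 < D" "\<And>x y. x \<in> \<Omega> \<Longrightarrow> y \<in> \<Omega> \<Longrightarrow> norm (x - y) \<le> D"
  shows "norm (p - q) / (2 * D) \<le> hdist p q"
proof -
  have "ln (1 - gauge q (p - q)) \<le> - gauge q (p - q)"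
    using ln_le_minus_one[of "1 - gauge q (p - q)"] gauge_diff_less_one[OF q p] by simp
  moreover have "0 \<le> ln (1 + gauge q (q - p))" using gauge_nonneg[OF q] by simp
  ultimately have "gauge q (p - q) / 2 \<le> hdist p q" by (simp add: hdist_eq'[OF p q])
  then show ?thesis using norm_le_gauge[OF q D(1) D(2), of "p - q"] by (simp add: field_simps)
qed

lemma hdist_pos:
  assumes "p \<in> \<Omega>" "q \<in> \<Omega>" "p \<noteq> q"
  shows "0 < hdist p q"
proof -
  obtain D where D: "0 < D" "\<And>x y. x \<in> \<Omega> \<Longrightarrow> y \<in> \<Omega> \<Longrightarrow> norm (x - y) \<le> D"
    using domain_radius by metis
  have "0 < norm (p - q) / (2 * D)" using assms D(1) by simp
  then show ?thesis using hdist_lower[OF assms(1,2) D] by linarith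
qed

lemma hdist_upper:
  assumes p: "p \<in> \<Omega>" and q: "q \<in> \<Omega>" and r: "0 < r" "ball p r \<subseteq> \<Omega>" "ball q r \<subseteq> \<Omega>"
  shows "hdist p q \<le> norm (p - q) / r"
proof -
  have "ln (1 + gauge p (p - q)) \<le> gauge p (p - q)" "ln (1 + gauge q (q - p)) \<le> gauge q (q - p)"
    by (intro ln_add_one_self_le_self gauge_nonneg p q)+
  moreover define N where "N = norm (p - q) / r"
  moreover have "gauge p (p - q) \<le> N" "gauge q (q - p) \<le> N"
    unfolding N_def
    using gauge_le_norm[OF p r(1,2)] gauge_le_norm[OF q r(1,3)] by (metis norm_minus_commute)+
  ultimately show ?thesis unfolding hdist_eq[OF p q] N_def[symmetric] by simp
qed

lemma continuous_on_hdist: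
  assumes q: "q \<in> \<Omega>"
  shows "continuous_on \<Omega> (\<lambda>x. hdist x q)"
proof -
  have "1 + gauge q v \<noteq> 0" "x \<in> \<Omega> \<Longrightarrow> 1 - gauge q (x - q) \<noteq> 0" for v x
    using gauge_ratio_pos[OF q, of v] gauge_diff_less_one[OF q, of x] by linarith+
  then have "continuous_on \<Omega> (\<lambda>x. (ln (1 + gauge q (q - x)) - ln (1 - gauge q (x - q))) / 2)"
    by (intro continuous_intros continuous_on_compose2[OF gauge_continuous[OF q]]) auto
  then show ?thesis
    by (rule continuous_on_eq) (use q in \<open>simp add: hdist_eq'\<close>)
qed

section \<open>First order behaviour of the distance, and its values along rays\<close>

lemma tendsto_ln_quotient:
  fixes a :: "real \<Rightarrow> real"
  assumes "(a \<longlongrightarrow> A) (at_right 0)"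
  shows "((\<lambda>t. ln (1 + t * a t) / t) \<longlongrightarrow> A) (at_right 0)"
proof -
  \<comment> \<open>The singularity is filled in because t * a t may vanish at positive t.\<close>
  define \<phi> :: "real \<Rightarrow> real" where "\<phi> s = (if s = 0 then 1 else ln (1 + s) / s)" for s
  have "((\<lambda>x::real. ln (1 + x)) has_real_derivative 1) (at 0)"
    by (auto intro!: derivative_eq_intros)
  then have "((\<lambda>h::real. ln (1 + h) / h) \<longlongrightarrow> 1) (at 0)"
    by (simp add: DERIV_def)
  then have "(\<phi> \<longlongrightarrow> 1) (at 0)"
    by (rule Lim_transform_eventually) (simp add: \<phi>_def eventually_at_filter)
  then have cont: "isCont \<phi> 0" by (simp add: isCont_def \<phi>_def)
  have "((\<lambda>t. t * a t) \<longlongrightarrow> 0 * A) (at_right 0)" by (intro tendsto_intros assms)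
  then have "((\<lambda>t. \<phi> (t * a t)) \<longlongrightarrow> \<phi> 0) (at_right 0)"
    using isCont_tendsto_compose[OF cont] by simp
  then have "((\<lambda>t. \<phi> (t * a t) * a t) \<longlongrightarrow> \<phi> 0 * A) (at_right 0)"
    by (intro tendsto_mult assms)
  then have "((\<lambda>t. \<phi> (t * a t) * a t) \<longlongrightarrow> A) (at_right 0)" by (simp add: \<phi>_def)
  then show ?thesis
    by (rule Lim_transform_eventually)
      (auto simp: \<phi>_def eventually_at_filter intro!: always_eventually)
qed

text \<open>The direction may vary with t so that the lemma applies to the image of a segment under
  a map differentiable at x: that curve is \<open>T x + t u(t)\<close>, with u(t) tending to the
  derivative.\<close>

lemma tendsto_hdist_finsler:
  fixes u :: "real \<Rightarrow> real ^ 'n"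
  assumes p: "p \<in> \<Omega>" and u: "(u \<longlongrightarrow> v) (at_right 0)"
  shows "((\<lambda>t. hdist (p + t *\<^sub>R u t) p / t) \<longlongrightarrow> finsler \<Omega> p v) (at_right 0)"
proof -
  have lim: "((\<lambda>t. gauge p (u t)) \<longlongrightarrow> gauge p v) (at_right 0)"
    "((\<lambda>t. gauge p (- u t)) \<longlongrightarrow> gauge p (- v)) (at_right 0)"
    using gauge_continuous[OF p] u
    by (auto intro!: continuous_on_tendsto_compose[OF gauge_continuous[OF p]] tendsto_intros)
  have "((\<lambda>t. (ln (1 + t * gauge p (- u t)) / t - ln (1 + t * (- gauge p (u t))) / t) / 2)
      \<longlongrightarrow> (gauge p (- v) - (- gauge p v)) / 2) (at_right 0)"
    by (intro tendsto_intros tendsto_ln_quotient lim) simp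
  moreover have "\<forall>\<^sub>F t in at_right 0. p + t *\<^sub>R u t \<in> \<Omega>"
  proof -
    have "((\<lambda>t. p + t *\<^sub>R u t) \<longlongrightarrow> p + 0 *\<^sub>R v) (at_right 0)" by (intro tendsto_intros u)
    then show ?thesis using topological_tendstoD[OF _ open_domain] p by simp
  qed
  then have "\<forall>\<^sub>F t in at_right 0. (ln (1 + t * gauge p (- u t)) / t - ln (1 + t * (- gauge p (u t))) / t) / 2
      = hdist (p + t *\<^sub>R u t) p / t"
    using eventually_at_right_less[of "0::real"]
  proof eventually_elim
    case (elim t)
    have "gauge p (- (t *\<^sub>R u t)) = t * gauge p (- u t)" "gauge p (t *\<^sub>R u t) = t * gauge p (u t)"
      using gauge_scale[OF p, of t "- u t"] gauge_scale[OF p, of t "u t"] elim by simp_all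
    then show ?case using hdist_eq'[OF elim(1) p] by (simp add: diff_divide_distrib)
  qed
  ultimately have "((\<lambda>t. hdist (p + t *\<^sub>R u t) p / t) \<longlongrightarrow> (gauge p (- v) - (- gauge p v)) / 2) (at_right 0)"
    by (rule Lim_transform_eventually)
  then show ?thesis by (simp add: finsler_eq[OF p] add.commute)
qed

text \<open>The right-hand side is the increment from s to t of the distance to p, so distances add
  up along a ray: segments are geodesics. The gauges based at the two points are expressed through
  those based at p by \<open>gauge_mult_eq\<close>.\<close>

lemma hdist_along_line:
  assumes p: "p \<in> \<Omega>" and t: "p + t *\<^sub>R u \<in> \<Omega>" and st: "0 \<le> s" "s \<le> t"
  shows "hdist (p + t *\<^sub>R u) (p + s *\<^sub>R u) =
    (ln (1 + t * gauge p (- u)) - ln (1 - t * gauge p u)) / 2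
    - (ln (1 + s * gauge p (- u)) - ln (1 - s * gauge p u)) / 2"
proof -
  define g where "g = gauge p u"
  define h where "h = gauge p (- u)"
  have gh: "g \<ge> 0" "h \<ge> 0" using gauge_nonneg[OF p] by (auto simp: g_def h_def)
  have tg: "t * g < 1" using gauge_diff_less_one[OF p t] gauge_scale[OF p, of t u] st by (simp add: g_def)
  have "s * g \<le> t * g" using st gh by (intro mult_right_mono)
  with tg have sg: "s * g < 1" by linarith
  have s: "p + s *\<^sub>R u \<in> \<Omega>"
    using sg gauge_less_one_iff[OF p, of "s *\<^sub>R u"] gauge_scale[OF p, of s u] st by (simp add: g_def)
  have 1: "(1 + t * gauge (p + t *\<^sub>R u) u) * (1 - t * g) = 1"
    using gauge_mult_eq[OF t p] gauge_scale[OF p, of t u] gauge_scale[OF t, of t u] st by (simp add: g_def)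
  have 2: "(1 + s * h) * (1 - s * gauge (p + s *\<^sub>R u) (- u)) = 1"
    using gauge_mult_eq[OF p s] gauge_scale[OF p, of s "- u"] gauge_scale[OF s, of s "- u"] st by (simp add: h_def)
  have 3: "gauge (p + t *\<^sub>R u) ((p + t *\<^sub>R u) - (p + s *\<^sub>R u)) = (t - s) * gauge (p + t *\<^sub>R u) u"
    using gauge_scale[OF t, of "t - s" u] st by (simp add: algebra_simps)
  have 4: "gauge (p + s *\<^sub>R u) ((p + s *\<^sub>R u) - (p + t *\<^sub>R u)) = (t - s) * gauge (p + s *\<^sub>R u) (- u)"
    using gauge_scale[OF s, of "t - s" "- u"] st by (simp add: algebra_simps)
  have pos: "1 + t * h > 0" "1 + s * h > 0" using st gh by (simp_all add: add_pos_nonneg)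
  have 5: "gauge (p + t *\<^sub>R u) u = g / (1 - t * g)" if "t > 0"
  proof -
    have "t * (gauge (p + t *\<^sub>R u) u * (1 - t * g)) = t * g" using 1 by (simp add: algebra_simps)
    then have "gauge (p + t *\<^sub>R u) u * (1 - t * g) = g" using that by simp
    then show ?thesis using tg by (simp add: eq_divide_eq)
  qed
  have 6: "gauge (p + s *\<^sub>R u) (- u) = h / (1 + s * h)"
  proof (cases "s = 0")
    case False
    have "s * (gauge (p + s *\<^sub>R u) (- u) * (1 + s * h)) = s * h" using 2 by argo
    then have "gauge (p + s *\<^sub>R u) (- u) * (1 + s * h) = h" using False by simp
    then show ?thesis using pos by (simp add: eq_divide_eq)
  qed (simp add: h_def)
  have A: "1 + (t - s) * gauge (p + t *\<^sub>R u) u = (1 - s * g) / (1 - t * g)"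
  proof (cases "t > 0")
    case True
    show ?thesis unfolding 5[OF True] using tg by (simp add: field_simps)
  next
    case False
    then have "t = 0" "s = 0" using st by auto
    then show ?thesis by simp
  qed
  have B: "1 + (t - s) * gauge (p + s *\<^sub>R u) (- u) = (1 + t * h) / (1 + s * h)"
    using pos unfolding 6 by (simp add: field_simps)
  show ?thesis
    unfolding hdist_eq[OF t s] 3 4 A B g_def[symmetric] h_def[symmetric]
    using tg sg pos by (simp add: ln_div field_simps)
qed

end

section \<open>Almost everywhere differentiability of convex functions\<close>

text \<open>For convex functions the quotient increases with h, so the infimum is the right
  derivative.\<close>

definition right_slope :: "(real \<Rightarrow> real) \<Rightarrow> real \<Rightarrow> real"
  where "right_slope \<phi> s = (INF h\<in>{0<..}. (\<phi> (s + h) - \<phi> s) / h)"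

context
  fixes \<phi> :: "real \<Rightarrow> real"
  assumes convex: "convex_on UNIV \<phi>"
begin

lemma slope_mono:
  assumes "a < b" "b < c"
  shows "(\<phi> b - \<phi> a) / (b - a) \<le> (\<phi> c - \<phi> a) / (c - a)"
    and "(\<phi> c - \<phi> a) / (c - a) \<le> (\<phi> c - \<phi> b) / (c - b)"
proof -
  have flip: "(\<phi> x - \<phi> y) / (x - y) = (\<phi> y - \<phi> x) / (y - x)" for x y
    by (metis minus_diff_eq minus_divide_divide)
  show "(\<phi> b - \<phi> a) / (b - a) \<le> (\<phi> c - \<phi> a) / (c - a)"
    using convex_on_slope_le(1)[OF convex _ _ assms] by (simp add: flip[of a])
  show "(\<phi> c - \<phi> a) / (c - a) \<le> (\<phi> c - \<phi> b) / (c - b)"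
    using convex_on_slope_le(2)[OF convex _ _ assms] by (simp add: flip[of a] flip[of b])
qed

lemma right_slope_bdd: "bdd_below ((\<lambda>h. (\<phi> (s + h) - \<phi> s) / h) ` {0<..})"
proof (rule bdd_belowI2)
  show "(\<phi> s - \<phi> (s - 1)) / (s - (s - 1)) \<le> (\<phi> (s + h) - \<phi> s) / h" if "h \<in> {0<..}" for h
    using slope_mono[of "s - 1" s "s + h"] that by simp
qed

lemma right_slope_le: "s < t \<Longrightarrow> right_slope \<phi> s \<le> (\<phi> t - \<phi> s) / (t - s)"
  unfolding right_slope_def by (rule cINF_lower2[OF right_slope_bdd, of "t - s"]) auto

lemma right_slope_ge:
  assumes "s < t"
  shows "(\<phi> t - \<phi> s) / (t - s) \<le> right_slope \<phi> t"
  unfolding right_slope_def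
proof (rule cINF_greatest)
  show "(\<phi> t - \<phi> s) / (t - s) \<le> (\<phi> (t + h) - \<phi> t) / h" if "h \<in> {0<..}" for h
    using slope_mono[of s t "t + h"] assms that by simp
qed auto

lemma mono_right_slope: "mono (right_slope \<phi>)"
  by (rule monoI) (metis order_trans right_slope_le right_slope_ge order_le_less order_refl)

lemma right_slope_near:
  assumes "0 < e"
  obtains d where "0 < d" "\<And>t. 0 < t \<Longrightarrow> t \<le> d \<Longrightarrow> (\<phi> (s + t) - \<phi> s) / t < right_slope \<phi> s + e"
proof -
  have "Inf ((\<lambda>h. (\<phi> (s + h) - \<phi> s) / h) ` {0<..}) < right_slope \<phi> s + e"
    using assms by (simp add: right_slope_def)
  then obtain d where d: "0 < d" "(\<phi> (s + d) - \<phi> s) / d < right_slope \<phi> s + e"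
    using cInf_lessD[of "(\<lambda>h. (\<phi> (s + h) - \<phi> s) / h) ` {0<..}"] by auto
  show ?thesis
  proof (rule that[OF d(1)])
    fix t :: real assume "0 < t" "t \<le> d"
    then have "(\<phi> (s + t) - \<phi> s) / t \<le> (\<phi> (s + d) - \<phi> s) / d"
      using slope_mono(1)[of s "s + t" "s + d"] by (cases "t = d") auto
    then show "(\<phi> (s + t) - \<phi> s) / t < right_slope \<phi> s + e" using d(2) by simp
  qed
qed

text \<open>The quotient is the right difference quotient minus the left one. Convexity makes it
  nonnegative, and it is small because the left quotient is at least the right slope at s - t, which
  is close to that at s by continuity.\<close>

lemma second_difference_tendsto:
  assumes cont: "isCont (right_slope \<phi>) s"
  shows "((\<lambda>t. (\<phi> (s + t) + \<phi> (s - t) - 2 * \<phi> s) / t) \<longlongrightarrow> 0) (at_right 0)"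
proof (rule tendstoI)
  fix e :: real assume e: "e > 0"
  obtain d where d: "0 < d" "\<And>t. 0 < t \<Longrightarrow> t \<le> d \<Longrightarrow> (\<phi> (s + t) - \<phi> s) / t < right_slope \<phi> s + e / 2"
    using right_slope_near[of "e / 2"] e by auto
  obtain d' where d': "0 < d'" "\<And>t. \<bar>t - s\<bar> < d' \<Longrightarrow> \<bar>right_slope \<phi> t - right_slope \<phi> s\<bar> < e / 2"
    using cont e unfolding continuous_at_eps_delta dist_real_def by (metis half_gt_zero)
  have "\<bar>(\<phi> (s + t) + \<phi> (s - t) - 2 * \<phi> s) / t\<bar> < e" if t: "0 < t" "t < min d d'" for t
  proof -
    have "right_slope \<phi> (s - t) \<le> (\<phi> s - \<phi> (s - t)) / t" using right_slope_le[of "s - t" s] t by simp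
    moreover have "(\<phi> s - \<phi> (s - t)) / t \<le> (\<phi> (s + t) - \<phi> s) / t"
      using slope_mono[of "s - t" s "s + t"] t by simp
    moreover have "\<bar>right_slope \<phi> (s - t) - right_slope \<phi> s\<bar> < e / 2" using d'(2)[of "s - t"] t by simp
    moreover have "(\<phi> (s + t) - \<phi> s) / t < right_slope \<phi> s + e / 2" using d(2) t by simp
    moreover have "(\<phi> (s + t) + \<phi> (s - t) - 2 * \<phi> s) / t = (\<phi> (s + t) - \<phi> s) / t - (\<phi> s - \<phi> (s - t)) / t"
      by (simp add: diff_divide_distrib add_divide_distrib)
    ultimately show ?thesis by linarith
  qed
  then show "\<forall>\<^sub>F t in at_right 0. dist ((\<phi> (s + t) + \<phi> (s - t) - 2 * \<phi> s) / t) 0 < e"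
    unfolding eventually_at_right_field using d(1) d'(1) by (intro exI[of _ "min d d'"]) auto
qed

text \<open>The exceptional points are discontinuities of the monotone function
  \<open>right_slope \<phi>\<close>. Second differences are used since they are explicit in \<phi>
  and so lead to Borel sets.\<close>

lemma countable_second_difference:
  "countable {s. \<not> ((\<lambda>t. (\<phi> (s + t) + \<phi> (s - t) - 2 * \<phi> s) / t) \<longlongrightarrow> 0) (at_right 0)}"
  using mono_ctble_discont[OF mono_right_slope] by (rule countable_subset[rotated])
    (use second_difference_tendsto in blast)

text \<open>Monotonicity of slopes lets the sequence of steps 1 / (k + 1) control all small steps,
  so a countable limit condition already yields differentiability.\<close>

lemma second_difference_imp_derivative:
  assumes lim: "(\<lambda>k. (\<phi> (s + inverse (real (Suc k))) + \<phi> (s - inverse (real (Suc k))) - 2 * \<phi> s)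
    / inverse (real (Suc k))) \<longlonglongrightarrow> 0"
  shows "(\<phi> has_real_derivative right_slope \<phi> s) (at s)"
  unfolding DERIV_def
proof (rule tendstoI)
  fix e :: real assume e: "e > 0"
  obtain d where d: "0 < d" "\<And>t. 0 < t \<Longrightarrow> t \<le> d \<Longrightarrow> (\<phi> (s + t) - \<phi> s) / t < right_slope \<phi> s + e"
    using right_slope_near[of "e"] e by auto
  have "\<forall>\<^sub>F k in sequentially. inverse (real (Suc k)) < d"
    using order_tendstoD(2)[OF LIMSEQ_inverse_real_of_nat d(1)] .
  moreover have "\<forall>\<^sub>F k in sequentially. (\<phi> (s + inverse (real (Suc k))) + \<phi> (s - inverse (real (Suc k))) - 2 * \<phi> s)
    / inverse (real (Suc k)) < e"
    using order_tendstoD(2)[OF lim e] .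
  ultimately have "\<forall>\<^sub>F k in sequentially. inverse (real (Suc k)) < d \<and> (\<phi> (s + inverse (real (Suc k))) + \<phi> (s - inverse (real (Suc k))) - 2 * \<phi> s)
    / inverse (real (Suc k)) < e" by eventually_elim auto
  then obtain k where k: "inverse (real (Suc k)) < d" "(\<phi> (s + inverse (real (Suc k))) + \<phi> (s - inverse (real (Suc k))) - 2 * \<phi> s)
    / inverse (real (Suc k)) < e" using eventually_happens'[OF sequentially_bot] by blast
  \<comment> \<open>One good scale is enough: all difference quotients with |h| < r lie between the
    left and the right quotient at r, and these differ by less than e.\<close>
  define r where "r = inverse (real (Suc k))"
  have r: "0 < r" "r < d" "(\<phi> (s + r) + \<phi> (s - r) - 2 * \<phi> s) / r < e"
    using k by (simp_all only: r_def) simp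
  have "dist ((\<phi> (s + h) - \<phi> s) / h) (right_slope \<phi> s) < e" if h: "h \<noteq> 0" "\<bar>h\<bar> < r" for h
  proof (cases "h > 0")
    case True
    then show ?thesis using right_slope_le[of s "s + h"] d(2)[of h] h r by (simp add: dist_real_def)
  next
    case False
    then have h': "h < 0" "- h < r" using h by auto
    have "(\<phi> s - \<phi> (s - r)) / r \<le> (\<phi> s - \<phi> (s + h)) / (- h)"
      using slope_mono(2)[of "s - r" "s + h" s] h' by simp
    moreover have "(\<phi> s - \<phi> (s + h)) / (- h) \<le> right_slope \<phi> s"
      using right_slope_ge[of "s + h" s] h' by simp
    moreover have "(\<phi> (s + r) + \<phi> (s - r) - 2 * \<phi> s) / r = (\<phi> (s + r) - \<phi> s) / r - (\<phi> s - \<phi> (s - r)) / r"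
      by (simp add: diff_divide_distrib add_divide_distrib)
    moreover have "right_slope \<phi> s \<le> (\<phi> (s + r) - \<phi> s) / r" using right_slope_le[of s "s + r"] r by simp
    moreover have "(\<phi> (s + h) - \<phi> s) / h = (\<phi> s - \<phi> (s + h)) / (- h)"
      by (metis minus_diff_eq minus_divide_divide)
    ultimately show ?thesis using r(3) e unfolding dist_real_def by linarith
  qed
  then show "\<forall>\<^sub>F h in at 0. dist ((\<phi> (s + h) - \<phi> s) / h) (right_slope \<phi> s) < e"
    unfolding eventually_at using r(1) by (intro exI[of _ r]) (auto simp: dist_real_def)
qed

end

text \<open>The indicator of x + t e \<in> N is integrated over t \<in> [0, 1] and all x.
  Integrating in t first gives 0 by the hypothesis on lines; integrating in x first gives the
  measure of N, by translation invariance.\<close>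

lemma null_set_of_countable_lines:
  fixes N :: "'a::euclidean_space set"
  assumes N: "N \<in> sets borel" and lines: "\<And>x. countable {t::real. x + t *\<^sub>R e \<in> N}"
  shows "N \<in> null_sets lborel"
proof -
  define f :: "real \<Rightarrow> 'a \<Rightarrow> ennreal" where "f t x = indicator {0..1} t * indicator N (x + t *\<^sub>R e)" for t x
  have [measurable]: "N \<in> sets borel" by (rule N)
  have meas: "case_prod f \<in> borel_measurable (lborel \<Otimes>\<^sub>M lborel)"
    unfolding f_def by measurable
  have "(\<integral>\<^sup>+t. f t x \<partial>lborel) = 0" for x
  proof -
    have "(\<integral>\<^sup>+t. f t x \<partial>lborel) = (\<integral>\<^sup>+t\<in>{t. x + t *\<^sub>R e \<in> N}. indicator {0..1} t \<partial>lborel)"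
      by (intro nn_integral_cong) (auto simp: f_def indicator_def)
    also have "\<dots> = 0"
      by (intro nn_integral_null_set countable_imp_null_set_lborel lines)
    finally show ?thesis .
  qed
  moreover have "(\<integral>\<^sup>+x. f t x \<partial>lborel) = indicator {0..1} t * emeasure lborel N" for t
  proof -
    have "(\<integral>\<^sup>+x. f t x \<partial>lborel) = indicator {0..1} t * (\<integral>\<^sup>+x. indicator N (t *\<^sub>R e + x) \<partial>lborel)"
      unfolding f_def by (subst nn_integral_cmult[symmetric]) (auto simp: add.commute)
    also have "(\<integral>\<^sup>+x. indicator N (t *\<^sub>R e + x) \<partial>lborel) = (\<integral>\<^sup>+x. indicator N x \<partial>distr lborel borel ((+) (t *\<^sub>R e)))"
      by (subst nn_integral_distr) auto
    also have "\<dots> = emeasure lborel N" by (simp add: lborel_distr_plus)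
    finally show ?thesis .
  qed
  ultimately have "(\<integral>\<^sup>+t. indicator {0..1::real} t * emeasure lborel N \<partial>lborel) = 0"
    using lborel_pair.Fubini'[OF meas] by simp
  then have "emeasure lborel N = 0" by (simp add: nn_integral_multc)
  then show ?thesis using N by (intro null_setsI) auto
qed

section \<open>Convex functions of several variables\<close>

lemma convex_on_compose_line:
  fixes u :: "'a::real_vector \<Rightarrow> real"
  assumes "convex_on UNIV u"
  shows "convex_on UNIV (\<lambda>t. u (x + t *\<^sub>R e))"
proof (rule convex_onI)
  fix t a b :: real assume t: "0 < t" "t < 1"
  have "x + ((1 - t) *\<^sub>R a + t *\<^sub>R b) *\<^sub>R e = (1 - t) *\<^sub>R (x + a *\<^sub>R e) + t *\<^sub>R (x + b *\<^sub>R e)"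
    by (simp add: algebra_simps)
  then show "u (x + ((1 - t) *\<^sub>R a + t *\<^sub>R b) *\<^sub>R e) \<le> (1 - t) * u (x + a *\<^sub>R e) + t * u (x + b *\<^sub>R e)"
    using convex_onD[OF assms, of t] t by simp
qed simp

text \<open>After subtracting the linear candidate, the remainder h is convex, vanishes at 0 and is
  small on the axes. As v is the average of the n vectors n (v \<bullet> e) e, Jensen's inequality
  bounds h v from above; the bound from below follows from - h v \<le> h (- v).\<close>

lemma convex_partials_imp_differentiable:
  fixes u :: "'a::euclidean_space \<Rightarrow> real"
  assumes convex: "convex_on UNIV u"
    and partial: "\<And>e. e \<in> Basis \<Longrightarrow> ((\<lambda>t. u (x + t *\<^sub>R e)) has_real_derivative a e) (at 0)"
  shows "u differentiable (at x)"
proof -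
  define A where "A v = (\<Sum>e\<in>Basis. (v \<bullet> e) * a e)" for v
  have A: "bounded_linear A" unfolding A_def by (intro bounded_linear_intros)
  define h where "h v = u (x + v) - u x - A v" for v
  have A_lin: "linear A" using A by (rule bounded_linear.linear)
  have A_e: "A (t *\<^sub>R e) = t * a e" if "e \<in> Basis" for t e
  proof -
    have "A (t *\<^sub>R e) = (\<Sum>e'\<in>Basis. if e' = e then t * a e else 0)"
      unfolding A_def using that by (intro sum.cong) (auto simp: inner_Basis)
    then show ?thesis using that by simp
  qed
  have conv: "convex_on UNIV h"
  proof (rule convex_onI)
    fix t :: real and v w assume t: "0 < t" "t < 1"
    have "x + ((1 - t) *\<^sub>R v + t *\<^sub>R w) = (1 - t) *\<^sub>R (x + v) + t *\<^sub>R (x + w)" by (simp add: algebra_simps)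
    then have "u (x + ((1 - t) *\<^sub>R v + t *\<^sub>R w)) \<le> (1 - t) * u (x + v) + t * u (x + w)"
      using convex_onD[OF convex, of t] t by simp
    then show "h ((1 - t) *\<^sub>R v + t *\<^sub>R w) \<le> (1 - t) * h v + t * h w"
      unfolding h_def linear_add[OF A_lin] linear_scale[OF A_lin] by (simp add: algebra_simps)
  qed simp
  have h0: "h 0 = 0" by (simp add: h_def linear_0[OF A_lin])
  define n where "n = real DIM('a)"
  have n: "n > 0" by (simp add: n_def)
  have "((\<lambda>v. norm (u (x + v) - u x - A v) / norm v) \<longlongrightarrow> 0) (at 0)"
  proof (rule tendstoI)
    fix \<epsilon> :: real assume \<epsilon>: "\<epsilon> > 0"
    define \<epsilon>' where "\<epsilon>' = \<epsilon> / (n + 1)"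
    have \<epsilon>': "\<epsilon>' > 0" "\<epsilon>' * n < \<epsilon>" using \<epsilon> n by (simp_all add: \<epsilon>'_def field_simps)
    have "\<forall>e\<in>Basis. \<exists>d>0. \<forall>t. \<bar>t\<bar> < d \<longrightarrow> h (t *\<^sub>R e) \<le> \<epsilon>' * \<bar>t\<bar>"
    proof
      fix e :: 'a assume e: "e \<in> Basis"
      have "((\<lambda>t. (u (x + t *\<^sub>R e) - u x) / t) \<longlongrightarrow> a e) (at 0)"
        using partial[OF e] by (simp add: DERIV_def)
      then obtain d where d: "d > 0"
        "\<And>t. t \<noteq> 0 \<Longrightarrow> \<bar>t\<bar> < d \<Longrightarrow> \<bar>(u (x + t *\<^sub>R e) - u x) / t - a e\<bar> < \<epsilon>'"
        using \<epsilon>'(1) unfolding tendsto_iff eventually_at dist_real_def by (metis UNIV_I diff_zero)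
      have "h (t *\<^sub>R e) \<le> \<epsilon>' * \<bar>t\<bar>" if "\<bar>t\<bar> < d" for t
      proof (cases "t = 0")
        case False
        then have "\<bar>(u (x + t *\<^sub>R e) - u x) / t - a e\<bar> * \<bar>t\<bar> \<le> \<epsilon>' * \<bar>t\<bar>"
          using d(2)[OF False that] by (intro mult_right_mono) auto
        moreover have "\<bar>(u (x + t *\<^sub>R e) - u x) / t - a e\<bar> * \<bar>t\<bar> = \<bar>h (t *\<^sub>R e)\<bar>"
        proof -
          have "h (t *\<^sub>R e) = ((u (x + t *\<^sub>R e) - u x) / t - a e) * t"
            using False by (simp add: h_def A_e[OF e] field_simps)
          then show ?thesis by (simp add: abs_mult)
        qed
        ultimately show ?thesis by linarith
      qed (simp add: h0)
      then show "\<exists>d>0. \<forall>t. \<bar>t\<bar> < d \<longrightarrow> h (t *\<^sub>R e) \<le> \<epsilon>' * \<bar>t\<bar>" using d(1) by blast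
    qed
    then obtain d where d: "\<And>e. e \<in> Basis \<Longrightarrow> d e > 0"
      "\<And>e t. e \<in> Basis \<Longrightarrow> \<bar>t\<bar> < d e \<Longrightarrow> h (t *\<^sub>R e) \<le> \<epsilon>' * \<bar>t\<bar>" by metis
    define D where "D = Min (d ` Basis) / n"
    have D: "D > 0" "\<And>e. e \<in> Basis \<Longrightarrow> n * D \<le> d e"
      using d(1) n by (auto simp: D_def)
    have le: "h v \<le> \<epsilon>' * n * norm v" if v: "norm v < D" for v
    proof -
      have "h v = h (\<Sum>e\<in>Basis. (1 / n) *\<^sub>R ((n * (v \<bullet> e)) *\<^sub>R e))"
        using n by (simp add: euclidean_representation)
      also have "\<dots> \<le> (\<Sum>e\<in>Basis. (1 / n) * h ((n * (v \<bullet> e)) *\<^sub>R e))"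
        using n by (intro convex_on_sum[OF _ _ conv]) (auto simp: n_def)
      also have "\<dots> \<le> (\<Sum>e\<in>(Basis :: 'a set). (1 / n) * (\<epsilon>' * (n * norm v)))"
      proof (intro sum_mono mult_left_mono)
        fix e :: 'a assume e: "e \<in> Basis"
        have b: "\<bar>n * (v \<bullet> e)\<bar> \<le> n * norm v"
          using Basis_le_norm[OF e] n by (simp add: abs_mult)
        also have "\<dots> < n * D" using v n by simp
        finally have "h ((n * (v \<bullet> e)) *\<^sub>R e) \<le> \<epsilon>' * \<bar>n * (v \<bullet> e)\<bar>"
          using d(2)[OF e] D(2)[OF e] by force
        also have "\<dots> \<le> \<epsilon>' * (n * norm v)" using b \<epsilon>' by (intro mult_left_mono) auto
        finally show "h ((n * (v \<bullet> e)) *\<^sub>R e) \<le> \<epsilon>' * (n * norm v)" .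
      qed (use n in auto)
      also have "\<dots> = \<epsilon>' * n * norm v" using n by (simp add: n_def)
      finally show ?thesis .
    qed
    have "\<bar>h v\<bar> \<le> \<epsilon>' * n * norm v" if v: "norm v < D" for v
    proof -
      have "h ((1 - 1/2) *\<^sub>R v + (1/2) *\<^sub>R (- v)) \<le> (1 - 1/2) * h v + 1/2 * h (- v)"
        by (rule convex_onD[OF conv]) auto
      then have "- h v \<le> h (- v)" using h0 by simp
      then show ?thesis using le[OF v] le[of "- v"] v by simp
    qed
    then have "dist (norm (u (x + v) - u x - A v) / norm v) 0 < \<epsilon>" if "v \<noteq> 0" "norm v < D" for v
    proof -
      have "\<bar>h v\<bar> / norm v \<le> \<epsilon>' * n" using that \<open>norm v < D \<Longrightarrow> \<bar>h v\<bar> \<le> _\<close> by (simp add: divide_le_eq)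
      then show ?thesis using \<epsilon>'(2) by (simp add: h_def)
    qed
    then show "\<forall>\<^sub>F v in at 0. dist (norm (u (x + v) - u x - A v) / norm v) 0 < \<epsilon>"
      unfolding eventually_at using D(1) by (intro exI[of _ D]) auto
  qed
  then have "(u has_derivative A) (at x)" unfolding has_derivative_at using A by blast
  then show ?thesis by (rule differentiableI)
qed

text \<open>For each basis vector the bad set \<open>N e\<close> is defined by second differences
  along the steps 1 / (k + 1), which makes it Borel; it meets every line in direction e in a
  countable set. Outside these null sets all partial derivatives exist.\<close>

theorem convex_on_ae_differentiable:
  fixes u :: "'a::euclidean_space \<Rightarrow> real"
  assumes convex: "convex_on UNIV u"
  shows "negligible {x. \<not> u differentiable (at x)}"
proof -
  define \<delta> where "\<delta> e k x = (u (x + inverse (real (Suc k)) *\<^sub>R e) + u (x - inverse (real (Suc k)) *\<^sub>R e) - 2 * u x)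
    / inverse (real (Suc k))" for e k x
  define N where "N e = {x. \<not> (\<lambda>k. \<delta> e k x) \<longlonglongrightarrow> 0}" for e
  have "continuous_on UNIV u" by (intro convex_on_continuous convex) simp
  then have [measurable]: "u \<in> borel_measurable borel" by (rule borel_measurable_continuous_onI)
  have null: "N e \<in> null_sets lborel" for e
  proof (rule null_set_of_countable_lines)
    show "N e \<in> sets borel" unfolding N_def \<delta>_def by measurable
    fix x
    define \<phi> where "\<phi> t = u (x + t *\<^sub>R e)" for t
    have conv: "convex_on UNIV \<phi>" unfolding \<phi>_def by (rule convex_on_compose_line[OF convex])
    have "(\<lambda>k. \<delta> e k (x + t *\<^sub>R e)) \<longlonglongrightarrow> 0"
      if lim: "((\<lambda>h. (\<phi> (t + h) + \<phi> (t - h) - 2 * \<phi> t) / h) \<longlongrightarrow> 0) (at_right 0)" for t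
    proof -
      have "filterlim (\<lambda>k. inverse (real (Suc k))) (at_right 0) sequentially"
        unfolding filterlim_at using LIMSEQ_inverse_real_of_nat by (simp add: always_eventually)
      from filterlim_compose[OF lim this] show ?thesis
        by (simp add: \<delta>_def \<phi>_def algebra_simps)
    qed
    then show "countable {t. x + t *\<^sub>R e \<in> N e}"
      using countable_second_difference[OF conv] unfolding N_def
      by (auto elim!: countable_subset[rotated])
  qed
  have "{x. \<not> u differentiable (at x)} \<subseteq> (\<Union>e\<in>Basis. N e)"
  proof (rule subsetI, rule ccontr)
    fix x assume "x \<in> {x. \<not> u differentiable (at x)}" and "x \<notin> (\<Union>e\<in>Basis. N e)"
    then have nd: "\<not> u differentiable (at x)" by simp
    have lim: "(\<lambda>k. \<delta> e k x) \<longlonglongrightarrow> 0" if "e \<in> Basis" for e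
      using that \<open>x \<notin> _\<close> by (auto simp: N_def)
    have "((\<lambda>t. u (x + t *\<^sub>R e)) has_real_derivative right_slope (\<lambda>t. u (x + t *\<^sub>R e)) 0) (at 0)"
      if "e \<in> Basis" for e
      by (rule second_difference_imp_derivative[OF convex_on_compose_line[OF convex]])
        (use lim[OF that] in \<open>simp add: \<delta>_def\<close>)
    then have "u differentiable (at x)"
      by (rule convex_partials_imp_differentiable[OF convex])
    with nd show False ..
  qed
  moreover have "(\<Union>e\<in>Basis. N e) \<in> null_sets lebesgue"
    by (intro null_sets_UN' null_sets_completionI null) (simp add: countable_finite)
  ultimately show ?thesis
    using negligible_iff_null_sets negligible_subset by blast
qed

section \<open>Isometries of the Hilbert distance\<close>

lemma convex_on_above_tangent:
  fixes u :: "'a::real_normed_vector \<Rightarrow> real"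
  assumes convex: "convex_on UNIV u" and u': "(u has_derivative u') (at x)"
  shows "u' (y - x) \<le> u y - u x"
proof -
  define v where "v = y - x"
  have "((\<lambda>t. u (x + t *\<^sub>R v)) has_derivative (\<lambda>t. u' (t *\<^sub>R v))) (at 0)"
    by (rule has_derivative_compose[of "\<lambda>t. x + t *\<^sub>R v" "\<lambda>t. t *\<^sub>R v"])
      (auto intro!: derivative_eq_intros u'[unfolded has_derivative_at] simp: u')
  then have "((\<lambda>t. u (x + t *\<^sub>R v)) has_real_derivative u' v) (at 0)"
    using linear_scale[OF has_derivative_linear[OF u']] by (simp add: has_field_derivative_def mult.commute[of _ "u' v"])
  then have "((\<lambda>t. (u (x + t *\<^sub>R v) - u x) / t) \<longlongrightarrow> u' v) (at 0)" by (simp add: DERIV_def)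
  then have "((\<lambda>t. (u (x + t *\<^sub>R v) - u x) / t) \<longlongrightarrow> u' v) (at_right 0)"
    by (rule tendsto_within_subset) simp
  moreover have "\<forall>\<^sub>F t in at_right 0. (u (x + t *\<^sub>R v) - u x) / t \<le> u y - u x"
    unfolding eventually_at_right_field
  proof (intro exI[of _ 1] conjI allI impI)
    fix t :: real assume t: "0 < t" "t < 1"
    have "x + t *\<^sub>R v = (1 - t) *\<^sub>R x + t *\<^sub>R y" by (simp add: v_def algebra_simps)
    then have "u (x + t *\<^sub>R v) \<le> (1 - t) * u x + t * u y"
      using convex_onD[OF convex, of t x y] t by simp
    then have "u (x + t *\<^sub>R v) - u x \<le> (u y - u x) * t" by (simp add: algebra_simps)
    then show "(u (x + t *\<^sub>R v) - u x) / t \<le> u y - u x" using t by (simp add: pos_divide_le_eq)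
  qed simp
  ultimately show ?thesis unfolding v_def by (rule tendsto_upperbound) simp
qed

text \<open>This extracts information on the derivative of \<open>T\<close> from that of \<open>G \<circ> T\<close>, when \<open>T\<close> is only known
  to be Lipschitz at the point.\<close>

lemma has_derivative_linearize_outer:
  fixes G :: "'b::real_normed_vector \<Rightarrow> 'c::real_normed_vector" and T :: "'a::real_normed_vector \<Rightarrow> 'b"
  assumes G: "(G has_derivative G') (at (T x))" and E: "((\<lambda>w. G (T w)) has_derivative E) (at x)"
    and r: "0 < r" "\<And>w. w \<in> ball x r \<Longrightarrow> norm (T w - T x) \<le> B * norm (w - x)"
  shows "((\<lambda>w. G' (T w)) has_derivative E) (at x)"
  unfolding has_derivative_at_alt
proof (intro conjI allI impI)
  show "bounded_linear E" using E by (rule has_derivative_bounded_linear)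
  fix e :: real assume e: "0 < e"
  \<comment> \<open>The maximum makes the Lipschitz constant positive, as it occurs in
    denominators.\<close>
  define C where "C = max B 1"
  have C: "C > 0" "C \<ge> B" by (auto simp: C_def)
  have pos: "0 < e / (2 * C)" "0 < e / 2" using e C by simp_all
  obtain d1 where d1: "d1 > 0" "\<And>u. norm (u - T x) < d1 \<Longrightarrow>
      norm (G u - G (T x) - G' (u - T x)) \<le> e / (2 * C) * norm (u - T x)"
    using G[unfolded has_derivative_at_alt, THEN conjunct2, rule_format, OF pos(1)] by blast
  obtain d2 where d2: "d2 > 0" "\<And>w. norm (w - x) < d2 \<Longrightarrow>
      norm (G (T w) - G (T x) - E (w - x)) \<le> e / 2 * norm (w - x)"
    using E[unfolded has_derivative_at_alt, THEN conjunct2, rule_format, OF pos(2)] by blast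
  show "\<exists>d>0. \<forall>w. norm (w - x) < d \<longrightarrow> norm (G' (T w) - G' (T x) - E (w - x)) \<le> e * norm (w - x)"
  proof (intro exI[of _ "Min {r, d2, d1 / C}"] conjI allI impI)
    show "0 < Min {r, d2, d1 / C}" using r d1 d2 C by simp
    fix w assume "norm (w - x) < Min {r, d2, d1 / C}"
    then have w: "norm (w - x) < r" "norm (w - x) < d2" "norm (w - x) * C < d1"
      using C by (simp_all add: pos_less_divide_eq)
    have "norm (T w - T x) \<le> B * norm (w - x)"
      using r(2)[of w] w by (simp add: dist_norm norm_minus_commute)
    also have "\<dots> \<le> C * norm (w - x)" using C by (intro mult_right_mono) auto
    finally have TC: "norm (T w - T x) \<le> C * norm (w - x)" .
    then have "norm (G (T w) - G (T x) - G' (T w - T x)) \<le> e / (2 * C) * norm (T w - T x)"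
      using w by (intro d1(2)) (simp add: mult.commute)
    also have "\<dots> \<le> e / (2 * C) * (C * norm (w - x))"
      using TC e C by (intro mult_left_mono) auto
    also have "\<dots> = e / 2 * norm (w - x)" using C by simp
    finally have 1: "norm (G (T w) - G (T x) - G' (T w - T x)) \<le> e / 2 * norm (w - x)" .
    have "G' (T w) - G' (T x) - E (w - x)
        = (G (T w) - G (T x) - E (w - x)) - (G (T w) - G (T x) - G' (T w - T x))"
      using linear_diff[OF has_derivative_linear[OF G]] by simp
    then have "norm (G' (T w) - G' (T x) - E (w - x)) \<le>
        norm (G (T w) - G (T x) - E (w - x)) + norm (G (T w) - G (T x) - G' (T w - T x))"
      by (simp only: norm_triangle_ineq4)
    also have "\<dots> \<le> e * norm (w - x)" using 1 d2(2)[OF w(2)] by simp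
    finally show "norm (G' (T w) - G' (T x) - E (w - x)) \<le> e * norm (w - x)" .
  qed
qed

context hilbert_domain
begin

section \<open>Isometries: continuity and null sets\<close>

definition isometry :: "(real ^ 'n \<Rightarrow> real ^ 'n) \<Rightarrow> bool"
  where "isometry T \<longleftrightarrow> bij_betw T \<Omega> \<Omega> \<and> (\<forall>x\<in>\<Omega>. \<forall>y\<in>\<Omega>. hdist (T x) (T y) = hdist x y)"

lemma isometryD:
  assumes "isometry T"
  shows "bij_betw T \<Omega> \<Omega>" and "x \<in> \<Omega> \<Longrightarrow> T x \<in> \<Omega>"
    and "x \<in> \<Omega> \<Longrightarrow> y \<in> \<Omega> \<Longrightarrow> hdist (T x) (T y) = hdist x y"
  using assms by (auto simp: isometry_def bij_betw_apply)

lemma isometry_inverse: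
  assumes T: "isometry T"
  shows "isometry (inv_into \<Omega> T)"
  unfolding isometry_def
proof (intro conjI ballI)
  show "bij_betw (inv_into \<Omega> T) \<Omega> \<Omega>" using isometryD(1)[OF T] by (rule bij_betw_inv_into)
  fix x y assume xy: "x \<in> \<Omega>" "y \<in> \<Omega>"
  note bij = isometryD(1)[OF T]
  have "inv_into \<Omega> T x \<in> \<Omega>" "inv_into \<Omega> T y \<in> \<Omega>"
    using bij_betw_apply[OF bij_betw_inv_into[OF bij]] xy by blast+
  from isometryD(3)[OF T this]
  show "hdist (inv_into \<Omega> T x) (inv_into \<Omega> T y) = hdist x y"
    by (simp only: bij_betw_inv_into_right[OF bij] xy)
qed

lemma isometry_inverse_apply:
  assumes "isometry T" "x \<in> \<Omega>"
  shows "inv_into \<Omega> T x \<in> \<Omega>" "T (inv_into \<Omega> T x) = x" "inv_into \<Omega> T (T x) = x"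
  using assms isometryD(1)[OF assms(1)] isometryD(2)[OF isometry_inverse[OF assms(1)]]
  by (auto simp: bij_betw_inv_into_right bij_betw_inv_into_left)

text \<open>At the sources \<open>hdist\<close> is bounded above by a multiple of the norm, locally;
  at the images it is bounded below by a multiple of the norm, on the whole domain, so nothing about
  the position of \<open>T x\<close> enters.\<close>

lemma isometry_locally_Lipschitz:
  assumes T: "isometry T" and x: "x \<in> \<Omega>"
  obtains r B where "0 < r" "ball x r \<subseteq> \<Omega>"
    "\<And>y z. y \<in> ball x r \<Longrightarrow> z \<in> ball x r \<Longrightarrow> norm (T y - T z) \<le> B * norm (y - z)"
proof -
  obtain e where e: "e > 0" "ball x e \<subseteq> \<Omega>" using open_domain x open_contains_ball by blast
  obtain D where D: "0 < D" "\<And>x y. x \<in> \<Omega> \<Longrightarrow> y \<in> \<Omega> \<Longrightarrow> norm (x - y) \<le> D"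
    using domain_radius by metis
  define r where "r = e / 2"
  have r: "r > 0" using e by (simp add: r_def)
  have sub: "ball x r \<subseteq> \<Omega>" using e by (auto simp: r_def)
  have "norm (T y - T z) \<le> (2 * D / r) * norm (y - z)" if yz: "y \<in> ball x r" "z \<in> ball x r" for y z
  proof -
    have in_dom: "y \<in> \<Omega>" "z \<in> \<Omega>" using yz sub by auto
    have "ball w r \<subseteq> ball x e" if "w \<in> ball x r" for w
    proof
      fix u assume "u \<in> ball w r"
      then show "u \<in> ball x e" using that dist_triangle[of x u w] by (simp add: r_def dist_commute)
    qed
    then have "ball y r \<subseteq> \<Omega>" "ball z r \<subseteq> \<Omega>" using yz e(2) by blast+
    then have "hdist y z \<le> norm (y - z) / r" using hdist_upper in_dom r by blast
    moreover have "norm (T y - T z) / (2 * D) \<le> hdist (T y) (T z)"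
      using in_dom D by (intro hdist_lower isometryD(2)[OF T]) auto
    ultimately have "norm (T y - T z) / (2 * D) \<le> norm (y - z) / r"
      using isometryD(3)[OF T in_dom] by simp
    then show ?thesis using D(1) by (simp add: divide_le_eq mult.commute)
  qed
  with r sub show ?thesis using that by blast
qed

lemma isometry_continuous_on:
  assumes T: "isometry T"
  shows "continuous_on \<Omega> T"
  unfolding continuous_on_eq_continuous_at[OF open_domain]
proof
  fix x assume "x \<in> \<Omega>"
  then obtain r B where r: "0 < r" "ball x r \<subseteq> \<Omega>"
    "\<And>y z. y \<in> ball x r \<Longrightarrow> z \<in> ball x r \<Longrightarrow> norm (T y - T z) \<le> B * norm (y - z)"
    using isometry_locally_Lipschitz[OF T] by metis
  have "((\<lambda>y. B * norm (y - x)) \<longlongrightarrow> B * norm (x - x)) (at x)" by (intro tendsto_intros)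
  moreover have "\<forall>\<^sub>F y in at x. norm (T y - T x) \<le> B * norm (y - x)"
    using r by (auto simp: eventually_at dist_commute intro!: exI[of _ r])
  ultimately have "((\<lambda>y. T y - T x) \<longlongrightarrow> 0) (at x)"
    by (simp add: Lim_null_comparison)
  then show "isCont T x" unfolding isCont_def by (simp add: LIM_zero_iff)
qed

lemma isometry_negligible_image:
  assumes T: "isometry T" and N: "negligible N" "N \<subseteq> \<Omega>"
  shows "negligible (T ` N)"
proof (rule negligible_locally_Lipschitz_image[OF _ N(1)])
  fix x assume "x \<in> N"
  then have "x \<in> \<Omega>" using N by blast
  then obtain r B where r: "0 < r" "ball x r \<subseteq> \<Omega>"
    "\<And>y z. y \<in> ball x r \<Longrightarrow> z \<in> ball x r \<Longrightarrow> norm (T y - T z) \<le> B * norm (y - z)"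
    using isometry_locally_Lipschitz[OF T] by metis
  then show "\<exists>U B. open U \<and> x \<in> U \<and> (\<forall>y\<in>N \<inter> U. norm (T y - T x) \<le> B * norm (y - x))"
    by (intro exI[of _ "ball x r"] exI[of _ B]) auto
qed simp

text \<open>Differentiability is asked of the two convex ingredients of the distance to z
  separately, since each of them is later compared with its own tangent.\<close>

definition regular :: "real ^ 'n \<Rightarrow> real ^ 'n \<Rightarrow> bool"
  where "regular z x \<longleftrightarrow> (\<lambda>x. gauge z (x - z)) differentiable (at x) \<and> (\<lambda>x. gauge z (z - x)) differentiable (at x)"

lemma convex_on_gauge_diff:
  assumes z: "z \<in> \<Omega>"
  shows "convex_on UNIV (\<lambda>x. gauge z (x - z))" "convex_on UNIV (\<lambda>x. gauge z (z - x))"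
proof -
  have "(1 - t) *\<^sub>R a + t *\<^sub>R b - z = (1 - t) *\<^sub>R (a - z) + t *\<^sub>R (b - z)"
    "z - ((1 - t) *\<^sub>R a + t *\<^sub>R b) = (1 - t) *\<^sub>R (z - a) + t *\<^sub>R (z - b)" for t :: real and a b
    by (simp_all add: algebra_simps)
  then show "convex_on UNIV (\<lambda>x. gauge z (x - z))" "convex_on UNIV (\<lambda>x. gauge z (z - x))"
    using convex_onD[OF convex_on_gauge[OF z]] by (auto intro!: convex_onI)
qed

lemma negligible_not_regular:
  assumes "z \<in> \<Omega>"
  shows "negligible {x. \<not> regular z x}"
proof -
  have "{x. \<not> regular z x} = {x. \<not> (\<lambda>x. gauge z (x - z)) differentiable (at x)} \<union>
      {x. \<not> (\<lambda>x. gauge z (z - x)) differentiable (at x)}"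
    by (auto simp: regular_def)
  moreover have "negligible \<dots>"
    by (intro negligible_Un convex_on_ae_differentiable convex_on_gauge_diff assms)
  ultimately show ?thesis by simp
qed

text \<open>The strict descent in the second conclusion is what makes the gradients span later. It
  comes from the tangent inequalities of the two convex gauges, after the comparison of distances
  has been exponentiated.\<close>

lemma hdist_derivative:
  assumes x: "x \<in> \<Omega>" and z: "z \<in> \<Omega>" and reg: "regular z x"
  obtains D where "((\<lambda>x. hdist x z) has_derivative D) (at x)"
    "\<And>y. y \<in> \<Omega> \<Longrightarrow> hdist y z < hdist x z \<Longrightarrow> D (y - x) < 0"
proof -
  define U where "U x = gauge z (x - z)" for x
  define W where "W x = gauge z (z - x)" for x
  obtain U' W' where U': "(U has_derivative U') (at x)" and W': "(W has_derivative W') (at x)"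
    using reg unfolding regular_def differentiable_def U_def W_def by blast
  have conv: "convex_on UNIV U" "convex_on UNIV W" unfolding U_def W_def by (rule convex_on_gauge_diff[OF z])+
  have pos: "1 + W y > 0" "1 - U y > 0" if "y \<in> \<Omega>" for y
    using gauge_ratio_pos[OF z] gauge_diff_less_one[OF z that] by (simp_all add: U_def W_def)
  define D where "D v = (W' v / (1 + W x) + U' v / (1 - U x)) / 2" for v
  have "((\<lambda>x. (ln (1 + W x) - ln (1 - U x)) / 2) has_derivative D) (at x)"
  proof -
    have "((\<lambda>x. 1 + W x) has_derivative W') (at x)" "((\<lambda>x. 1 - U x) has_derivative (\<lambda>v. - U' v)) (at x)"
      using has_derivative_add[OF has_derivative_const[of 1] W'] has_derivative_diff[OF has_derivative_const[of 1] U']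
      by simp_all
    from this[THEN has_derivative_ln[rotated]]
    have "((\<lambda>x. (ln (1 + W x) - ln (1 - U x)) / 2) has_derivative
        (\<lambda>v. (W' v * inverse (1 + W x) - (- U' v * inverse (1 - U x))) / 2)) (at x)"
      using pos[OF x] by (intro bounded_linear.has_derivative[OF bounded_linear_divide] has_derivative_diff) auto
    moreover have "D = (\<lambda>v. (W' v * inverse (1 + W x) - (- U' v * inverse (1 - U x))) / 2)"
      by (rule ext) (simp add: D_def divide_inverse[of _ "1 + W x"] divide_inverse[of _ "1 - U x"])
    ultimately show ?thesis by (simp only:)
  qed
  then have D: "((\<lambda>x. hdist x z) has_derivative D) (at x)"
    by (rule has_derivative_transform_within_open[OF _ open_domain x])
      (simp add: hdist_eq'[OF _ z] U_def W_def)
  show ?thesis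
  proof (rule that[OF D])
    fix y assume y: "y \<in> \<Omega>" and less: "hdist y z < hdist x z"
    have "ln ((1 + W y) / (1 - U y)) < ln ((1 + W x) / (1 - U x))"
      using less pos[OF x] pos[OF y] by (simp add: hdist_eq'[OF _ z] x y ln_div U_def[symmetric] W_def[symmetric])
    then have "(1 + W y) / (1 - U y) < (1 + W x) / (1 - U x)"
      using pos[OF x] pos[OF y] by simp
    \<comment> \<open>This form matches the tangent bounds: W' (y - x) / (1 + W x) is at most the
      left side minus 1 and U' (y - x) / (1 - U x) at most 1 minus the right side, so the sum is
      negative.\<close>
    then have less': "(1 + W y) / (1 + W x) < (1 - U y) / (1 - U x)"
      using pos[OF x] pos[OF y] by (simp add: field_simps)
    have "W' (y - x) / (1 + W x) \<le> (W y - W x) / (1 + W x)"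
      using convex_on_above_tangent[OF conv(2) W'] pos[OF x] by (intro divide_right_mono) auto
    moreover have "U' (y - x) / (1 - U x) \<le> (U y - U x) / (1 - U x)"
      using convex_on_above_tangent[OF conv(1) U'] pos[OF x] by (intro divide_right_mono) auto
    moreover have "(W y - W x) / (1 + W x) = (1 + W y) / (1 + W x) - 1"
      using pos[OF x] by (simp add: field_simps)
    moreover have "(U y - U x) / (1 - U x) = 1 - (1 - U y) / (1 - U x)"
      using pos[OF x] by (simp add: field_simps)
    moreover have "(a + c) / 2 < 0" if "a \<le> b" "c \<le> d" "b = e - 1" "d = 1 - f" "e < f" for a b c d e f :: real
      using that by simp
    ultimately show "D (y - x) < 0" using less' unfolding D_def by blast
  qed
qed

theorem isometry_ae_differentiable:
  assumes T: "isometry T"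
  shows "negligible {x\<in>\<Omega>. \<not> T differentiable (at x)}"
proof -
  define S where "S = inv_into \<Omega> T"
  have S: "isometry S" unfolding S_def by (rule isometry_inverse[OF T])
  obtain D0 :: "(real ^ 'n) set" where D0: "countable D0" "\<And>X. open X \<Longrightarrow> X \<noteq> {} \<Longrightarrow> \<exists>d\<in>D0. d \<in> X"
    using countable_dense_setE by blast
  define Z where "Z = D0 \<inter> \<Omega>"
  have Z: "countable Z" "Z \<subseteq> \<Omega>" using D0(1) by (auto simp: Z_def)
  \<comment> \<open>\<open>N1\<close> is a condition at x on the distances to the points
    \<open>S z\<close>, \<open>N2\<close> one at \<open>T x\<close> on the distances to z. The
    latter is brought back to x by \<open>S\<close>, which preserves null sets.\<close>
  define N1 where "N1 = (\<Union>z\<in>Z. {x. \<not> regular (S z) x})"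
  define N2 where "N2 = (\<Union>z\<in>Z. {x. \<not> regular z x})"
  have "negligible N1" "negligible N2"
    unfolding N1_def N2_def using Z isometryD(2)[OF S]
    by (auto intro!: negligible_countable_Union negligible_not_regular)
  then have neg: "negligible (N1 \<union> S ` (N2 \<inter> \<Omega>))"
    by (intro negligible_Un isometry_negligible_image[OF S] negligible_Int) auto
  have "T differentiable (at x)" if x: "x \<in> \<Omega>" "x \<notin> N1 \<union> S ` (N2 \<inter> \<Omega>)" for x
  proof -
    have y: "T x \<in> \<Omega>" using isometryD(2)[OF T x(1)] .
    have "S (T x) = x" using isometry_inverse_apply(3)[OF T x(1)] by (simp add: S_def)
    then have reg: "regular (S z) x" "regular z (T x)" if "z \<in> Z" for z
      using x y that by (auto simp: N1_def N2_def) (metis IntI UN_I image_eqI mem_Collect_eq)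
    obtain r B where r: "0 < r" "ball x r \<subseteq> \<Omega>"
      "\<And>y z. y \<in> ball x r \<Longrightarrow> z \<in> ball x r \<Longrightarrow> norm (T y - T z) \<le> B * norm (y - z)"
      using isometry_locally_Lipschitz[OF T x(1)] by metis
    \<comment> \<open>These are the directions in which \<open>T\<close> is already known to be
      differentiable at x. The set is a linear subspace containing the gradients at
      \<open>T x\<close> of the distances to all z in \<open>Z\<close>; differentiability of
      \<open>T\<close> amounts to V being the whole space.\<close>
    define V where "V = {a. (\<lambda>w. a \<bullet> T w) differentiable (at x)}"
    have sub: "subspace V"
      unfolding V_def by (intro subspaceI) (auto simp: inner_add_left intro!: differentiable_add differentiable_mult)
    have V: "adjoint D 1 \<in> V"
      if z: "z \<in> Z" and D: "((\<lambda>u. hdist u z) has_derivative D) (at (T x))" for z D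
    proof -
      have Sz: "S z \<in> \<Omega>" using z Z isometryD(2)[OF S] by blast
      obtain E where "((\<lambda>w. hdist w (S z)) has_derivative E) (at x)"
        using hdist_derivative[OF x(1) Sz reg(1)[OF z]] by metis
      then have "((\<lambda>w. hdist (T w) z) has_derivative E) (at x)"
      proof (rule has_derivative_transform_within_open[OF _ open_domain x(1)])
        fix w assume "w \<in> \<Omega>"
        then show "hdist w (S z) = hdist (T w) z"
          using isometryD(3)[OF T _ Sz] isometry_inverse_apply(2)[OF T] z Z by (auto simp: S_def)
      qed
      from has_derivative_linearize_outer[OF D this r(1), where B = B]
      have "((\<lambda>w. D (T w)) has_derivative E) (at x)"
        using r by auto
      moreover have "D v = adjoint D 1 \<bullet> v" for v
        using adjoint_works[OF has_derivative_linear[OF D], of v 1] by (simp add: inner_commute)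
      ultimately show ?thesis unfolding V_def differentiable_def by auto
    qed
    have "V = UNIV"
    proof (rule ccontr)
      assume "V \<noteq> UNIV"
      then have "span V \<noteq> UNIV" using sub by (simp add: span_eq_iff[THEN iffD2])
      then obtain v where v: "v \<noteq> 0" "\<And>a. a \<in> V \<Longrightarrow> v \<bullet> a = 0"
        using span_not_UNIV_orthogonal span_base by metis
      have "((\<lambda>t. T x + t *\<^sub>R v) \<longlongrightarrow> T x + 0 *\<^sub>R v) (at_right 0)" by (intro tendsto_intros)
      then have "\<forall>\<^sub>F t in at_right 0. T x + t *\<^sub>R v \<in> \<Omega>"
        using topological_tendstoD[OF _ open_domain] y by simp
      then have "\<forall>\<^sub>F t in at_right 0. 0 < t \<and> T x + t *\<^sub>R v \<in> \<Omega>"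
        using eventually_at_right_less[of "0::real"] by eventually_elim auto
      then obtain t where t: "0 < t" "T x + t *\<^sub>R v \<in> \<Omega>"
        using eventually_happens' trivial_limit_at_right_real by blast
      \<comment> \<open>Points z near y' are closer to y' than to \<open>T x\<close>, and density
        provides one in \<open>Z\<close>. Strict descent then gives a negative derivative along v,
        although v is orthogonal to every gradient in V.\<close>
      define y' where "y' = T x + t *\<^sub>R v"
      have y': "y' \<in> \<Omega>" "y' \<noteq> T x" using t v by (auto simp: y'_def)
      have "open (\<Omega> \<inter> {z. hdist z y' - hdist z (T x) < 0})"
      proof -
        have "continuous_on \<Omega> (\<lambda>z. hdist z y' - hdist z (T x))"
          by (intro continuous_intros continuous_on_hdist y y')
        then have "open (\<Omega> \<inter> (\<lambda>z. hdist z y' - hdist z (T x)) -` {..<0})"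
          by (rule continuous_open_preimage[OF _ open_domain]) simp
        then show ?thesis by (simp add: vimage_def lessThan_def)
      qed
      moreover have "y' \<in> \<Omega> \<inter> {z. hdist z y' - hdist z (T x) < 0}"
        using hdist_pos[OF y'(1) y y'(2)] y' by simp
      ultimately obtain z where "z \<in> D0" "z \<in> \<Omega>" and less: "hdist z y' < hdist z (T x)"
        using D0(2) by fastforce
      then have z: "z \<in> Z" "z \<in> \<Omega>" by (auto simp: Z_def)
      obtain D where D: "((\<lambda>u. hdist u z) has_derivative D) (at (T x))"
        and neg: "\<And>y'. y' \<in> \<Omega> \<Longrightarrow> hdist y' z < hdist (T x) z \<Longrightarrow> D (y' - T x) < 0"
        using hdist_derivative[OF y z(2) reg(2)[OF z(1)]] by metis
      have "D (t *\<^sub>R v) < 0" using neg[OF y'(1)] less z y y' by (simp add: hdist_commute y'_def)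
      moreover have "D (t *\<^sub>R v) = t *\<^sub>R v \<bullet> adjoint D 1"
        using adjoint_works[OF has_derivative_linear[OF D], of "t *\<^sub>R v" 1] by simp
      ultimately show False using v(2)[OF V[OF z(1) D]] by simp
    qed
    then show ?thesis
      unfolding differentiable_componentwise_within[of T x UNIV]
      by (auto simp: V_def inner_commute[of "T _"])
  qed
  then show ?thesis by (intro negligible_subset[OF neg]) auto
qed

text \<open>Both Finsler norms are limits of the same quotients
  \<open>hdist (x + t v) x / t\<close>. On the image side the point is written as
  \<open>T x + t u(t)\<close>, where u is the difference quotient of \<open>T\<close>.\<close>

lemma isometry_derivative_finsler:
  assumes T: "isometry T" and x: "x \<in> \<Omega>" and A: "(T has_derivative A) (at x)"
  shows "finsler \<Omega> (T x) (A v) = finsler \<Omega> x v"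
proof -
  define u where "u t = (T (x + t *\<^sub>R v) - T x) /\<^sub>R t" for t
  have "((\<lambda>t. T (x + t *\<^sub>R v)) has_derivative (\<lambda>t. A (t *\<^sub>R v))) (at 0)"
    by (rule has_derivative_compose[of "\<lambda>t. x + t *\<^sub>R v" "\<lambda>t. t *\<^sub>R v"])
      (auto intro!: derivative_eq_intros simp: A)
  then have "((\<lambda>t. T (x + t *\<^sub>R v)) has_vector_derivative A v) (at 0)"
    using linear_scale[OF has_derivative_linear[OF A]] by (simp add: has_vector_derivative_def)
  then have "((\<lambda>t. norm (T (x + t *\<^sub>R v) - T x - t *\<^sub>R A v) / norm t) \<longlongrightarrow> 0) (at 0)"
    by (simp add: has_vector_derivative_def has_derivative_iff_norm)
  then have "((\<lambda>t. norm (u t - A v)) \<longlongrightarrow> 0) (at 0)"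
  proof (rule Lim_transform_eventually)
    have "norm (T (x + t *\<^sub>R v) - T x - t *\<^sub>R A v) / norm t = norm (u t - A v)" if "t \<noteq> 0" for t
    proof -
      have "u t - A v = (T (x + t *\<^sub>R v) - T x - t *\<^sub>R A v) /\<^sub>R t"
        using that by (simp add: u_def scaleR_diff_right)
      then show ?thesis by (simp add: divide_inverse mult.commute)
    qed
    then show "\<forall>\<^sub>F t in at 0. norm (T (x + t *\<^sub>R v) - T x - t *\<^sub>R A v) / norm t = norm (u t - A v)"
      by (simp add: eventually_at_filter)
  qed
  then have "(u \<longlongrightarrow> A v) (at 0)"
    by (rule LIM_zero_cancel[OF tendsto_norm_zero_cancel])
  then have "(u \<longlongrightarrow> A v) (at_right 0)" by (rule tendsto_within_subset) simp
  then have "((\<lambda>t. hdist (T x + t *\<^sub>R u t) (T x) / t) \<longlongrightarrow> finsler \<Omega> (T x) (A v)) (at_right 0)"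
    by (rule tendsto_hdist_finsler[OF isometryD(2)[OF T x]])
  moreover have "\<forall>\<^sub>F t in at_right 0. hdist (T x + t *\<^sub>R u t) (T x) / t = hdist (x + t *\<^sub>R v) x / t"
  proof -
    have "((\<lambda>t. x + t *\<^sub>R v) \<longlongrightarrow> x + 0 *\<^sub>R v) (at_right 0)" by (intro tendsto_intros)
    then have "\<forall>\<^sub>F t in at_right 0. x + t *\<^sub>R v \<in> \<Omega>"
      using topological_tendstoD[OF _ open_domain] x by simp
    then show ?thesis using eventually_at_right_less[of "0::real"]
      by eventually_elim (use isometryD(3)[OF T _ x] in \<open>simp add: u_def\<close>)
  qed
  ultimately have "((\<lambda>t. hdist (x + t *\<^sub>R v) x / t) \<longlongrightarrow> finsler \<Omega> (T x) (A v)) (at_right 0)"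
    by (rule Lim_transform_eventually)
  moreover have "((\<lambda>t. hdist (x + t *\<^sub>R v) x / t) \<longlongrightarrow> finsler \<Omega> x v) (at_right 0)"
    by (rule tendsto_hdist_finsler[OF x tendsto_const])
  ultimately show ?thesis using tendsto_unique[OF trivial_limit_at_right_real] by blast
qed

section \<open>Dual norms and norms of differentials\<close>

lemma norm_le_finsler:
  assumes p: "p \<in> \<Omega>" and D: "0 < D" "\<And>x y. x \<in> \<Omega> \<Longrightarrow> y \<in> \<Omega> \<Longrightarrow> norm (x - y) \<le> D"
  shows "norm v / D \<le> finsler \<Omega> p v"
proof -
  have "norm v / D + norm v / D \<le> gauge p v + gauge p (- v)"
    using norm_le_gauge[OF p D, of v] norm_le_gauge[OF p D, of "- v"] by (intro add_mono) auto
  then show ?thesis by (simp add: finsler_eq[OF p] mult.commute)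
qed

text \<open>The dual norm is a supremum of real numbers, which carries information only once the set
  is bounded.\<close>

lemma bdd_above_dual_norm:
  assumes p: "p \<in> \<Omega>" and l: "bounded_linear l"
  shows "bdd_above ((\<lambda>v. \<bar>l v :: real\<bar>) ` {v. finsler \<Omega> p v \<le> 1})"
proof -
  obtain D where D: "0 < D" "\<And>x y. x \<in> \<Omega> \<Longrightarrow> y \<in> \<Omega> \<Longrightarrow> norm (x - y) \<le> D"
    using domain_radius by metis
  obtain K where K: "K \<ge> 0" "\<And>v. norm (l v) \<le> norm v * K" using bounded_linear.nonneg_bounded[OF l] by blast
  show ?thesis
  proof (rule bdd_aboveI2)
    fix v assume "v \<in> {v. finsler \<Omega> p v \<le> 1}"
    then have "norm v / D \<le> 1" using norm_le_finsler[OF p D, of v] by simp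
    then have "norm v \<le> D" using D(1) by simp
    then have "norm v * K \<le> D * K" using K by (intro mult_right_mono) auto
    then show "\<bar>l v\<bar> \<le> D * K" using K(2)[of v] by simp
  qed
qed

lemma finsler_zero [simp]: "finsler \<Omega> p 0 = 0"
  by (simp add: finsler_def)

lemma dual_norm_nonneg:
  assumes p: "p \<in> \<Omega>" and l: "bounded_linear l"
  shows "0 \<le> dual_norm \<Omega> p l"
  unfolding dual_norm_def
  by (rule cSUP_upper2[OF bdd_above_dual_norm[OF assms], of 0]) auto

lemma differential_norm_nonneg:
  assumes p: "p \<in> \<Omega>"
  shows "0 \<le> differential_norm \<Omega> f p"
proof (cases "f differentiable (at p)")
  case True
  then have "bounded_linear (frechet_derivative f (at p))"
    using frechet_derivative_works has_derivative_bounded_linear by blast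
  then show ?thesis using dual_norm_nonneg[OF p] True by (simp add: differential_norm_def)
qed (simp add: differential_norm_def)

text \<open>If h' is not differentiable at x, the left side is the dummy value 0. Otherwise the
  chain rule for h = h' \<circ> S, with S the inverse of T, gives h the derivative E \<circ> A' at T
  x, and A sends each competitor v for E to the competitor A v with the same Finsler norm and the
  same value.\<close>

lemma differential_norm_isometry_le:
  assumes T: "isometry T" and x: "x \<in> \<Omega>" and dT: "T differentiable (at x)"
    and dS: "inv_into \<Omega> T differentiable (at (T x))" and h': "\<And>w. w \<in> \<Omega> \<Longrightarrow> h' w = h (T w)"
  shows "differential_norm \<Omega> h' x \<le> differential_norm \<Omega> h (T x)"
proof (cases "h' differentiable (at x)")
  case False
  then show ?thesis using differential_norm_nonneg[OF isometryD(2)[OF T x]] by (simp add: differential_norm_def)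
next
  case True
  define S where "S = inv_into \<Omega> T"
  have y: "T x \<in> \<Omega>" using isometryD(2)[OF T x] .
  have ST: "S (T w) = w" if "w \<in> \<Omega>" for w using isometry_inverse_apply(3)[OF T that] by (simp add: S_def)
  have TS: "T (S w) = w" "S w \<in> \<Omega>" if "w \<in> \<Omega>" for w
    using isometry_inverse_apply(1,2)[OF T that] by (simp_all add: S_def)
  obtain E where E: "(h' has_derivative E) (at x)" using True by (auto simp: differentiable_def)
  obtain A where A: "(T has_derivative A) (at x)" using dT by (auto simp: differentiable_def)
  obtain A' where A': "(S has_derivative A') (at (T x))" using dS by (auto simp: differentiable_def S_def)
  have "((\<lambda>w. h' (S w)) has_derivative (\<lambda>v. E (A' v))) (at (T x))"
    using has_derivative_compose[OF A', of h' E] E ST[OF x] by simp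
  then have h: "(h has_derivative (\<lambda>v. E (A' v))) (at (T x))"
    by (rule has_derivative_transform_within_open[OF _ open_domain y]) (simp add: TS h')
  have "((\<lambda>w. S (T w)) has_derivative (\<lambda>v. A' (A v))) (at x)"
    by (rule has_derivative_compose[OF A A'])
  then have "((\<lambda>w. w) has_derivative (\<lambda>v. A' (A v))) (at x)"
    by (rule has_derivative_transform_within_open[OF _ open_domain x]) (simp add: ST)
  then have "(\<lambda>v. A' (A v)) = (\<lambda>v. v)" using has_derivative_unique[OF _ has_derivative_ident] by blast
  then have AA: "A' (A v) = v" for v by meson
  have bl: "bounded_linear (\<lambda>v. E (A' v))" using h by (rule has_derivative_bounded_linear)
  have "dual_norm \<Omega> x E \<le> dual_norm \<Omega> (T x) (\<lambda>v. E (A' v))"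
    unfolding dual_norm_def
  proof (rule cSUP_least)
    fix v assume "v \<in> {v. finsler \<Omega> x v \<le> 1}"
    then have "A v \<in> {v. finsler \<Omega> (T x) v \<le> 1}" using isometry_derivative_finsler[OF T x A] by simp
    then have "\<bar>E (A' (A v))\<bar> \<le> (SUP v\<in>{v. finsler \<Omega> (T x) v \<le> 1}. \<bar>E (A' v)\<bar>)"
      by (rule cSUP_upper) (rule bdd_above_dual_norm[OF y bl])
    then show "\<bar>E v\<bar> \<le> (SUP v\<in>{v. finsler \<Omega> (T x) v \<le> 1}. \<bar>E (A' v)\<bar>)" by (simp add: AA)
  qed (auto intro!: exI[of _ 0])
  then show ?thesis
    using E h frechet_derivative_at[OF E] frechet_derivative_at[OF h]
    by (auto simp: differential_norm_def differentiable_def)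
qed

end

section \<open>Change of variables\<close>

text \<open>The library proves the change of variables formula for \<open>real ^ 'm\<close> with a well-ordered index type \<open>'m\<close>
  only. An arbitrary finite index type is replaced by an initial segment of the natural numbers.\<close>

typedef (overloaded) 'a ordered_index = "{..<CARD('a::finite)}"
  by (rule exI[of _ 0]) simp

instance ordered_index :: (finite) finite
proof
  have eq: "(UNIV :: 'a ordered_index set) = Abs_ordered_index ` {..<CARD('a)}"
    by (rule type_definition.Abs_image[OF type_definition_ordered_index, symmetric])
  show "finite (UNIV :: 'a ordered_index set)" by (metis eq finite_imageI finite_lessThan)
qed

lemma card_ordered_index: "CARD('a::finite ordered_index) = CARD('a)"
  using type_definition.card[OF type_definition_ordered_index[where ?'a = 'a]] by simp

instantiation ordered_index :: (finite) wellorder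
begin

definition less_eq_ordered_index :: "'a ordered_index \<Rightarrow> 'a ordered_index \<Rightarrow> bool"
  where "x \<le> y \<longleftrightarrow> Rep_ordered_index x \<le> Rep_ordered_index y"

definition less_ordered_index :: "'a ordered_index \<Rightarrow> 'a ordered_index \<Rightarrow> bool"
  where "x < y \<longleftrightarrow> Rep_ordered_index x < Rep_ordered_index y"

instance
proof
  fix P :: "'a ordered_index \<Rightarrow> bool" and a :: "'a ordered_index"
  assume step: "\<And>x. (\<And>y. y < x \<Longrightarrow> P y) \<Longrightarrow> P x"
  show "P a"
    by (induction a rule: measure_induct_rule[of Rep_ordered_index]) (rule step, simp add: less_ordered_index_def)
qed (auto simp: less_eq_ordered_index_def less_ordered_index_def Rep_ordered_index_inject)

end

section \<open>Invariance of Lebesgue measure under relabelling of coordinates\<close>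

definition relabel :: "('b::finite \<Rightarrow> 'a::finite) \<Rightarrow> real ^ 'a \<Rightarrow> real ^ 'b"
  where "relabel \<psi> x = (\<chi> i. x $ \<psi> i)"

lemma linear_relabel: "linear (relabel \<psi>)"
  by (rule linearI) (auto simp: relabel_def vec_eq_iff)

lemma relabel_inverse:
  assumes "bij \<psi>"
  shows "relabel (inv_into UNIV \<psi>) (relabel \<psi> x) = x" "relabel \<psi> (relabel (inv_into UNIV \<psi>) y) = y"
  using assms by (simp_all add: relabel_def vec_eq_iff bij_is_surj surj_f_inv_f bij_is_inj)

lemma prod_Basis_cart: "(\<Prod>b\<in>(Basis :: (real ^ 'a::finite) set). x \<bullet> b) = (\<Prod>i\<in>UNIV. x $ i)"
proof -
  have eq: "(Basis :: (real ^ 'a) set) = (\<lambda>i. axis i 1) ` UNIV" by (auto simp: Basis_vec_def)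
  have "inj (\<lambda>i::'a. axis i (1::real))" by (auto simp: inj_def axis_eq_axis)
  then show ?thesis unfolding eq by (subst prod.reindex) (auto simp: inner_axis o_def)
qed

text \<open>The preimage of a box is the box with relabelled corners, and the product of its side
  lengths is merely reindexed.\<close>

lemma lborel_distr_relabel:
  fixes \<psi> :: "'b::finite \<Rightarrow> 'a::finite"
  assumes \<psi>: "bij \<psi>"
  shows "distr lborel borel (relabel \<psi>) = (lborel :: (real ^ 'b) measure)"
proof (rule lborel_eqI[symmetric])
  fix l u :: "real ^ 'b" assume le: "\<And>b. b \<in> Basis \<Longrightarrow> l \<bullet> b \<le> u \<bullet> b"
  have [measurable]: "relabel \<psi> \<in> borel \<rightarrow>\<^sub>M borel"
    by (intro borel_measurable_continuous_onI linear_continuous_on linear_conv_bounded_linear[THEN iffD1] linear_relabel)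
  define l' where "l' = relabel (inv_into UNIV \<psi>) l"
  define u' where "u' = relabel (inv_into UNIV \<psi>) u"
  have nth: "l' $ \<psi> i = l $ i" "u' $ \<psi> i = u $ i" for i
    using \<psi> by (simp_all add: l'_def u'_def relabel_def bij_is_inj)
  have all: "(\<forall>j. P j) \<longleftrightarrow> (\<forall>i. P (\<psi> i))" for P
    using surj_f_inv_f[OF bij_is_surj[OF \<psi>]] by metis
  have "relabel \<psi> -` box l u = box l' u'"
  proof (rule Set.set_eqI)
    show "x \<in> relabel \<psi> -` box l u \<longleftrightarrow> x \<in> box l' u'" for x
      unfolding mem_box_cart all[of "\<lambda>j. l' $ j < x $ j \<and> x $ j < u' $ j"] nth
      by (simp add: mem_box_cart relabel_def)
  qed
  then have "emeasure (distr lborel borel (relabel \<psi>)) (box l u) = emeasure lborel (box l' u')"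
    by (subst emeasure_distr) auto
  also have "\<dots> = ennreal (\<Prod>b\<in>Basis. (u' - l') \<bullet> b)"
  proof (rule emeasure_lborel_box)
    have "l' $ j \<le> u' $ j" for j
      using le[of "axis (inv_into UNIV \<psi> j) 1"] nth[of "inv_into UNIV \<psi> j"] \<psi>
      by (simp add: inner_axis bij_is_surj surj_f_inv_f axis_in_Basis_iff)
    then show "l' \<bullet> b \<le> u' \<bullet> b" if "b \<in> Basis" for b
      using that by (auto simp: Basis_vec_def inner_axis)
  qed
  also have "(\<Prod>b\<in>Basis. (u' - l') \<bullet> b) = (\<Prod>j\<in>UNIV. (u' - l') $ j)" by (rule prod_Basis_cart)
  also have "\<dots> = (\<Prod>i\<in>UNIV. (u' - l') $ \<psi> i)"
    using prod.reindex_bij_betw[OF \<psi>, of "\<lambda>j. (u' - l') $ j"] by simp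
  also have "\<dots> = (\<Prod>b\<in>Basis. (u - l) \<bullet> b)" by (simp add: nth prod_Basis_cart)
  finally show "emeasure (distr lborel borel (relabel \<psi>)) (box l u) = ennreal (\<Prod>b\<in>Basis. (u - l) \<bullet> b)" .
qed simp

lemma lebesgue_distr_relabel:
  fixes \<psi> :: "'b::finite \<Rightarrow> 'a::finite"
  assumes \<psi>: "bij \<psi>"
  shows "relabel \<psi> \<in> lebesgue \<rightarrow>\<^sub>M lebesgue" "distr lebesgue lebesgue (relabel \<psi>) = lebesgue"
proof -
  have "relabel \<psi> \<in> borel \<rightarrow>\<^sub>M borel"
    by (intro borel_measurable_continuous_onI linear_continuous_on linear_conv_bounded_linear[THEN iffD1] linear_relabel)
  then have meas: "relabel \<psi> \<in> lebesgue \<rightarrow>\<^sub>M lborel" by (intro measurable_completion) simp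
  have eq: "distr lebesgue lborel (relabel \<psi>) = lborel"
    using lborel_distr_relabel[OF \<psi>] meas
    by (subst distr_completion) (auto simp: measurable_completion \<open>relabel \<psi> \<in> borel \<rightarrow>\<^sub>M borel\<close> cong: distr_cong)
  show "relabel \<psi> \<in> lebesgue \<rightarrow>\<^sub>M lebesgue"
    by (rule completion.measurable_completion2[OF meas]) (simp add: eq)
  show "distr lebesgue lebesgue (relabel \<psi>) = lebesgue"
    using completion.completion_distr_eq[OF meas] by (simp add: eq)
qed

text \<open>A dictionary between the nonnegative integral, which may be infinite, and the language
  of absolute integrability in which the change of variables is carried out.\<close>

lemma nn_integral_eq_integral_or_infinite:
  fixes \<rho> :: "'a::euclidean_space \<Rightarrow> real"
  assumes \<rho>: "\<rho> \<in> borel_measurable lebesgue" "\<And>x. 0 \<le> \<rho> x" and A: "A \<in> sets lebesgue"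
  shows "(\<integral>\<^sup>+x\<in>A. ennreal (\<rho> x) \<partial>lebesgue) =
    (if \<rho> absolutely_integrable_on A then ennreal (integral A \<rho>) else \<infinity>)"
proof -
  have eq: "(\<integral>\<^sup>+x\<in>A. ennreal (\<rho> x) \<partial>lebesgue) = (\<integral>\<^sup>+x. ennreal (indicator A x *\<^sub>R \<rho> x) \<partial>lebesgue)"
    by (intro nn_integral_cong) (auto simp: indicator_def)
  show ?thesis
  proof (cases "\<rho> absolutely_integrable_on A")
    case True
    then have "(\<integral>\<^sup>+x. ennreal (indicator A x *\<^sub>R \<rho> x) \<partial>lebesgue) = ennreal (LINT x|lebesgue. indicator A x *\<^sub>R \<rho> x)"
      using \<rho>(2) by (intro nn_integral_eq_integral) (auto simp: set_integrable_def)
    also have "(LINT x|lebesgue. indicator A x *\<^sub>R \<rho> x) = integral A \<rho>"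
      using set_lebesgue_integral_eq_integral(2)[OF True] by (simp add: set_lebesgue_integral_def)
    finally show ?thesis using True eq by simp
  next
    case False
    have "(\<lambda>x. indicator A x *\<^sub>R \<rho> x) \<in> borel_measurable lebesgue" using \<rho>(1) A by measurable
    then have "(\<integral>\<^sup>+x. ennreal (indicator A x *\<^sub>R \<rho> x) \<partial>lebesgue) = \<infinity>"
      using False integrableI_nonneg[of "\<lambda>x. indicator A x *\<^sub>R \<rho> x" lebesgue] \<rho>(2)
      by (auto simp: set_integrable_def less_top[symmetric])
    then show ?thesis using False eq by simp
  qed
qed

text \<open>The set \<open>E x\<close> serves as a unit of volume at \<open>x\<close>; the hypothesis says that \<open>g\<close> carries the density \<open>\<rho>\<close> to itself.\<close>

lemma nn_integral_image_wellorder: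
  fixes g :: "real ^ 'm::{finite,wellorder} \<Rightarrow> real ^ 'm::_" and \<rho> :: "real ^ 'm::_ \<Rightarrow> real"
  assumes S: "S \<in> sets lebesgue" "g ` S \<in> sets lebesgue"
    and \<rho>: "\<rho> \<in> borel_measurable lebesgue" "\<And>x. 0 \<le> \<rho> x"
    and g: "\<And>x. x \<in> S \<Longrightarrow> (g has_derivative g' x) (at x)" "inj_on g S"
    and E: "\<And>x. x \<in> S \<Longrightarrow> E x \<in> lmeasurable" "\<And>x. x \<in> S \<Longrightarrow> 0 < measure lebesgue (E x)"
      "\<And>x. x \<in> S \<Longrightarrow> measure lebesgue (g' x ` E x) * \<rho> (g x) = measure lebesgue (E x) * \<rho> x"
  shows "(\<integral>\<^sup>+x\<in>g ` S. ennreal (\<rho> x) \<partial>lebesgue) = (\<integral>\<^sup>+x\<in>S. ennreal (\<rho> x) \<partial>lebesgue)"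
proof -
  \<comment> \<open>The Jacobian is eliminated by measuring the image of the unit of volume
    \<open>E x\<close> under the derivative.\<close>
  have det: "\<bar>det (matrix (g' x))\<bar> * \<rho> (g x) = \<rho> x" if x: "x \<in> S" for x
  proof -
    have "measure lebesgue (E x) * (\<bar>det (matrix (g' x))\<bar> * \<rho> (g x)) = measure lebesgue (E x) * \<rho> x"
      using E(3)[OF x] measure_linear_image[OF has_derivative_linear[OF g(1)[OF x]] E(1)[OF x]]
      by (simp add: mult_ac)
    then show ?thesis using E(2)[OF x] by simp
  qed
  \<comment> \<open>The change of variables formula is taken for values in \<open>real ^ 1\<close>,
    which is why the density is wrapped by \<open>vec\<close>.\<close>
  have iff: "\<rho> absolutely_integrable_on S \<and> integral S \<rho> = b \<longleftrightarrow>
      \<rho> absolutely_integrable_on (g ` S) \<and> integral (g ` S) \<rho> = b" for b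
  proof -
    have "(\<lambda>x. \<bar>det (matrix (g' x))\<bar> *\<^sub>R vec (\<rho> (g x)) :: real ^ 1) absolutely_integrable_on S \<and>
             integral S (\<lambda>x. \<bar>det (matrix (g' x))\<bar> *\<^sub>R vec (\<rho> (g x))) = (vec b :: real ^ 1)
         \<longleftrightarrow> (\<lambda>x. vec (\<rho> x) :: real ^ 1) absolutely_integrable_on (g ` S) \<and>
             integral (g ` S) (\<lambda>x. vec (\<rho> x)) = (vec b :: real ^ 1)"
      using g by (intro has_absolute_integral_change_of_variables S) (auto intro: has_derivative_at_withinI)
    then have "(\<lambda>x. \<bar>det (matrix (g' x))\<bar> * \<rho> (g x)) absolutely_integrable_on S \<and>
             integral S (\<lambda>x. \<bar>det (matrix (g' x))\<bar> * \<rho> (g x)) = b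
         \<longleftrightarrow> \<rho> absolutely_integrable_on (g ` S) \<and> integral (g ` S) \<rho> = b"
      by (simp add: absolutely_integrable_on_1_iff integral_on_1_eq)
    moreover have "(\<lambda>x. \<bar>det (matrix (g' x))\<bar> * \<rho> (g x)) absolutely_integrable_on S \<longleftrightarrow> \<rho> absolutely_integrable_on S"
      by (intro set_integrable_cong) (auto simp: det)
    moreover have "integral S (\<lambda>x. \<bar>det (matrix (g' x))\<bar> * \<rho> (g x)) = integral S \<rho>"
      by (intro integral_cong) (simp add: det)
    ultimately show ?thesis by simp
  qed
  \<comment> \<open>The two choices of b cover integrability on S and integrability on the image; if
    both fail, both integrals are infinite.\<close>
  show ?thesis
    unfolding nn_integral_eq_integral_or_infinite[OF \<rho> S(1)] nn_integral_eq_integral_or_infinite[OF \<rho> S(2)]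
    using iff[of "integral S \<rho>"] iff[of "integral (g ` S) \<rho>"] by auto
qed

text \<open>The relabelling \<open>R\<close> is linear and preserves Lebesgue measure, so the claim
  for g follows from that for its conjugate by \<open>R\<close>, with the units of volume
  transported by \<open>R\<close> as well.\<close>

lemma nn_integral_image_density:
  fixes g :: "real ^ 'n::finite \<Rightarrow> real ^ 'n" and \<rho> :: "real ^ 'n \<Rightarrow> real"
  assumes S: "S \<in> sets lebesgue" "g ` S \<in> sets lebesgue"
    and \<rho>: "\<rho> \<in> borel_measurable lebesgue" "\<And>x. 0 \<le> \<rho> x"
    and g: "\<And>x. x \<in> S \<Longrightarrow> (g has_derivative g' x) (at x)" "inj_on g S"
    and E: "\<And>x. x \<in> S \<Longrightarrow> E x \<in> lmeasurable" "\<And>x. x \<in> S \<Longrightarrow> 0 < measure lebesgue (E x)"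
      "\<And>x. x \<in> S \<Longrightarrow> measure lebesgue (g' x ` E x) * \<rho> (g x) = measure lebesgue (E x) * \<rho> x"
      "\<And>x. x \<in> S \<Longrightarrow> g' x ` E x \<in> lmeasurable"
  shows "(\<integral>\<^sup>+x\<in>g ` S. ennreal (\<rho> x) \<partial>lebesgue) = (\<integral>\<^sup>+x\<in>S. ennreal (\<rho> x) \<partial>lebesgue)"
proof -
  have "card (UNIV :: 'n ordered_index set) = card (UNIV :: 'n set)" by (rule card_ordered_index)
  then obtain \<psi> :: "'n ordered_index \<Rightarrow> 'n" where \<psi>: "bij \<psi>"
    using bij_betw_iff_card[of "UNIV :: 'n ordered_index set" "UNIV :: 'n set"] by auto
  define R where "R = relabel \<psi>"
  define R' where "R' = relabel (inv_into UNIV \<psi>)"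
  have inv: "R' (R x) = x" "R (R' y) = y" for x y
    unfolding R_def R'_def by (rule relabel_inverse[OF \<psi>])+
  note R = lebesgue_distr_relabel[OF \<psi>, folded R_def]
  note R' = lebesgue_distr_relabel[OF bij_imp_bij_inv[OF \<psi>], folded R'_def]
  have lin: "linear R" "linear R'" by (auto simp: R_def R'_def linear_relabel)
  have image: "R ` A = R' -` A" for A
    using inv by (auto simp: image_iff) (metis inv(2))
  have sets: "R ` A \<in> sets lebesgue" if "A \<in> sets lebesgue" for A
    using measurable_sets[OF R'(1) that] by (simp add: image)
  have emeasure: "emeasure lebesgue (R ` A) = emeasure lebesgue A" if "A \<in> sets lebesgue" for A
    using emeasure_distr[OF R'(1) that] by (simp add: image R'(2))
  have lmeas: "R ` A \<in> lmeasurable" "measure lebesgue (R ` A) = measure lebesgue A" if "A \<in> lmeasurable" for A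
    using that sets emeasure by (auto simp: fmeasurable_def measure_def)
  have nn: "(\<integral>\<^sup>+x\<in>A. ennreal (\<rho> x) \<partial>lebesgue) = (\<integral>\<^sup>+y\<in>R ` A. ennreal (\<rho> (R' y)) \<partial>lebesgue)"
    if [measurable]: "A \<in> sets lebesgue" for A
  proof -
    have [measurable]: "\<rho> \<in> borel_measurable lebesgue" by (rule \<rho>)
    have "(\<integral>\<^sup>+x\<in>A. ennreal (\<rho> x) \<partial>lebesgue) = (\<integral>\<^sup>+x. ennreal (\<rho> x) * indicator A x \<partial>distr lebesgue lebesgue R')"
      by (simp only: R'(2))
    also have "\<dots> = (\<integral>\<^sup>+y. ennreal (\<rho> (R' y)) * indicator A (R' y) \<partial>lebesgue)"
      by (intro nn_integral_distr R'(1)) measurable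
    finally show ?thesis by (simp add: image indicator_def vimage_def)
  qed
  have "R ` g ` S = (\<lambda>y. R (g (R' y))) ` (R ` S)" by (simp add: image_image inv)
  moreover have "(\<integral>\<^sup>+y\<in>(\<lambda>y. R (g (R' y))) ` (R ` S). ennreal (\<rho> (R' y)) \<partial>lebesgue) =
      (\<integral>\<^sup>+y\<in>R ` S. ennreal (\<rho> (R' y)) \<partial>lebesgue)"
  proof (rule nn_integral_image_wellorder[where g' = "\<lambda>y v. R (g' (R' y) (R' v))" and E = "\<lambda>y. R ` E (R' y)"])
    show "R ` S \<in> sets lebesgue" using S by (intro sets)
    show "(\<lambda>y. R (g (R' y))) ` R ` S \<in> sets lebesgue"
      using sets[OF S(2)] by (simp add: image_image inv)
    show "(\<lambda>y. \<rho> (R' y)) \<in> borel_measurable lebesgue" using measurable_compose[OF R'(1) \<rho>(1)] .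
    show "0 \<le> \<rho> (R' y)" for y by (rule \<rho>)
    have bl: "(R has_derivative R) F" "(R' has_derivative R') F'" for F F'
      using lin linear_conv_bounded_linear bounded_linear_imp_has_derivative by blast+
    show "((\<lambda>y. R (g (R' y))) has_derivative (\<lambda>v. R (g' (R' y) (R' v)))) (at y)" if "y \<in> R ` S" for y
    proof -
      have "R' y \<in> S" using that inv by auto
      from has_derivative_compose[OF bl(2) g(1)[OF this]]
      show ?thesis by (rule has_derivative_compose[OF _ bl(1)])
    qed
    show "inj_on (\<lambda>y. R (g (R' y))) (R ` S)"
      using g(2) by (auto simp: inj_on_def inv) (metis inv(1))
    fix y assume "y \<in> R ` S"
    then have y: "R' y \<in> S" using inv by auto
    show "R ` E (R' y) \<in> lmeasurable" using lmeas E(1)[OF y] by blast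
    show "0 < measure lebesgue (R ` E (R' y))" using lmeas(2)[OF E(1)[OF y]] E(2)[OF y] by simp
    have "(\<lambda>v. R (g' (R' y) (R' v))) ` R ` E (R' y) = R ` g' (R' y) ` E (R' y)" by (simp add: image_image inv)
    then show "measure lebesgue ((\<lambda>v. R (g' (R' y) (R' v))) ` R ` E (R' y)) * \<rho> (R' (R (g (R' y)))) =
        measure lebesgue (R ` E (R' y)) * \<rho> (R' y)"
      using lmeas(2)[OF E(1)[OF y]] lmeas(2)[OF E(4)[OF y]] E(3)[OF y] by (simp add: inv)
  qed
  ultimately show ?thesis using nn[OF S(1)] nn[OF S(2)] by simp
qed

text \<open>For a non-measurable \<open>h\<close> the integral is a lower integral, so the proof goes through the simple functions below \<open>h \<circ> T\<close>.\<close>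

lemma nn_integral_compose_le:
  assumes T: "T \<in> M \<rightarrow>\<^sub>M M" "distr M M T = M" and S: "S \<in> M \<rightarrow>\<^sub>M M"
    and inv: "\<And>x. x \<in> space M \<Longrightarrow> S (T x) = x" "\<And>x. x \<in> space M \<Longrightarrow> T (S x) = x"
  shows "(\<integral>\<^sup>+x. h (T x) \<partial>M) \<le> (\<integral>\<^sup>+x. h x \<partial>M)"
  unfolding nn_integral_def[of M "\<lambda>x. h (T x)"]
proof (rule SUP_least)
  fix s assume "s \<in> {g. simple_function M g \<and> g \<le> (\<lambda>x. h (T x))}"
  then have s: "simple_function M s" "\<And>x. s x \<le> h (T x)" by (auto simp: le_fun_def)
  have [measurable]: "s \<in> borel_measurable M" using s(1) by (rule borel_measurable_simple_function)
  have "integral\<^sup>S M s = (\<integral>\<^sup>+x. s x \<partial>M)" using s(1) by (rule nn_integral_eq_simple_integral[symmetric])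
  also have "\<dots> = (\<integral>\<^sup>+x. s (S (T x)) \<partial>M)" by (intro nn_integral_cong) (simp add: inv)
  also have "\<dots> = (\<integral>\<^sup>+x. s (S x) \<partial>distr M M T)"
    by (intro nn_integral_distr[symmetric] T(1)) (simp add: measurable_compose[OF S \<open>s \<in> borel_measurable M\<close>])
  also have "\<dots> = (\<integral>\<^sup>+x. s (S x) \<partial>M)" by (simp only: T(2))
  also have "\<dots> \<le> (\<integral>\<^sup>+x. h x \<partial>M)"
  proof (rule nn_integral_mono)
    fix x assume "x \<in> space M"
    then show "s (S x) \<le> h x" using s(2)[of "S x"] by (simp add: inv)
  qed
  finally show "integral\<^sup>S M s \<le> (\<integral>\<^sup>+x. h x \<partial>M)" .
qed

section \<open>Isometry invariance of the Hilbert measure and of the Rayleigh quotient\<close>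

lemma ennreal_divide_mono:
  fixes a b c d :: ennreal
  assumes "a \<le> c" "d \<le> b"
  shows "a / b \<le> c / d"
proof -
  have "inverse b \<le> inverse d" using assms(2)
    by (simp add: less_eq_ennreal.rep_eq inverse_ennreal.rep_eq ereal_inverse_antimono)
  then show ?thesis unfolding divide_ennreal_def by (intro mult_mono assms) auto
qed

context hilbert_domain
begin

section \<open>Finsler unit balls and the Hilbert density\<close>

definition unit_ball :: "real ^ 'n \<Rightarrow> (real ^ 'n) set"
  where "unit_ball x = {v. finsler \<Omega> x v < 1}"

definition hilbert_density :: "real ^ 'n \<Rightarrow> real"
  where "hilbert_density x = indicator \<Omega> x * measure lebesgue (ball (0 :: real ^ 'n) 1) / measure lebesgue (unit_ball x)"

lemma hilbert_measure_eq: "hilbert_measure \<Omega> = density lebesgue (\<lambda>x. ennreal (hilbert_density x))"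
  unfolding hilbert_measure_def hilbert_density_def unit_ball_def ..

text \<open>The sum of the gauges of v and - v is below 2 iff some a \<in> (0, 2) exceeds the first
  while 2 - a exceeds the second. For fixed a both are memberships of points depending continuously
  on (x, v), so openness holds jointly; this is what makes the volume of the unit ball measurable in
  x.\<close>

lemma open_unit_balls: "open {(x, v). x \<in> \<Omega> \<and> v \<in> unit_ball x}"
proof -
  have "{(x, v). x \<in> \<Omega> \<and> v \<in> unit_ball x} =
      (\<Union>a\<in>{0<..<2}. (\<Omega> \<times> UNIV) \<inter> ((\<lambda>(x, v). x + v /\<^sub>R a) -` \<Omega>) \<inter> ((\<lambda>(x, v). x - v /\<^sub>R (2 - a)) -` \<Omega>))"
    (is "?L = ?R")
  proof (intro equalityI subsetI)
    fix z assume "z \<in> ?L"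
    then obtain x v where z: "z = (x, v)" and x: "x \<in> \<Omega>" and lt: "gauge x v + gauge x (- v) < 2"
      by (auto simp: unit_ball_def finsler_eq)
    \<comment> \<open>Half of the slack, so that both gauges are exceeded strictly.\<close>
    define \<delta> where "\<delta> = (2 - gauge x v - gauge x (- v)) / 2"
    have \<delta>: "0 < \<delta>" "2 * \<delta> = 2 - gauge x v - gauge x (- v)" using lt by (simp_all add: \<delta>_def)
    define a where "a = gauge x v + \<delta>"
    have "gauge x v < a" "gauge x (- v) < 2 - a" "0 < a" "0 < 2 - a"
      using \<delta> gauge_nonneg[OF x, of v] gauge_nonneg[OF x, of "- v"] by (simp_all add: a_def)
    then show "z \<in> ?R"
      using x gauge_less_iff[OF x, of a v] gauge_less_iff[OF x, of "2 - a" "- v"] by (auto simp: z)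
  next
    fix z assume "z \<in> ?R"
    then obtain x v a where z: "z = (x, v)" and x: "x \<in> \<Omega>" and a: "0 < a" "0 < 2 - a"
      "x + v /\<^sub>R a \<in> \<Omega>" "x - v /\<^sub>R (2 - a) \<in> \<Omega>" by (cases z) auto
    then have "gauge x v < a" "gauge x (- v) < 2 - a"
      using gauge_less_iff[OF x, of a v] gauge_less_iff[OF x, of "2 - a" "- v"] by auto
    then show "z \<in> ?L" by (simp add: z x unit_ball_def finsler_eq)
  qed
  moreover have "open \<dots>"
    unfolding case_prod_unfold
    by (intro open_UN ballI open_Int open_Times open_vimage open_domain continuous_intros) auto
  ultimately show ?thesis by simp
qed

lemma open_unit_ball:
  assumes "x \<in> \<Omega>"
  shows "open (unit_ball x)"
proof -
  have "open (Pair x -` {(x, v). x \<in> \<Omega> \<and> v \<in> unit_ball x})"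
    by (intro open_vimage open_unit_balls continuous_intros)
  then show ?thesis using assms by (simp add: vimage_def)
qed

lemma unit_ball_lmeasurable:
  assumes x: "x \<in> \<Omega>"
  shows "unit_ball x \<in> lmeasurable" "0 < measure lebesgue (unit_ball x)"
proof -
  obtain D where D: "0 < D" "\<And>x y. x \<in> \<Omega> \<Longrightarrow> y \<in> \<Omega> \<Longrightarrow> norm (x - y) \<le> D"
    using domain_radius by metis
  have "norm v \<le> D" if "v \<in> unit_ball x" for v
  proof -
    have "norm v / D \<le> 1" using that norm_le_finsler[OF x D, of v] by (simp add: unit_ball_def)
    then show ?thesis using D(1) by simp
  qed
  then have "bounded (unit_ball x)" by (auto simp: bounded_iff)
  then show lm: "unit_ball x \<in> lmeasurable" using open_unit_ball[OF x] by (rule lmeasurable_open)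
  have "0 \<in> unit_ball x" by (simp add: unit_ball_def)
  then have "\<not> negligible (unit_ball x)" using open_not_negligible open_unit_ball[OF x] by blast
  then show "0 < measure lebesgue (unit_ball x)"
    using negligible_iff_measure0[OF lm] by (simp add: zero_less_measure_iff)
qed

lemma hilbert_density_nonneg: "0 \<le> hilbert_density x"
  by (simp add: hilbert_density_def)

text \<open>On \<Omega> the density is a constant divided by the volume of the section at x of the
  open set \<open>?Q\<close> in the product, and section volumes are measurable functions.\<close>

lemma hilbert_density_measurable: "hilbert_density \<in> borel_measurable lebesgue"
proof -
  let ?Q = "{(x, v). x \<in> \<Omega> \<and> v \<in> unit_ball x}"
  have "?Q \<in> sets (borel \<Otimes>\<^sub>M borel)"
    unfolding borel_prod by (rule borel_open[OF open_unit_balls])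
  also have "sets (borel \<Otimes>\<^sub>M borel) = sets ((borel :: (real ^ 'n) measure) \<Otimes>\<^sub>M (lborel :: (real ^ 'n) measure))"
    by (intro sets_pair_measure_cong) auto
  finally have "?Q \<in> sets (borel \<Otimes>\<^sub>M lborel)" .
  then have meas: "(\<lambda>x. emeasure lborel (Pair x -` ?Q)) \<in> borel_measurable borel"
    by (rule lborel.measurable_emeasure_Pair)
  have \<Omega>: "\<Omega> \<in> sets borel" using open_domain by simp
  have "(\<lambda>x. indicator \<Omega> x * measure lebesgue (ball (0 :: real ^ 'n) 1) / enn2real (emeasure lborel (Pair x -` ?Q)))
      \<in> borel_measurable borel"
    using meas \<Omega> by measurable
  moreover have "hilbert_density = (\<lambda>x. indicator \<Omega> x * measure lebesgue (ball (0 :: real ^ 'n) 1) / enn2real (emeasure lborel (Pair x -` ?Q)))"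
  proof
    show "hilbert_density x = indicator \<Omega> x * measure lebesgue (ball (0 :: real ^ 'n) 1) / enn2real (emeasure lborel (Pair x -` ?Q))" for x
    proof (cases "x \<in> \<Omega>")
      case True
      then have "Pair x -` ?Q = unit_ball x" by auto
      moreover have "measure lebesgue (unit_ball x) = measure lborel (unit_ball x)"
        using open_unit_ball[OF True] by simp
      ultimately show ?thesis by (simp add: hilbert_density_def measure_def)
    qed (simp add: hilbert_density_def)
  qed
  ultimately show ?thesis by (simp add: measurable_completion)
qed

lemma unit_ball_density:
  assumes "x \<in> \<Omega>"
  shows "measure lebesgue (unit_ball x) * hilbert_density x = measure lebesgue (ball (0 :: real ^ 'n) 1)"
  using unit_ball_lmeasurable(2)[OF assms] assms by (simp add: hilbert_density_def)

text \<open>Preservation of the Finsler norm gives one inclusion and the injectivity of A. Equality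
  of dimensions makes A surjective, whence the other inclusion.\<close>

lemma isometry_derivative_image_unit_ball:
  assumes T: "isometry T" and x: "x \<in> \<Omega>" and A: "(T has_derivative A) (at x)"
  shows "A ` unit_ball x = unit_ball (T x)"
proof -
  have lin: "linear A" using A by (rule has_derivative_linear)
  note F = isometry_derivative_finsler[OF T x A]
  obtain D where D: "0 < D" "\<And>x y. x \<in> \<Omega> \<Longrightarrow> y \<in> \<Omega> \<Longrightarrow> norm (x - y) \<le> D"
    using domain_radius by metis
  have "v = 0" if "A v = 0" for v
  proof -
    have "finsler \<Omega> x v = 0" using F[of v] that by simp
    then have "norm v / D \<le> 0" using norm_le_finsler[OF x D, of v] by simp
    then show ?thesis using D(1) by (simp add: divide_le_0_iff)
  qed
  then have "inj A" using linear_injective_0[OF lin] by blast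
  then have "surj A" using linear_injective_imp_surjective[OF lin] by blast
  show ?thesis
  proof (intro equalityI subsetI)
    show "w \<in> unit_ball (T x)" if "w \<in> A ` unit_ball x" for w using that F by (auto simp: unit_ball_def)
    fix w assume w: "w \<in> unit_ball (T x)"
    obtain v where "w = A v" using \<open>surj A\<close> by (metis surjD)
    then show "w \<in> A ` unit_ball x" using w F by (auto simp: unit_ball_def)
  qed
qed

section \<open>Invariance of measure, integrals and Rayleigh quotients\<close>

lemma isometry_image_inverse:
  assumes T: "isometry T" and "A \<subseteq> \<Omega>"
  shows "T ` A = {y\<in>\<Omega>. inv_into \<Omega> T y \<in> A}"
proof (intro equalityI subsetI)
  fix y assume "y \<in> T ` A"
  then show "y \<in> {y\<in>\<Omega>. inv_into \<Omega> T y \<in> A}"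
    using assms(2) isometry_inverse_apply(3)[OF T] isometryD(2)[OF T] by auto
next
  fix y assume "y \<in> {y\<in>\<Omega>. inv_into \<Omega> T y \<in> A}"
  then show "y \<in> T ` A" using isometry_inverse_apply(2)[OF T, of y] by (metis (mono_tags) imageI mem_Collect_eq)
qed

text \<open>A Lebesgue set is the union of a Borel set, whose image is a preimage under the
  continuous inverse, and a null set, whose image is null.\<close>

lemma isometry_image_sets:
  assumes T: "isometry T" and A: "A \<in> sets lebesgue" "A \<subseteq> \<Omega>"
  shows "T ` A \<in> sets lebesgue"
proof -
  obtain B N where BN: "B \<in> sets borel" "negligible N" "B \<union> N = A"
    using sets_lebesgue_almost_borel[OF A(1)] .
  have sub: "B \<subseteq> \<Omega>" "N \<subseteq> \<Omega>" using BN A(2) by auto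
  have "continuous_on \<Omega> (inv_into \<Omega> T)" by (rule isometry_continuous_on[OF isometry_inverse[OF T]])
  then have "inv_into \<Omega> T \<in> borel_measurable (restrict_space borel \<Omega>)" by (rule borel_measurable_continuous_on_restrict)
  then have "inv_into \<Omega> T -` B \<inter> space (restrict_space borel \<Omega>) \<in> sets (restrict_space borel \<Omega>)"
    using BN(1) by (rule measurable_sets)
  then have "inv_into \<Omega> T -` B \<inter> \<Omega> \<in> sets borel"
    using open_domain by (simp add: sets_restrict_space_iff space_restrict_space)
  moreover have "T ` B = inv_into \<Omega> T -` B \<inter> \<Omega>" using isometry_image_inverse[OF T sub(1)] by auto
  ultimately have "T ` B \<in> sets lebesgue" by simp
  moreover have "T ` N \<in> sets lebesgue"
    using isometry_negligible_image[OF T BN(2) sub(2)] by (simp add: negligible_imp_sets)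
  moreover have "T ` A = T ` B \<union> T ` N" using BN(3) by auto
  ultimately show ?thesis by simp
qed

text \<open>The Finsler unit balls serve as units of volume. Points where \<open>T\<close> is not
  differentiable are removed from A, and their images from \<open>T\<close> of A; both are null
  sets.\<close>

lemma isometry_preserves_density:
  assumes T: "isometry T" and A: "A \<in> sets lebesgue" "A \<subseteq> \<Omega>"
  shows "(\<integral>\<^sup>+x\<in>T ` A. ennreal (hilbert_density x) \<partial>lebesgue) = (\<integral>\<^sup>+x\<in>A. ennreal (hilbert_density x) \<partial>lebesgue)"
proof -
  define N where "N = {x\<in>\<Omega>. \<not> T differentiable (at x)}"
  have N: "negligible N" "N \<subseteq> \<Omega>" using isometry_ae_differentiable[OF T] by (auto simp: N_def)
  define S where "S = A - N"
  have S: "S \<in> sets lebesgue" "S \<subseteq> \<Omega>" using A N by (auto simp: S_def negligible_imp_sets)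
  have dT: "(T has_derivative frechet_derivative T (at x)) (at x)" if "x \<in> S" for x
    using that A(2) by (auto simp: S_def N_def frechet_derivative_works[symmetric])
  have ae: "(\<integral>\<^sup>+x\<in>X. ennreal (hilbert_density x) \<partial>lebesgue) = (\<integral>\<^sup>+x\<in>Y. ennreal (hilbert_density x) \<partial>lebesgue)"
    if "Y \<subseteq> X" "X - Y \<subseteq> Z" "negligible Z" for X Y Z
  proof (rule nn_integral_cong_AE)
    have "AE x in lebesgue. x \<notin> Z" using that(3) by (simp add: negligible_iff_null_sets AE_not_in)
    then show "AE x in lebesgue. ennreal (hilbert_density x) * indicator X x = ennreal (hilbert_density x) * indicator Y x"
      by eventually_elim (use that in \<open>auto simp: indicator_def\<close>)
  qed
  have "(\<integral>\<^sup>+x\<in>T ` A. ennreal (hilbert_density x) \<partial>lebesgue) = (\<integral>\<^sup>+x\<in>T ` S. ennreal (hilbert_density x) \<partial>lebesgue)"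
    by (rule ae[OF _ _ isometry_negligible_image[OF T N]]) (auto simp: S_def)
  also have "\<dots> = (\<integral>\<^sup>+x\<in>S. ennreal (hilbert_density x) \<partial>lebesgue)"
  proof (rule nn_integral_image_density[OF S(1) isometry_image_sets[OF T S] hilbert_density_measurable hilbert_density_nonneg dT])
    show "inj_on T S" using isometryD(1)[OF T] S(2) by (meson bij_betw_def inj_on_subset)
    fix x assume x: "x \<in> S"
    then have x': "x \<in> \<Omega>" "T x \<in> \<Omega>" using S(2) isometryD(2)[OF T] by auto
    show "unit_ball x \<in> lmeasurable" "0 < measure lebesgue (unit_ball x)" by (rule unit_ball_lmeasurable[OF x'(1)])+
    have im: "frechet_derivative T (at x) ` unit_ball x = unit_ball (T x)"
      by (rule isometry_derivative_image_unit_ball[OF T x'(1) dT[OF x]])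
    show "measure lebesgue (frechet_derivative T (at x) ` unit_ball x) * hilbert_density (T x)
        = measure lebesgue (unit_ball x) * hilbert_density x"
      unfolding im using unit_ball_density x' by simp
    show "frechet_derivative T (at x) ` unit_ball x \<in> lmeasurable"
      unfolding im by (rule unit_ball_lmeasurable[OF x'(2)])
  qed
  also have "\<dots> = (\<integral>\<^sup>+x\<in>A. ennreal (hilbert_density x) \<partial>lebesgue)"
    by (rule ae[symmetric, OF _ _ N(1)]) (auto simp: S_def)
  finally show ?thesis .
qed

lemma AE_hilbert_measure:
  assumes "negligible N" and "\<And>x. x \<in> \<Omega> \<Longrightarrow> x \<notin> N \<Longrightarrow> P x"
  shows "AE x in hilbert_measure \<Omega>. P x"
proof -
  have "AE x in lebesgue. x \<notin> N" using assms(1) by (simp add: negligible_iff_null_sets AE_not_in)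
  then have "AE x in lebesgue. 0 < ennreal (hilbert_density x) \<longrightarrow> P x"
    by eventually_elim (use assms(2) in \<open>auto simp: hilbert_density_def indicator_def\<close>)
  then show ?thesis
    unfolding hilbert_measure_eq using hilbert_density_measurable by (subst AE_density) auto
qed

text \<open>Nothing is known about \<open>T\<close> outside \<Omega>, so the measure is restricted
  to \<Omega>, where \<open>T\<close> and its inverse are measurable and preserve it. The function h
  is arbitrary, so the bound applies directly to squared norms of differentials.\<close>

lemma isometry_nn_integral_le:
  assumes T: "isometry T"
  shows "(\<integral>\<^sup>+x. h (T x) \<partial>hilbert_measure \<Omega>) \<le> (\<integral>\<^sup>+x. h x \<partial>hilbert_measure \<Omega>)"
proof -
  define M where "M = restrict_space (hilbert_measure \<Omega>) \<Omega>"
  have \<Omega>: "\<Omega> \<inter> space (hilbert_measure \<Omega>) \<in> sets (hilbert_measure \<Omega>)"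
    using open_domain by (simp add: hilbert_measure_eq)
  have M: "space M = \<Omega>" "A \<in> sets M \<longleftrightarrow> A \<subseteq> \<Omega> \<and> A \<in> sets lebesgue" for A
    using sets_restrict_space_iff[OF \<Omega>] by (auto simp: M_def space_restrict_space hilbert_measure_eq)
  have emeasure_M: "emeasure M A = (\<integral>\<^sup>+x\<in>A. ennreal (hilbert_density x) \<partial>lebesgue)" if "A \<in> sets M" for A
    using that M(2)[of A] emeasure_restrict_space[OF \<Omega>] hilbert_density_measurable
    by (simp add: M_def[symmetric]) (simp add: M_def hilbert_measure_eq emeasure_density)
  have restrict: "(\<integral>\<^sup>+x. k x \<partial>hilbert_measure \<Omega>) = (\<integral>\<^sup>+x. k x \<partial>M)" for k
    unfolding M_def nn_integral_restrict_space[OF \<Omega>]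
    by (rule nn_integral_cong_AE, rule AE_hilbert_measure[of "{}"]) auto
  have vimage: "U -` A \<inter> \<Omega> = inv_into \<Omega> U ` A" if "isometry U" "A \<subseteq> \<Omega>" for U A
  proof -
    have "inv_into \<Omega> (inv_into \<Omega> U) y = U y" if "y \<in> \<Omega>" for y
      using inv_into_inv_into_eq[OF isometryD(1)[OF \<open>isometry U\<close>] that] .
    then show ?thesis using isometry_image_inverse[OF isometry_inverse[OF that(1)] that(2)] by auto
  qed
  have meas: "U \<in> M \<rightarrow>\<^sub>M M" if U: "isometry U" for U
  proof (rule measurableI)
    show "U x \<in> space M" if "x \<in> space M" for x using that isometryD(2)[OF U] M by simp
    show "U -` A \<inter> space M \<in> sets M" if "A \<in> sets M" for A
      using that vimage[OF U, of A] isometry_image_sets[OF isometry_inverse[OF U], of A]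
        isometryD(2)[OF isometry_inverse[OF U]] by (auto simp: M)
  qed
  have "distr M M T = M"
  proof (rule measure_eqI)
    fix A assume "A \<in> sets (distr M M T)"
    then have A: "A \<in> sets M" by simp
    then have "emeasure (distr M M T) A = emeasure M (inv_into \<Omega> T ` A)"
      using meas[OF T] vimage[OF T, of A] by (simp add: emeasure_distr M)
    also have "\<dots> = emeasure M A"
      using A measurable_sets[OF meas[OF T] A] vimage[OF T, of A]
        isometry_preserves_density[OF isometry_inverse[OF T], of A]
      by (subst (1 2) emeasure_M) (auto simp: M)
    finally show "emeasure (distr M M T) A = emeasure M A" .
  qed simp
  from nn_integral_compose_le[OF meas[OF T] this meas[OF isometry_inverse[OF T]]]
  show ?thesis unfolding restrict using isometry_inverse_apply[OF T] by (simp add: M)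
qed

text \<open>The numerator is bounded pointwise almost everywhere and then moved by \<open>T\<close>.
  For the denominator h is rewritten as h' composed with the inverse, which is an isometry as
  well.\<close>

theorem rayleigh_quotient_isometry_le:
  assumes T: "isometry T" and h': "\<And>x. x \<in> \<Omega> \<Longrightarrow> h' x = h (T x)"
  shows "rayleigh_quotient \<Omega> h' \<le> rayleigh_quotient \<Omega> h"
  unfolding rayleigh_quotient_def
proof (rule ennreal_divide_mono)
  define S where "S = inv_into \<Omega> T"
  have S: "isometry S" unfolding S_def by (rule isometry_inverse[OF T])
  \<comment> \<open>Differentiability of \<open>T\<close> at x and of the inverse at
    \<open>T x\<close> are both required; the second exceptional set is brought back to x by
    \<open>S\<close>.\<close>
  define N where "N = {x\<in>\<Omega>. \<not> T differentiable (at x)} \<union> S ` {y\<in>\<Omega>. \<not> S differentiable (at y)}"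
  have N: "negligible N"
    unfolding N_def by (intro negligible_Un isometry_ae_differentiable T S isometry_negligible_image) auto
  have "(\<integral>\<^sup>+p. ennreal ((differential_norm \<Omega> h' p)\<^sup>2) \<partial>hilbert_measure \<Omega>) \<le>
      (\<integral>\<^sup>+p. ennreal ((differential_norm \<Omega> h (T p))\<^sup>2) \<partial>hilbert_measure \<Omega>)"
  proof (rule nn_integral_mono_AE, rule AE_hilbert_measure[OF N])
    fix x assume x: "x \<in> \<Omega>" "x \<notin> N"
    have "S (T x) = x" using isometry_inverse_apply(3)[OF T x(1)] by (simp add: S_def)
    then have "T differentiable (at x)" "S differentiable (at (T x))"
      using x isometryD(2)[OF T x(1)] by (auto simp: N_def image_iff)
    then have "differential_norm \<Omega> h' x \<le> differential_norm \<Omega> h (T x)"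
      using differential_norm_isometry_le[OF T x(1), of h' h] h' by (simp add: S_def)
    then show "ennreal ((differential_norm \<Omega> h' x)\<^sup>2) \<le> ennreal ((differential_norm \<Omega> h (T x))\<^sup>2)"
      using differential_norm_nonneg[OF x(1)] by (intro ennreal_leI power_mono)
  qed
  also have "\<dots> \<le> (\<integral>\<^sup>+p. ennreal ((differential_norm \<Omega> h p)\<^sup>2) \<partial>hilbert_measure \<Omega>)"
    by (rule isometry_nn_integral_le[OF T])
  finally show "(\<integral>\<^sup>+p. ennreal ((differential_norm \<Omega> h' p)\<^sup>2) \<partial>hilbert_measure \<Omega>) \<le>
      (\<integral>\<^sup>+p. ennreal ((differential_norm \<Omega> h p)\<^sup>2) \<partial>hilbert_measure \<Omega>)" .
  have "(\<integral>\<^sup>+p. ennreal ((h p)\<^sup>2) \<partial>hilbert_measure \<Omega>) = (\<integral>\<^sup>+p. ennreal ((h' (S p))\<^sup>2) \<partial>hilbert_measure \<Omega>)"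
  proof (rule nn_integral_cong_AE, rule AE_hilbert_measure[of "{}"])
    fix x assume "x \<in> \<Omega>"
    then show "ennreal ((h x)\<^sup>2) = ennreal ((h' (S x))\<^sup>2)"
      using h' isometry_inverse_apply[OF T] by (simp add: S_def)
  qed simp
  also have "\<dots> \<le> (\<integral>\<^sup>+p. ennreal ((h' p)\<^sup>2) \<partial>hilbert_measure \<Omega>)"
    by (rule isometry_nn_integral_le[OF S])
  finally show "(\<integral>\<^sup>+p. ennreal ((h p)\<^sup>2) \<partial>hilbert_measure \<Omega>) \<le> (\<integral>\<^sup>+p. ennreal ((h' p)\<^sup>2) \<partial>hilbert_measure \<Omega>)" .
qed

end

section \<open>Horoballs and divisibility in projective space\<close>

lemma linear_bij_nonzero:
  assumes "linear g" "bij g" "z \<noteq> 0"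
  shows "g z \<noteq> 0"
  using inj_eq[OF bij_is_inj[OF assms(2)], of z 0] linear_0[OF assms(1)] assms(3) by simp

text \<open>The set of nonzero vectors lying over the image of U is the g-image of the double cone
  {(u, c) | c \<noteq> 0, u / c \<in> U}, which is open.\<close>

lemma open_affine_point_image:
  fixes g :: "'n::finite chart"
  assumes g: "linear g" "bij g" and U: "open U"
  shows "open (affine_point g ` U)"
proof -
  define V where "V = {z. snd z \<noteq> 0} \<inter> (\<lambda>z. fst z /\<^sub>R snd z) -` U"
  have "open {z :: (real ^ 'n) \<times> real. snd z \<noteq> 0}"
    by (intro open_Collect_neq continuous_intros)
  then have "open V" unfolding V_def
    by (intro continuous_open_preimage U continuous_intros) auto
  then have "open (g ` V)" by (rule open_surjective_linear_image[OF _ g(1) bij_is_surj[OF g(2)]])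
  moreover have nz: "g (v, c) \<noteq> 0" if "c \<noteq> 0" for v c
    using linear_bij_nonzero[OF g, of "(v, c)"] that by (simp add: zero_prod_def)
  have "{x. x \<noteq> 0 \<and> abs_projective x \<in> affine_point g ` U} = g ` V"
  proof (intro equalityI subsetI)
    fix x assume "x \<in> {x. x \<noteq> 0 \<and> abs_projective x \<in> affine_point g ` U}"
    then obtain v where v: "v \<in> U" "x \<noteq> 0" "abs_projective (g (v, 1)) = abs_projective x"
      by (auto simp: affine_point_def)
    obtain c where c: "c \<noteq> 0" "x = c *\<^sub>R g (v, 1)" using v nz[of 1 v] abs_projective_eq_iff[of "g (v, 1)" x] by auto
    then have "x = g (c *\<^sub>R v, c)" using linear_scale[OF g(1), of c "(v, 1)"] by simp
    moreover have "(c *\<^sub>R v, c) \<in> V" using c v by (simp add: V_def)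
    ultimately show "x \<in> g ` V" by blast
  next
    fix x assume "x \<in> g ` V"
    then obtain u c where x: "x = g (u, c)" "c \<noteq> 0" "u /\<^sub>R c \<in> U" by (auto simp: V_def)
    have "x = c *\<^sub>R g (u /\<^sub>R c, 1)" using x linear_scale[OF g(1), of c "(u /\<^sub>R c, 1)"] by simp
    moreover have "g (u /\<^sub>R c, 1) \<noteq> 0" "x \<noteq> 0" using x nz by auto
    ultimately have "abs_projective x = affine_point g (u /\<^sub>R c)"
      unfolding affine_point_def using x(2) abs_projective_eq_iff[of "g (u /\<^sub>R c, 1)" x] by metis
    then show "x \<in> {x. x \<noteq> 0 \<and> abs_projective x \<in> affine_point g ` U}" using x(3) \<open>x \<noteq> 0\<close> by blast
  qed
  ultimately show ?thesis by (simp add: open_projective_iff)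
qed

lemma continuous_on_affine_point:
  fixes g :: "'n::finite chart"
  assumes g: "linear g" "bij g"
  shows "continuous_on UNIV (affine_point g)"
  unfolding continuous_on_open_vimage[OF open_UNIV]
proof (intro allI impI)
  fix B :: "'n projective set" assume "open B"
  then have B: "open {x. x \<noteq> 0 \<and> abs_projective x \<in> B}" by (simp only: open_projective_iff[symmetric])
  have "g (v, 1) \<noteq> 0" for v
    using linear_bij_nonzero[OF g, of "(v, 1)"] by (simp add: zero_prod_def)
  then have eq: "affine_point g -` B \<inter> UNIV = (\<lambda>v. g (v, 1)) -` {x. x \<noteq> 0 \<and> abs_projective x \<in> B}"
    by (auto simp: affine_point_def)
  have "continuous_on UNIV (\<lambda>v. g (v, 1))"
    by (intro continuous_on_compose2[OF linear_continuous_on[OF linear_conv_bounded_linear[THEN iffD1, OF g(1)]]]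
        continuous_intros) auto
  then show "open (affine_point g -` B \<inter> UNIV)"
    unfolding eq by (intro open_vimage B)
qed

text \<open>Boundedness and nonemptiness keep the two suprema in \<open>hausdorff_dist\<close>
  meaningful.\<close>

lemma infdist_le_hausdorff_dist:
  fixes A B :: "'a::metric_space set"
  assumes "bounded A" "bounded B" "A \<noteq> {}" "B \<noteq> {}"
  shows "a \<in> A \<Longrightarrow> infdist a B \<le> hausdorff_dist A B" and "b \<in> B \<Longrightarrow> infdist b A \<le> hausdorff_dist A B"
proof -
  have bdd: "bdd_above ((\<lambda>x. infdist x Y) ` X)" if X: "bounded X" and Y: "Y \<noteq> {}" for X Y :: "'a set"
  proof -
    obtain y where y: "y \<in> Y" using Y by blast
    obtain e where e: "\<And>x. x \<in> X \<Longrightarrow> dist y x \<le> e" using X bounded_any_center[of X y] by blast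
    have "infdist x Y \<le> e" if "x \<in> X" for x
      using infdist_le[OF y, of x] e[OF that] by (simp add: dist_commute)
    then show ?thesis by (intro bdd_aboveI2)
  qed
  show "infdist a B \<le> hausdorff_dist A B" if "a \<in> A"
    unfolding hausdorff_dist_def using cSUP_upper[OF that bdd[OF assms(1,4)]] by linarith
  show "infdist b A \<le> hausdorff_dist A B" if "b \<in> B"
    unfolding hausdorff_dist_def using cSUP_upper[OF that bdd[OF assms(2,3)]] by linarith
qed

section \<open>The projective convex set in an adapted chart\<close>

locale hilbert_chart =
  fixes g :: "'n::finite chart" and C :: "'n projective set"
  assumes chart: "adapted_chart g C"
begin

abbreviation \<Omega> where "\<Omega> \<equiv> affine_trace g C"
abbreviation pt where "pt \<equiv> affine_point g"
abbreviation co where "co \<equiv> affine_coord g"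

sublocale hilbert_domain \<Omega>
  using chart by unfold_locales (auto simp: adapted_chart_def)

lemma chart_linear: "linear g" "bij g"
  using chart by (auto simp: adapted_chart_def)

lemma co_pt [simp]: "co (pt v) = v"
  unfolding affine_coord_def by (rule inv_into_f_f[OF inj_affine_point[OF chart_linear]]) simp

lemma pt_co [simp]: "P \<in> C \<Longrightarrow> pt (co P) = P"
  using chart unfolding adapted_chart_def affine_coord_def by (meson f_inv_into_f subsetD)

lemma pt_in_iff [simp]: "pt v \<in> C \<longleftrightarrow> v \<in> \<Omega>"
  by (simp add: affine_trace_def)

lemma co_in: "P \<in> C \<Longrightarrow> co P \<in> \<Omega>"
  using pt_co pt_in_iff by metis

lemma C_eq: "C = pt ` \<Omega>"
  using co_in pt_co by (force simp: image_iff)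

lemma continuous_on_pt: "continuous_on A pt"
  using continuous_on_affine_point[OF chart_linear] continuous_on_subset by blast

lemma open_pt_image: "open U \<Longrightarrow> open (pt ` U)"
  by (rule open_affine_point_image[OF chart_linear])

lemma open_C: "open C"
  using open_pt_image[OF open_domain] C_eq by simp

lemma continuous_on_co: "continuous_on C co"
  unfolding continuous_on_open_vimage[OF open_C]
proof (intro allI impI)
  fix B :: "(real ^ 'n) set" assume "open B"
  then have "open (pt ` (B \<inter> \<Omega>))" using open_domain by (intro open_pt_image open_Int)
  moreover have "co -` B \<inter> C = pt ` (B \<inter> \<Omega>)"
    using co_in pt_co by (force simp: image_iff)
  ultimately show "open (co -` B \<inter> C)" by simp
qed

text \<open>As \<Omega> is bounded, the chart maps its closure to a compact, hence closed, set: the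
  closure of C stays away from the hyperplane at infinity.\<close>

lemma closure_C_subset: "closure C \<subseteq> pt ` closure \<Omega>"
proof (rule closure_minimal)
  have "compact (pt ` closure \<Omega>)"
    by (intro compact_continuous_image continuous_on_pt) (use bounded_domain in \<open>simp add: compact_closure\<close>)
  then show "closed (pt ` closure \<Omega>)" by (rule compact_imp_closed)
  show "C \<subseteq> pt ` closure \<Omega>" using C_eq closure_subset by (metis image_mono)
qed

text \<open>In the chart this is the fact that an open convex set is the interior of its
  closure.\<close>

lemma interior_closure_C: "interior (closure C) \<subseteq> C"
proof
  fix P assume P: "P \<in> interior (closure C)"
  have "open (pt -` interior (closure C))"
    by (rule open_vimage[OF _ continuous_on_pt]) simp
  moreover have "pt -` interior (closure C) \<subseteq> closure \<Omega>"
  proof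
    fix v assume "v \<in> pt -` interior (closure C)"
    then have "pt v \<in> pt ` closure \<Omega>" using interior_subset closure_C_subset by blast
    then obtain w where "w \<in> closure \<Omega>" "pt v = pt w" by blast
    then show "v \<in> closure \<Omega>" using co_pt by metis
  qed
  ultimately have "pt -` interior (closure C) \<subseteq> interior (closure \<Omega>)" by (simp add: interior_maximal)
  also have "\<dots> = \<Omega>"
    using convex_interior_closure[OF convex_domain] open_domain by (simp add: interior_open)
  finally have sub: "pt -` interior (closure C) \<subseteq> \<Omega>" .
  obtain v where "P = pt v" using P interior_subset closure_C_subset by blast
  then show "P \<in> C" using sub P by auto
qed

lemma frontier_C_imp:
  assumes P: "P \<in> frontier C"
  shows "pt (co P) = P" "co P \<in> frontier \<Omega>"
proof -
  have "P \<in> closure C" "P \<notin> C" using P open_C by (auto simp: frontier_def interior_open)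
  then obtain v where v: "P = pt v" "v \<in> closure \<Omega>" using closure_C_subset by blast
  then show "pt (co P) = P" by simp
  have "v \<notin> \<Omega>" using v \<open>P \<notin> C\<close> by simp
  then show "co P \<in> frontier \<Omega>" using v open_domain by (simp add: frontier_def interior_open)
qed

lemma hilbert_dist_eq: "hilbert_dist g C P Q = hdist (co P) (co Q)"
  by (simp add: hilbert_dist_def)

lemma hilbert_ball_eq: "hilbert_ball g C (pt x) r = pt ` {y\<in>\<Omega>. hdist x y < r}"
  unfolding hilbert_ball_def hilbert_dist_eq using co_in by (force simp: image_iff)

lemma open_hilbert_ball:
  assumes x: "x \<in> \<Omega>"
  shows "open (hilbert_ball g C (pt x) r)"
proof -
  have "open (\<Omega> \<inter> (\<lambda>y. hdist y x) -` {..<r})"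
    by (intro continuous_open_preimage continuous_on_hdist x open_domain) simp
  moreover have "{y\<in>\<Omega>. hdist x y < r} = \<Omega> \<inter> (\<lambda>y. hdist y x) -` {..<r}"
    using hdist_commute[OF x] by auto
  ultimately show ?thesis unfolding hilbert_ball_eq by (intro open_pt_image) simp
qed

lemma bounded_hilbert_ball: "bounded (hilbert_ball g C X r)"
proof -
  have "compact (pt ` closure \<Omega>)"
    by (intro compact_continuous_image continuous_on_pt) (use bounded_domain in \<open>simp add: compact_closure\<close>)
  moreover have "hilbert_ball g C X r \<subseteq> pt ` closure \<Omega>"
    using closure_C_subset closure_subset[of C] by (auto simp: hilbert_ball_def)
  ultimately show ?thesis using bounded_subset compact_imp_bounded by blast
qed

text \<open>The balls along the ray increase, because the ray is a geodesic; so each of them lies in the limit \<open>H\<close>.\<close>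

lemma horoball_props:
  assumes H: "horoball g C H"
  shows "interior H \<subseteq> C"
    and "\<exists>X\<in>C. \<exists>r>R. hilbert_ball g C X r \<subseteq> interior H"
proof -
  obtain X0 P where X0: "X0 \<in> C" and P: "P \<in> frontier C" and cH: "compact H" "H \<noteq> {}"
    and lim: "((\<lambda>X. hausdorff_dist (closure (hilbert_ball g C X (hilbert_dist g C X X0))) H) \<longlongrightarrow> 0)
        (at P within pt ` open_segment (co X0) (co P))"
    using H unfolding horoball_def by blast
  define x0 where "x0 = co X0"
  define u where "u = co P - x0"
  define x where "x t = x0 + t *\<^sub>R u" for t
  define ball where "ball t = hilbert_ball g C (pt (x t)) (hdist (x t) x0)" for t
  have x0: "x0 \<in> \<Omega>" "pt x0 = X0" using co_in[OF X0] X0 by (simp_all add: x0_def)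
  have p: "pt (x0 + u) = P" "x0 + u \<in> frontier \<Omega>" using frontier_C_imp[OF P] by (simp_all add: u_def)
  \<comment> \<open>Parameter 1 is the frontier point, so the ray leaves the domain there.\<close>
  have g1: "gauge x0 u = 1" using gauge_frontier[OF x0(1), of 1 u] p by simp
  have u0: "u \<noteq> 0" using g1 gauge_zero[OF x0(1)] by auto
  have x_in: "x t \<in> \<Omega>" if "0 \<le> t" "t < 1" for t
    using gauge_less_one_iff[OF x0(1), of "t *\<^sub>R u"] gauge_scale[OF x0(1), of t u] that g1 by (simp add: x_def)
  have seg: "pt (x t) \<in> pt ` open_segment (co X0) (co P)" if "0 < t" "t < 1" for t
  proof -
    have "x t \<in> open_segment (co X0) (co P)"
      unfolding in_segment using that u0
      by (intro conjI exI[of _ t]) (auto simp: x_def u_def x0_def algebra_simps)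
    then show ?thesis by blast
  qed
  \<comment> \<open>This turns the limit over the segment into one in the parameter t. The filter
    excludes P itself: the points with t < 1 lie in the open set C, and P does not.\<close>
  have flim: "filterlim (\<lambda>t. pt (x t)) (at P within pt ` open_segment (co X0) (co P)) (at_left 1)"
    unfolding filterlim_at
  proof
    have "((\<lambda>t. x t) \<longlongrightarrow> x0 + 1 *\<^sub>R u) (at_left 1)" unfolding x_def by (intro tendsto_intros)
    then show "((\<lambda>t. pt (x t)) \<longlongrightarrow> P) (at_left 1)"
      using continuous_on_tendsto_compose[OF continuous_on_pt[of UNIV]] p by force
    have "\<forall>\<^sub>F t in at_left (1::real). t \<in> {0<..<1}" by (rule eventually_at_left_real) simp
    then show "\<forall>\<^sub>F t in at_left 1. pt (x t) \<in> pt ` open_segment (co X0) (co P) \<and> pt (x t) \<noteq> P"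
    proof eventually_elim
      case (elim t)
      then have "x t \<in> \<Omega>" using x_in by simp
      then have "pt (x t) \<noteq> P" using P open_C by (auto simp: frontier_def interior_open)
      then show ?case using seg elim by simp
    qed
  qed
  have "((\<lambda>t. hausdorff_dist (closure (hilbert_ball g C (pt (x t)) (hilbert_dist g C (pt (x t)) X0))) H) \<longlongrightarrow> 0) (at_left 1)"
    by (rule filterlim_compose[OF lim flim])
  then have lim': "((\<lambda>t. hausdorff_dist (closure (ball t)) H) \<longlongrightarrow> 0) (at_left 1)"
    by (simp add: ball_def hilbert_dist_eq x0_def)
  have near: "\<exists>t. s < t \<and> 0 < t \<and> t < 1 \<and> hausdorff_dist (closure (ball t)) H < e" if "s < 1" "0 < e" for s e
  proof -
    have "\<forall>\<^sub>F t in at_left 1. t \<in> {max s 0<..<1}" by (rule eventually_at_left_real) (use that in simp)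
    moreover have "\<forall>\<^sub>F t in at_left 1. hausdorff_dist (closure (ball t)) H < e"
      using order_tendstoD(2)[OF lim' that(2)] .
    ultimately have "\<forall>\<^sub>F t in at_left 1. s < t \<and> 0 < t \<and> t < 1 \<and> hausdorff_dist (closure (ball t)) H < e"
      by eventually_elim auto
    then show ?thesis using eventually_happens' trivial_limit_at_left_real by blast
  qed
  have radius: "2 * hdist (x t) (x s) = (ln (1 + t * gauge x0 (- u)) - ln (1 - t)) - (ln (1 + s * gauge x0 (- u)) - ln (1 - s))"
    if "0 \<le> s" "s \<le> t" "t < 1" for s t
    using hdist_along_line[OF x0(1), of t u s] x_in[of t] that
    by (simp add: x_def g1 diff_divide_distrib)
  have xx0: "x 0 = x0" by (simp add: x_def)
  have mono: "ball s \<subseteq> ball t" if st: "0 \<le> s" "s \<le> t" "t < 1" for s t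
  proof -
    have "hdist (x t) x0 = hdist (x t) (x s) + hdist (x s) x0"
      using radius[of s t] radius[of 0 t] radius[of 0 s] st by (simp add: xx0)
    moreover have "hdist (x t) y \<le> hdist (x t) (x s) + hdist (x s) y" if "y \<in> \<Omega>" for y
      using hdist_triangle x_in st that by simp
    ultimately show ?thesis unfolding ball_def hilbert_ball_eq by force
  qed
  have ball_C: "ball t \<subseteq> C" for t by (auto simp: ball_def hilbert_ball_def)
  have nonempty: "ball t \<noteq> {}" if "0 < t" "t < 1" for t
  proof -
    have "x t \<noteq> x0" using u0 that by (simp add: x_def)
    then have "pt (x t) \<in> ball t" using hdist_pos[of "x t" x0] x_in that x0
      by (simp add: ball_def hilbert_ball_def hilbert_dist_eq)
    then show ?thesis by blast
  qed
  have bounded: "bounded (closure (ball t))" for t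
    unfolding ball_def by (rule bounded_closure[OF bounded_hilbert_ball])
  have bounded_H: "bounded H" using cH compact_imp_bounded by blast
  \<comment> \<open>Each point of H is arbitrarily close to balls inside C. Together with
    \<open>interior_closure_C\<close> this places the interior of H in C.\<close>
  have "H \<subseteq> closure C"
  proof
    fix h assume h: "h \<in> H"
    have "infdist h (closure C) \<le> 0 + e" if e: "e > 0" for e
    proof -
      obtain t where t: "0 < t" "t < 1" "hausdorff_dist (closure (ball t)) H < e" using near[of 0 e] e by auto
      have "infdist h (closure C) \<le> infdist h (closure (ball t))"
        using ball_C nonempty[OF t(1,2)] by (intro infdist_mono closure_mono) auto
      also have "\<dots> \<le> hausdorff_dist (closure (ball t)) H"
        using infdist_le_hausdorff_dist(2)[OF bounded bounded_H _ cH(2) h] nonempty[OF t(1,2)] by simp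
      finally show ?thesis using t by simp
    qed
    then have "infdist h (closure C) \<le> 0" by (rule field_le_epsilon)
    then have "infdist h (closure C) = 0" by (rule antisym[OF _ infdist_nonneg])
    then show "h \<in> closure C" using in_closed_iff_infdist_zero[of "closure C" h] X0 closure_subset by blast
  qed
  then show "interior H \<subseteq> C" using interior_mono interior_closure_C by blast
  \<comment> \<open>A fixed ball lies in all later ones, and among these the Hausdorff distance to
    the closed set H is arbitrarily small.\<close>
  have ball_H: "ball s \<subseteq> H" if s: "0 \<le> s" "s < 1" for s
  proof
    fix Y assume Y: "Y \<in> ball s"
    have "infdist Y H \<le> 0 + e" if e: "e > 0" for e
    proof -
      obtain t where t: "s < t" "0 < t" "t < 1" "hausdorff_dist (closure (ball t)) H < e" using near[OF s(2) e] by auto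
      have "Y \<in> closure (ball t)" using mono[of s t] s t Y closure_subset by auto
      then have "infdist Y H \<le> hausdorff_dist (closure (ball t)) H"
        using infdist_le_hausdorff_dist(1)[OF bounded bounded_H _ cH(2)] nonempty[OF t(2,3)] by simp
      then show ?thesis using t by simp
    qed
    then have "infdist Y H \<le> 0" by (rule field_le_epsilon)
    then have "infdist Y H = 0" by (rule antisym[OF _ infdist_nonneg])
    then show "Y \<in> H" using in_closed_iff_infdist_zero[OF compact_imp_closed[OF cH(1)] cH(2)] by blast
  qed
  \<comment> \<open>R' exceeds R and is positive, so that 0 < t. The choice of t gives - ln (1 - t)
    = 2 R', and the other logarithm is nonnegative, so \<open>hdist (x t) x0\<close> is at least
    R'.\<close>
  define R' where "R' = max R 0 + 1"
  define t where "t = 1 - exp (- (2 * R'))"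
  have t: "0 < t" "t < 1" by (simp_all add: t_def R'_def)
  have "0 \<le> ln (1 + t * gauge x0 (- u))"
    using t gauge_nonneg[OF x0(1)] by simp
  then have "R' \<le> hdist (x t) x0" using radius[of 0 t] t by (simp add: xx0) (simp add: t_def)
  then have "R < hdist (x t) x0" by (simp add: R'_def)
  moreover have "hilbert_ball g C (pt (x t)) (hdist (x t) x0) \<subseteq> interior H"
    using ball_H[of t] t x_in[of t] open_hilbert_ball[of "x t"] by (intro interior_maximal) (auto simp: ball_def)
  moreover have "pt (x t) \<in> C" using x_in t by simp
  ultimately show "\<exists>X\<in>C. \<exists>r>R. hilbert_ball g C X r \<subseteq> interior H" by blast
qed

section \<open>Moving compact supports into large balls\<close>

lemma hdist_bounded_on_compact:
  assumes "compact K" "K \<subseteq> C" "x \<in> \<Omega>"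
  obtains M where "\<And>P. P \<in> K \<Longrightarrow> hdist (co P) x \<le> M"
proof -
  have "continuous_on K (\<lambda>P. hdist (co P) x)"
    using co_in assms by (intro continuous_on_compose2[OF continuous_on_hdist[OF assms(3)] continuous_on_subset[OF continuous_on_co]]) auto
  then have "bounded ((\<lambda>P. hdist (co P) x) ` K)"
    using assms(1) compact_continuous_image compact_imp_bounded by blast
  then obtain M where "\<And>P. P \<in> K \<Longrightarrow> \<bar>hdist (co P) x\<bar> \<le> M" by (auto simp: bounded_iff)
  then show ?thesis using that by (meson abs_le_D1)
qed

text \<open>The radius R does not depend on X: writing X = \<gamma> k with k in the compact set K,
  the isometry induced by \<gamma> reduces all distances to those between K and S, which are bounded
  through a fixed point x.\<close>

lemma divisible_moves_compact:
  assumes div: "divisible g C" and S: "compact S" "S \<subseteq> C"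
  obtains R where "\<And>X. X \<in> C \<Longrightarrow> \<exists>T. isometry T \<and> (\<forall>P\<in>S. hdist (co X) (T (co P)) \<le> R)"
proof -
  obtain \<Gamma> where \<Gamma>: "subgroup \<Gamma> (BijGroup C)"
    "\<forall>\<gamma>\<in>\<Gamma>. \<forall>P\<in>C. \<forall>Q\<in>C. hilbert_dist g C (\<gamma> P) (\<gamma> Q) = hilbert_dist g C P Q"
    and ex: "\<exists>K\<subseteq>C. compact K \<and> (\<Union>\<gamma>\<in>\<Gamma>. \<gamma> ` K) = C"
    using div unfolding divisible_def by auto
  from ex obtain K where K: "K \<subseteq> C" "compact K" "(\<Union>\<gamma>\<in>\<Gamma>. \<gamma> ` K) = C" by auto
  show ?thesis
  proof (cases "C = {}")
    case True
    then show ?thesis using that by blast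
  next
    case False
    then obtain x where x: "x \<in> \<Omega>" using co_in by blast
    obtain M where M: "\<And>P. P \<in> K \<Longrightarrow> hdist (co P) x \<le> M" using hdist_bounded_on_compact[OF K(2,1) x] by metis
    obtain M' where M': "\<And>P. P \<in> S \<Longrightarrow> hdist (co P) x \<le> M'" using hdist_bounded_on_compact[OF S x] by metis
    show ?thesis
    proof (rule that[of "M + M'"])
      fix X assume "X \<in> C"
      then obtain \<gamma> k where \<gamma>: "\<gamma> \<in> \<Gamma>" and k: "k \<in> K" "X = \<gamma> k" using K(3) by blast
      have bij: "bij_betw \<gamma> C C"
        using subgroup.mem_carrier[OF \<Gamma>(1) \<gamma>] by (simp add: BijGroup_def Bij_def)
      define T where "T v = co (\<gamma> (pt v))" for v
      have bij_pt: "bij_betw pt \<Omega> C"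
        by (rule bij_betw_byWitness[where f' = co]) (use co_in in auto)
      have bij_co: "bij_betw co C \<Omega>"
        by (rule bij_betw_byWitness[where f' = pt]) (use co_in in auto)
      have "bij_betw (co \<circ> (\<gamma> \<circ> pt)) \<Omega> \<Omega>"
        by (intro bij_betw_trans[OF bij_betw_trans[OF bij_pt bij] bij_co])
      then have "bij_betw T \<Omega> \<Omega>" by (simp add: T_def[abs_def] o_def)
      moreover have "hdist (T v) (T w) = hdist v w" if "v \<in> \<Omega>" "w \<in> \<Omega>" for v w
        using \<Gamma>(2)[rule_format, OF \<gamma>, of "pt v" "pt w"] that by (simp add: hilbert_dist_eq T_def)
      ultimately have T: "isometry T" by (simp add: isometry_def)
      have "hdist (co X) (T (co P)) \<le> M + M'" if P: "P \<in> S" for P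
      proof -
        have in_dom: "co k \<in> \<Omega>" "co P \<in> \<Omega>" using co_in k K(1) P S(2) by auto
        have "co X = T (co k)" using k K(1) by (auto simp: T_def)
        then have "hdist (co X) (T (co P)) = hdist (co k) (co P)" using isometryD(3)[OF T in_dom] by simp
        also have "\<dots> \<le> hdist (co k) x + hdist x (co P)" by (rule hdist_triangle[OF in_dom(1) x in_dom(2)])
        also have "\<dots> \<le> M + M'" using M[OF k(1)] M'[OF P] hdist_commute[OF x in_dom(2)] by simp
        finally show ?thesis .
      qed
      then show "\<exists>T. isometry T \<and> (\<forall>P\<in>S. hdist (co X) (T (co P)) \<le> M + M')" using T by blast
    qed
  qed
qed

text \<open>The new function is f composed with the inverse of \<open>T\<close>. The Lipschitz
  constant is unchanged, and its support is contained in the compact image under \<open>T\<close> of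
  the support of f.\<close>

lemma transport_test_function:
  assumes f: "f \<in> test_functions g C C" and T: "isometry T"
    and U: "\<And>P. P \<in> closure {P \<in> C. f P \<noteq> 0} \<Longrightarrow> pt (T (co P)) \<in> U"
  obtains f' where "f' \<in> test_functions g C U"
    "rayleigh_quotient \<Omega> (f' \<circ> pt) \<le> rayleigh_quotient \<Omega> (f \<circ> pt)"
proof -
  define S where "S = inv_into \<Omega> T"
  have S: "isometry S" unfolding S_def by (rule isometry_inverse[OF T])
  define f' where "f' P = f (pt (S (co P)))" for P
  define Z where "Z = closure {P \<in> C. f P \<noteq> 0}"
  obtain L P0 where L: "\<And>P Q. P \<in> C \<Longrightarrow> Q \<in> C \<Longrightarrow> \<bar>f P - f Q\<bar> \<le> L * hilbert_dist g C P Q"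
    and P0: "P0 \<in> C" "f P0 \<noteq> 0" and Z: "compact Z" "Z \<subseteq> C"
    using f unfolding test_functions_def Z_def by blast
  have S_in: "S (co P) \<in> \<Omega>" if "P \<in> C" for P using isometryD(2)[OF S co_in[OF that]] .
  have lip: "\<bar>f' P - f' Q\<bar> \<le> L * hilbert_dist g C P Q" if "P \<in> C" "Q \<in> C" for P Q
    using L[of "pt (S (co P))" "pt (S (co Q))"] S_in that isometryD(3)[OF S co_in[OF that(1)] co_in[OF that(2)]]
    by (simp add: f'_def hilbert_dist_eq)
  have nz: "pt (T (co P0)) \<in> C" "f' (pt (T (co P0))) \<noteq> 0"
    using P0 co_in isometryD(2)[OF T] isometry_inverse_apply(3)[OF T] by (simp_all add: f'_def S_def)
  define W where "W = (\<lambda>P. pt (T (co P))) ` Z"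
  have "continuous_on Z (\<lambda>P. pt (T (co P)))"
    using co_in Z(2)
    by (intro continuous_on_compose2[OF continuous_on_pt[of UNIV]]
        continuous_on_compose2[OF isometry_continuous_on[OF T]] continuous_on_subset[OF continuous_on_co]) auto
  then have W: "compact W" unfolding W_def using Z(1) by (rule compact_continuous_image)
  have "{P \<in> C. f' P \<noteq> 0} \<subseteq> W"
  proof
    fix P assume P: "P \<in> {P \<in> C. f' P \<noteq> 0}"
    then have "pt (S (co P)) \<in> Z"
      unfolding Z_def using S_in by (intro subsetD[OF closure_subset]) (auto simp: f'_def)
    moreover have "P = pt (T (co (pt (S (co P)))))"
      using P co_in isometry_inverse_apply(2)[OF T] by (simp add: S_def)
    ultimately show "P \<in> W" unfolding W_def by blast
  qed
  then have sub: "closure {P \<in> C. f' P \<noteq> 0} \<subseteq> W" by (intro closure_minimal compact_imp_closed W)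
  have "compact (closure {P \<in> C. f' P \<noteq> 0} \<inter> W)" by (rule closed_Int_compact[OF closed_closure W])
  then have "compact (closure {P \<in> C. f' P \<noteq> 0})" using sub by (simp add: Int_absorb2)
  moreover have "W \<subseteq> U" using U by (auto simp: W_def Z_def)
  ultimately have "f' \<in> test_functions g C U"
    unfolding test_functions_def using lip nz sub by blast
  moreover have "rayleigh_quotient \<Omega> (f' \<circ> pt) \<le> rayleigh_quotient \<Omega> (f \<circ> pt)"
    by (rule rayleigh_quotient_isometry_le[OF S]) (simp add: f'_def)
  ultimately show ?thesis by (rule that)
qed

lemma lambda1_eq_lambda1_horoball:
  assumes div: "divisible g C" and H: "horoball g C H"
  shows "lambda1 g C = lambda1_horoball g C H"
proof (rule antisym)
  have "test_functions g C (interior H) \<subseteq> test_functions g C C"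
    using horoball_props(1)[OF H] by (auto simp: test_functions_def)
  then show "lambda1 g C \<le> lambda1_horoball g C H"
    unfolding lambda1_def lambda1_horoball_def lambda1_on_def by (rule INF_superset_mono) simp
  show "lambda1_horoball g C H \<le> lambda1 g C"
    unfolding lambda1_def lambda1_horoball_def lambda1_on_def
  proof (rule INF_greatest)
    fix f assume f: "f \<in> test_functions g C C"
    define Z where "Z = closure {P \<in> C. f P \<noteq> 0}"
    have Z: "compact Z" "Z \<subseteq> C" using f by (auto simp: test_functions_def Z_def)
    obtain R where R: "\<And>X. X \<in> C \<Longrightarrow> \<exists>T. isometry T \<and> (\<forall>P\<in>Z. hdist (co X) (T (co P)) \<le> R)"
      using divisible_moves_compact[OF div Z] by metis
    obtain X r where X: "X \<in> C" "R < r" "hilbert_ball g C X r \<subseteq> interior H"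
      using horoball_props(2)[OF H] by metis
    obtain T where T: "isometry T" "\<And>P. P \<in> Z \<Longrightarrow> hdist (co X) (T (co P)) \<le> R"
      using R[OF X(1)] by blast
    have "pt (T (co P)) \<in> interior H" if P: "P \<in> Z" for P
    proof -
      have "T (co P) \<in> \<Omega>" using isometryD(2)[OF T(1)] co_in P Z(2) by blast
      then have "pt (T (co P)) \<in> hilbert_ball g C X r"
        using T(2)[OF P] X(2) by (simp add: hilbert_ball_def hilbert_dist_eq)
      then show ?thesis using X(3) by blast
    qed
    then have U: "\<And>P. P \<in> closure {P \<in> C. f P \<noteq> 0} \<Longrightarrow> pt (T (co P)) \<in> interior H"
      unfolding Z_def .
    obtain f' where "f' \<in> test_functions g C (interior H)"
      "rayleigh_quotient \<Omega> (f' \<circ> pt) \<le> rayleigh_quotient \<Omega> (f \<circ> pt)"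
      by (rule transport_test_function[OF f T(1) U])
    show "(INF f\<in>test_functions g C (interior H). rayleigh_quotient \<Omega> (f \<circ> pt)) \<le> rayleigh_quotient \<Omega> (f \<circ> pt)"
      by (rule INF_lower2[of f']) fact+
  qed
qed

end

theorem proposition8:
  fixes C H :: "'n::finite projective set"
    and g :: "'n chart"
  assumes "properly_open_convex C"
    and "adapted_chart g C"
    and "divisible g C"
    and "horoball g C H"
  shows "lambda1 g C = lambda1_horoball g C H"
proof -
  interpret hilbert_chart g C by unfold_locales (rule assms)
  show ?thesis by (rule lambda1_eq_lambda1_horoball) (fact assms)+
qed

end
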